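(* Let $G$ be a unicyclic graph on $n$ vertices $\{x_1,\ldots,x_n\}$ with girth $m$, let $\mathbb{K}$ be a field and $R=\mathbb{K}[x_1,\ldots,x_n]$. (1) If $m$ is not a multiple of $3$, then $\beta_{i,\mathbf{a}}^R(R/I(G))\in\{0,1\}$ for all $i\ge1$ and $\mathbf{a}\in\mathbb{N}^n$. (2) If $m=3k$, then $\beta_{i,\mathbf{a}}^R(R/I(G))\in\{0,1,2\}$ for all $i\ge 1$ and $\mathbf{a}\in\mathbb{N}^n$. If, furthermore, every vertex of $G$ is at distance at most two from the unique cycle $C_m$ in $G$, then $\beta_{i,\mathbf{a}}^R(R/I(G))=2$ if and only if $i=2k$ and $\mathbf{a}=\sum_{x\in V(C_m)}\mathbf{e}_x$.
   Context: A block of a graph is a maximal nontrivial connected induced subgraph which has no cut vertex; a (finite simple) graph is unicyclic if exactly one of its blocks is a cycle and each other block is an edge. The girth of a unicyclic graph is the length of its unique induced cycle. $I(G)=(x_ix_j:\{x_i,x_j\}\in E(G))\subset R$ is the edge ideal. $R$ is $\mathbb{N}^n$-graded ($0\in\mathbb{N}$) with $\deg x_i=\mathbf{e}_i$, the $i$-th standard basis vector, and $\mathbf{e}_u=\mathbf{e}_i$ if $u=x_i$. $\beta_{i,\mathbf{a}}^R$ denotes the $\mathbb{N}^n$-graded (multigraded) Betti numbers. *)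

theory Defs
  imports
    "HOL-Library.Poly_Mapping"
    "HOL-Library.Extended_Nat"
    "Jordan_Normal_Form.Matrix_Kernel"
begin

section \<open>Graphs\<close>

text \<open>A finite simple graph has as vertex set the whole (finite) type \<open>'v\<close>, and is given by its
  set \<open>E\<close> of two-element edges. The induced subgraph on a vertex set \<open>W\<close> is represented by \<open>W\<close>.\<close>

definition simple_graph :: "'v set set \<Rightarrow> bool" where
  "simple_graph E \<longleftrightarrow> (\<forall>e\<in>E. card e = 2)"

definition adj_on :: "'v set set \<Rightarrow> 'v set \<Rightarrow> 'v rel" where
  "adj_on E W = {(u, v). u \<in> W \<and> v \<in> W \<and> {u, v} \<in> E}"

definition connected_on :: "'v set set \<Rightarrow> 'v set \<Rightarrow> bool" where
  "connected_on E W \<longleftrightarrow> (\<forall>u\<in>W. \<forall>v\<in>W. (u, v) \<in> (adj_on E W)\<^sup>*)"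

text \<open>Only used when the induced subgraph on \<open>W\<close> is connected.\<close>

definition cut_vertex :: "'v set set \<Rightarrow> 'v set \<Rightarrow> 'v \<Rightarrow> bool" where
  "cut_vertex E W v \<longleftrightarrow> v \<in> W \<and> \<not> connected_on E (W - {v})"

definition nonseparable :: "'v set set \<Rightarrow> 'v set \<Rightarrow> bool" where
  "nonseparable E W \<longleftrightarrow> card W \<ge> 2 \<and> connected_on E W \<and> (\<forall>v. \<not> cut_vertex E W v)"

definition block :: "'v set set \<Rightarrow> 'v set \<Rightarrow> bool" where
  "block E W \<longleftrightarrow> nonseparable E W \<and> (\<forall>W'. nonseparable E W' \<and> W \<subseteq> W' \<longrightarrow> W' = W)"

definition induces_cycle :: "'v set set \<Rightarrow> 'v set \<Rightarrow> bool" where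
  "induces_cycle E W \<longleftrightarrow>
    (\<exists>vs. distinct vs \<and> length vs \<ge> 3 \<and> set vs = W \<and>
       {e \<in> E. e \<subseteq> W} = {{vs ! i, vs ! ((i + 1) mod length vs)} | i. i < length vs})"

definition unicyclic :: "'v::finite set set \<Rightarrow> bool" where
  "unicyclic E \<longleftrightarrow> simple_graph E \<and>
     (\<exists>!W. block E W \<and> induces_cycle E W) \<and>
     (\<forall>W. block E W \<and> \<not> induces_cycle E W \<longrightarrow> W \<in> E)"

definition the_cycle :: "'v::finite set set \<Rightarrow> 'v set" where
  "the_cycle E = (THE C. induces_cycle E C)"

definition girth :: "'v::finite set set \<Rightarrow> nat" where
  "girth E = card (the_cycle E)"

text \<open>The distance between vertices of different components is \<open>\<infinity>\<close>.\<close>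

definition graph_dist :: "'v set set \<Rightarrow> 'v \<Rightarrow> 'v \<Rightarrow> enat" where
  "graph_dist E u v = (INF l\<in>{l. (u, v) \<in> adj_on E UNIV ^^ l}. enat l)"

definition dist_to_set :: "'v set set \<Rightarrow> 'v \<Rightarrow> 'v set \<Rightarrow> enat" where
  "dist_to_set E v C = (INF c\<in>C. graph_dist E v c)"


section \<open>Polynomial ring and edge ideal\<close>

text \<open>\<open>('v, 'k) mpoly\<close> is the polynomial ring \<open>R\<close> over \<open>'k\<close> with one indeterminate for each element
  of \<open>'v\<close>; exponents of monomials and multidegrees both have type \<open>'v mdeg\<close>, that is \<open>\<nat>\<^sup>n\<close>.\<close>

type_synonym 'v mdeg = "('v, nat) poly_mapping"
type_synonym ('v, 'k) mpoly = "('v mdeg, 'k) poly_mapping"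

definition unit_deg :: "'v \<Rightarrow> 'v mdeg" where
  "unit_deg x = Poly_Mapping.single x 1"

definition indet :: "'v \<Rightarrow> ('v, 'k::field) mpoly" where
  "indet x = Poly_Mapping.single (unit_deg x) 1"

definition edge_ideal :: "'v::finite set set \<Rightarrow> ('v, 'k::field) mpoly set" where
  "edge_ideal E = Modules.module.span (*) {indet x * indet y | x y. {x, y} \<in> E}"


section \<open>Minimal multigraded free resolutions and Betti numbers\<close>

text \<open>A list \<open>S\<close> of multidegrees stands for the multigraded free module \<open>\<Oplus>\<^sub>j R(- S ! j)\<close>, whose
  \<open>j\<close>-th basis element has degree \<open>S ! j\<close>. A matrix \<open>A\<close> defines a degree-preserving map from the
  module of \<open>S\<close> to the module of \<open>T\<close> iff its entry at \<open>(k, j)\<close> is homogeneous of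
  degree \<open>S ! j - T ! k\<close> (hence zero if this is not in \<open>\<nat>\<^sup>n\<close>).\<close>

definition multigraded_map ::
    "'v mdeg list \<Rightarrow> 'v mdeg list \<Rightarrow> ('v, 'k::field) mpoly mat \<Rightarrow> bool" where
  "multigraded_map S T A \<longleftrightarrow> A \<in> carrier_mat (length T) (length S) \<and>
     (\<forall>k<length T. \<forall>j<length S. \<forall>t\<in>Poly_Mapping.keys (A $$ (k, j)). t + T ! k = S ! j)"

definition mat_range :: "'a::semiring_0 mat \<Rightarrow> 'a vec set" where
  "mat_range A = (\<lambda>v. A *\<^sub>v v) ` carrier_vec (dim_col A)"

text \<open>\<open>minimal_resolution I F D\<close>: the modules \<open>F\<^sub>i\<close> given by \<open>F i\<close> form a minimal multigraded free
  resolution \<open>\<dots> \<rightarrow> F\<^sub>2 \<rightarrow> F\<^sub>1 \<rightarrow> F\<^sub>0 \<rightarrow> R/I \<rightarrow> 0\<close> of \<open>R/I\<close>. The differential \<open>F\<^sub>i\<^sub>+\<^sub>1 \<rightarrow> F\<^sub>i\<close> is \<open>D (Suc i)\<close>.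
  The augmentation \<open>F\<^sub>0 \<rightarrow> R/I\<close> is given by a lift \<open>D 0\<close> to a one-row matrix \<open>F\<^sub>0 \<rightarrow> R\<close>, so that
  surjectivity and kernel are taken modulo \<open>I\<close>. Minimality requires that the entries of the
  differentials lie in the ideal generated by the indeterminates, i.e. have no constant term.\<close>

definition minimal_resolution ::
    "('v, 'k::field) mpoly set \<Rightarrow> (nat \<Rightarrow> 'v mdeg list) \<Rightarrow> (nat \<Rightarrow> ('v, 'k) mpoly mat) \<Rightarrow> bool" where
  "minimal_resolution I F D \<longleftrightarrow>
     multigraded_map (F 0) [0] (D 0) \<and>
     (\<forall>i. multigraded_map (F (Suc i)) (F i) (D (Suc i))) \<and>
     (\<forall>p. \<exists>v\<in>carrier_vec (length (F 0)). p - (D 0 *\<^sub>v v) $ 0 \<in> I) \<and>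
     {v \<in> carrier_vec (length (F 0)). (D 0 *\<^sub>v v) $ 0 \<in> I} = mat_range (D 1) \<and>
     (\<forall>i. mat_kernel (D (Suc i)) = mat_range (D (Suc (Suc i)))) \<and>
     (\<forall>i. \<forall>k<length (F i). \<forall>j<length (F (Suc i)).
        Poly_Mapping.lookup (D (Suc i) $$ (k, j)) 0 = 0)"

text \<open>\<open>betti I i a\<close> is the multigraded Betti number \<open>\<beta>\<^sub>i\<^sub>,\<^sub>a(R/I)\<close>: the number of basis elements
  of degree \<open>a\<close> in the \<open>i\<close>-th module of a minimal multigraded free resolution of \<open>R/I\<close>, which for a
  monomial ideal \<open>I\<close> exists and is unique up to isomorphism.\<close>

definition betti :: "('v::finite, 'k::field) mpoly set \<Rightarrow> nat \<Rightarrow> 'v mdeg \<Rightarrow> nat" where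
  "betti I i a = (THE b. \<exists>F D. minimal_resolution I F D \<and> b = count_list (F i) a)"

end

theory Submission
  imports Defs "HOL-Library.Function_Algebras"
begin

text \<open>
  A multigraded map of free modules is a matrix of scalars between generators with degrees, and
  multiplication by monomials becomes inclusion. For a resolution of \<open>R/I\<close>, keep only the generators of
  degree \<open>\<le> c\<close> whose degree equals \<open>c\<close> on a set \<open>X\<close> of variables: the homology of this complex is
  \<open>Tor\<^sub>i(R/I, R/(x\<^sub>v. v \<in> X))\<^sub>c\<close>, which for \<open>X = \<emptyset>\<close> is \<open>(R/I)\<^sub>c\<close> and for the set of all variables counts, by
  minimality, the generators of degree \<open>c\<close>. Adding one variable at a time to \<open>X\<close> gives long exact
  sequences, hence \<open>\<beta>\<^sub>i\<^sub>,\<^sub>c = 0\<close> for \<open>c\<close> not squarefree, and for \<open>u \<in> W\<close> with \<open>d\<close> neighbors in \<open>W\<close> an exact sequence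
  \<open>\<beta>\<^sub>i(W - u) \<rightarrow> \<beta>\<^sub>i\<^sub>-\<^sub>d(W - N[u]) \<rightarrow> \<beta>\<^sub>i(W) \<rightarrow> \<beta>\<^sub>i\<^sub>-\<^sub>1(W - u)\<close>. If \<open>u\<close> is the neighbor of a leaf in \<open>W\<close>, the outer
  terms vanish. So leaves can be stripped together with their neighbors' neighborhoods: forests have
  total Betti number at most 1 in degree \<open>W\<close>, and for a cycle the sequence reduces to paths. If \<open>W\<close>
  properly contains the cycle and all vertices are at distance at most two from it, then stripping
  one leaf already destroys the cycle.
\<close>

section \<open>Ranks of block matrices\<close>

text \<open>\<open>betti\<close> is a definite description, so before any bound on it can be proved,
  a minimal resolution must be built and its counts shown to be independent of the choice.
  Uniqueness comes out of the computation itself: the recursions hold in an arbitrary minimal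
  resolution, and for a unicyclic graph they (empty set, isolated vertex, leaf, whole cycle) reach
  every vertex set and so determine the numbers. Existence is obtained in squarefree degrees: these
  are the subsets of a finite vertex set, and minimal generators can be picked subset by subset.
  Homology never appears as a quotient space. Only ranks are kept, and a long exact sequence is
  recorded by the ranks \<open>\<delta>\<close> of its connecting maps, bounded by the dimensions on
  both sides. Such bounds settle a term once a neighboring term vanishes, so vanishing terms carry
  the argument. Dimensions alone do not decide when multiplication by a variable maps one line of
  R/I to another; there surjectivity is shown by an explicit lift.\<close>

context vector_space
begin

text \<open>The space of functions on the naturals is infinite-dimensional, so dimension statements
  carry a finite \<open>T\<close> whose span contains the subspace; this makes the nested bases
  finite.\<close>

lemma finite_basis_extend:
  assumes "subspace A" "A \<subseteq> span T" "finite T" "S \<subseteq> A" "independent S"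
  obtains B where "S \<subseteq> B" "B \<subseteq> A" "independent B" "finite B" "span B = A" "dim A = card B"
proof -
  obtain B where B: "S \<subseteq> B" "B \<subseteq> A" "independent B" "A \<subseteq> span B"
    using maximal_independent_subset_extend[OF assms(4,5)] by blast
  have "finite B"
    using independent_span_bound[OF assms(3) B(3)] B(2) assms(2) by blast
  moreover have "span B = A"
    using B assms(1) by (simp add: span_minimal subset_antisym)
  moreover have "dim A = card B"
    using B by (simp add: dim_unique)
  ultimately show thesis using B that by blast
qed

lemma finite_dim_mono:
  assumes "subspace A" "subspace B" "A \<subseteq> B" "B \<subseteq> span T" "finite T"
  shows "dim A \<le> dim B"
proof -
  obtain S where S: "S \<subseteq> A" "independent S" "span S = A" "dim A = card S"
    by (rule finite_basis_extend[OF assms(1) subset_trans[OF assms(3,4)] assms(5) empty_subsetI independent_empty])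
  obtain S' where "S \<subseteq> S'" "finite S'" "dim B = card S'"
    by (rule finite_basis_extend[OF assms(2,4,5) subset_trans[OF S(1) assms(3)] S(2)])
  then show ?thesis using S(4) by (simp add: card_mono)
qed

lemma independent_span_Int:
  assumes "independent B" "finite B" "B0 \<subseteq> B" "x \<in> span B0" "x \<in> span (B - B0)"
  shows "x = 0"
proof -
  have fin: "finite B0" "finite (B - B0)" using assms(2,3) finite_subset by auto
  obtain u where u: "x = (\<Sum>b\<in>B0. scale (u b) b)"
    using assms(4) span_finite[OF fin(1)] by auto
  obtain w where w: "x = (\<Sum>b\<in>B-B0. scale (w b) b)"
    using assms(5) span_finite[OF fin(2)] by auto
  define c where "c b = (if b \<in> B0 then u b else - w b)" for b
  have "(\<Sum>b\<in>B. scale (c b) b) = (\<Sum>b\<in>B0. scale (c b) b) + (\<Sum>b\<in>B-B0. scale (c b) b)"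
    using sum.subset_diff[OF assms(3,2)] by (simp add: add.commute)
  also have "(\<Sum>b\<in>B0. scale (c b) b) = x"
    unfolding u by (rule sum.cong) (auto simp: c_def)
  also have "(\<Sum>b\<in>B-B0. scale (c b) b) = - x"
    unfolding w sum_negf[symmetric] by (rule sum.cong) (auto simp: c_def)
  finally have "(\<Sum>b\<in>B. scale (c b) b) = 0" by simp
  then have "c b = 0" if "b \<in> B" for b
    using independentD[OF assms(1,2) subset_refl] that by blast
  then have "u b = 0" if "b \<in> B0" for b
    using that assms(3) c_def by (metis subsetD)
  then show ?thesis using u by simp
qed

lemma rank_nullity:
  assumes "Vector_Spaces.linear scale scale f" "subspace A" "A \<subseteq> span T" "finite T"
  shows "dim A = dim {x \<in> A. f x = 0} + dim (f ` A)"
proof -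
  interpret vector_space_pair scale scale ..
  have sK: "subspace {x \<in> A. f x = 0}"
    using subspace_inter[OF assms(2) linear_subspace_kernel[OF assms(1)]]
    by (simp add: Collect_conj_eq)
  obtain B0 where B0: "B0 \<subseteq> {x \<in> A. f x = 0}" "independent B0" "span B0 = {x \<in> A. f x = 0}"
      "dim {x \<in> A. f x = 0} = card B0"
    by (rule finite_basis_extend[OF sK subset_trans[OF Collect_restrict assms(3)] assms(4)
          empty_subsetI independent_empty])
  obtain B where B: "B0 \<subseteq> B" "B \<subseteq> A" "independent B" "finite B" "span B = A" "dim A = card B"
    by (rule finite_basis_extend[OF assms(2-4) subset_trans[OF B0(1) Collect_restrict] B0(2)])
  have span_sub: "span (B - B0) \<subseteq> A"
    using B(5) span_mono[of "B - B0" B] by auto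
  have inj: "inj_on f (span (B - B0))"
  proof (rule inj_onI)
    fix x y assume xy: "x \<in> span (B - B0)" "y \<in> span (B - B0)" "f x = f y"
    have d: "x - y \<in> span (B - B0)" using xy span_diff by blast
    then have "x - y \<in> span B0"
      unfolding B0(3) using span_sub xy(3) linear_diff[OF assms(1), of x y] by auto
    then show "x = y"
      using independent_span_Int[OF B(3,4,1) _ d] by simp
  qed
  have ind: "independent (f ` (B - B0))"
    using linear_independent_injective_image[OF assms(1) _ inj] independent_mono[OF B(3), of "B - B0"]
    by blast
  have "f ` A \<subseteq> span (f ` (B - B0))"
  proof
    fix y assume "y \<in> f ` A"
    then have "y \<in> span (f ` B)"
      using B(5) linear_span_image[OF assms(1), of B] by simp
    also have "span (f ` B) \<subseteq> span (f ` (B - B0))"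
    proof (rule span_minimal)
      show "f ` B \<subseteq> span (f ` (B - B0))"
      proof
        fix z assume "z \<in> f ` B"
        then obtain b where b: "b \<in> B" "z = f b" by blast
        show "z \<in> span (f ` (B - B0))"
        proof (cases "b \<in> B0")
          case True
          then have "z = 0" using b B0(1) by auto
          then show ?thesis by (simp add: span_zero)
        next
          case False
          then show ?thesis using b by (intro span_base) blast
        qed
      qed
    qed simp
    finally show "y \<in> span (f ` (B - B0))" .
  qed
  moreover have "f ` (B - B0) \<subseteq> f ` A" using B(2) by blast
  ultimately have "dim (f ` A) = card (f ` (B - B0))"
    using ind by (simp add: dim_unique)
  also have "\<dots> = card (B - B0)"
    using inj by (intro card_image) (meson inj_on_subset span_superset)
  also have "\<dots> = card B - card B0"
    using B(1,4) by (intro card_Diff_subset) (auto intro: finite_subset)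
  finally show ?thesis
    using B0(4) B(1,4,6) by (simp add: card_mono)
qed

end

section \<open>Coordinate spaces and matrices on sets of indices\<close>

definition fscale :: "'k::field \<Rightarrow> (nat \<Rightarrow> 'k) \<Rightarrow> nat \<Rightarrow> 'k" where
  "fscale c x = (\<lambda>j. c * x j)"

lemma fscale_apply [simp]: "fscale c x j = c * x j"
  by (simp add: fscale_def)

global_interpretation fv: vector_space fscale
  by unfold_locales (auto simp: fun_eq_iff algebra_simps)

lemma sum_fun_apply: "(\<Sum>i\<in>A. f i) x = (\<Sum>i\<in>A. f i x)"
  by (induction A rule: infinite_finite_induct) auto

definition vsupp :: "nat set \<Rightarrow> (nat \<Rightarrow> 'k::field) set" where
  "vsupp A = {x. \<forall>j. j \<notin> A \<longrightarrow> x j = 0}"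

definition uvec :: "nat \<Rightarrow> nat \<Rightarrow> 'k::field" where
  "uvec i = (\<lambda>j. if j = i then 1 else 0)"

lemma subspace_vsupp: "fv.subspace (vsupp A)"
  by (rule fv.subspaceI) (auto simp: vsupp_def)

lemma vsupp_mono: "A \<subseteq> B \<Longrightarrow> vsupp A \<subseteq> vsupp B"
  by (auto simp: vsupp_def)

lemma vsupp_expand:
  assumes "finite A" "x \<in> vsupp A"
  shows "x = (\<Sum>i\<in>A. fscale (x i) (uvec i))"
proof
  fix j
  have "(\<Sum>i\<in>A. fscale (x i) (uvec i) j) = (\<Sum>i\<in>A. if j = i then x i else 0)"
    by (rule sum.cong) (auto simp: uvec_def)
  also have "\<dots> = x j"
    using assms by (auto simp: vsupp_def)
  finally show "x j = (\<Sum>i\<in>A. fscale (x i) (uvec i)) j"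
    by (simp add: sum_fun_apply)
qed

lemma vsupp_subset_span: "finite A \<Longrightarrow> vsupp A \<subseteq> fv.span (uvec ` A)"
  by (rule subsetI, subst vsupp_expand) (auto intro: fv.span_sum fv.span_scale fv.span_base)

lemma dim_vsupp:
  assumes "finite A"
  shows "fv.dim (vsupp A :: (nat \<Rightarrow> 'k::field) set) = card A"
proof -
  have inj: "inj_on (uvec :: nat \<Rightarrow> nat \<Rightarrow> 'k) A"
    by (rule inj_onI) (metis uvec_def zero_neq_one)
  have "fv.independent (uvec ` A :: (nat \<Rightarrow> 'k) set)"
  proof (rule fv.independent_if_scalars_zero)
    fix f :: "(nat \<Rightarrow> 'k) \<Rightarrow> 'k" and x :: "nat \<Rightarrow> 'k"
    assume s: "(\<Sum>x\<in>uvec ` A. fscale (f x) x) = 0" and x: "x \<in> uvec ` A"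
    then obtain i where i: "i \<in> A" "x = uvec i" by blast
    have "0 = (\<Sum>j\<in>A. fscale (f (uvec j)) (uvec j)) i"
      using s by (simp add: sum.reindex[OF inj])
    also have "\<dots> = (\<Sum>j\<in>A. if i = j then f (uvec j) else 0)"
      unfolding sum_fun_apply by (rule sum.cong) (auto simp: uvec_def)
    also have "\<dots> = f x" using i assms by simp
    finally show "f x = 0" by simp
  qed (use assms in auto)
  moreover have "(uvec ` A :: (nat \<Rightarrow> 'k) set) \<subseteq> vsupp A"
    by (auto simp: vsupp_def uvec_def)
  ultimately show ?thesis
    by (intro fv.dim_unique[OF _ vsupp_subset_span[OF assms] _ card_image[OF inj]])
qed

text \<open>The index sets are parameters, so one coefficient function \<open>C\<close> serves a
  complex, its subcomplexes and its quotients: passing between them only changes \<open>A\<close>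
  and \<open>B\<close>. Values outside \<open>B\<close> are 0, so that all vectors live in one
  type.\<close>

definition mapp :: "(nat \<Rightarrow> nat \<Rightarrow> 'k::field) \<Rightarrow> nat set \<Rightarrow> nat set \<Rightarrow> (nat \<Rightarrow> 'k) \<Rightarrow> nat \<Rightarrow> 'k" where
  "mapp C B A x = (\<lambda>k. if k \<in> B then (\<Sum>j\<in>A. C k j * x j) else 0)"

definition mker :: "(nat \<Rightarrow> nat \<Rightarrow> 'k::field) \<Rightarrow> nat set \<Rightarrow> nat set \<Rightarrow> (nat \<Rightarrow> 'k) set" where
  "mker C B A = {x \<in> vsupp A. mapp C B A x = 0}"

definition mrank :: "(nat \<Rightarrow> nat \<Rightarrow> 'k::field) \<Rightarrow> nat set \<Rightarrow> nat set \<Rightarrow> nat" where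
  "mrank C B A = fv.dim (mapp C B A ` vsupp A)"

lemma linear_mapp: "Vector_Spaces.linear fscale fscale (mapp C B A)"
proof -
  interpret vector_space_pair fscale fscale ..
  show ?thesis
    by (auto simp: Vector_Spaces.linear_iff fv.vector_space_axioms mapp_def fun_eq_iff sum.distrib
        sum_distrib_left distrib_left intro!: sum.cong)
qed

lemma subspace_mker: "fv.subspace (mker C B A)"
proof -
  interpret vector_space_pair fscale fscale ..
  have "mker C B A = vsupp A \<inter> {x. mapp C B A x = 0}"
    unfolding mker_def by blast
  then show ?thesis
    using fv.subspace_inter[OF subspace_vsupp linear_subspace_kernel[OF linear_mapp]] by simp
qed

lemma subspace_mapp_image:
  assumes "fv.subspace S"
  shows "fv.subspace (mapp C B A ` S)"
proof -
  interpret vector_space_pair fscale fscale ..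
  show ?thesis
    by (rule linear_subspace_image[OF linear_mapp assms])
qed

lemma mapp_vsupp: "mapp C B A x \<in> vsupp B"
  by (auto simp: mapp_def vsupp_def)

lemma dim_vsupp_mono:
  assumes "finite A" "fv.subspace S" "fv.subspace T" "S \<subseteq> T" "T \<subseteq> vsupp A"
  shows "fv.dim S \<le> fv.dim T"
  using fv.finite_dim_mono[OF assms(2-4) subset_trans[OF assms(5) vsupp_subset_span[OF assms(1)]]] assms(1)
  by simp

lemma mrank_nullity:
  assumes "finite A"
  shows "card A = fv.dim (mker C B A) + mrank C B A"
  using fv.rank_nullity[OF linear_mapp subspace_vsupp vsupp_subset_span[OF assms], of C B A]
    assms by (simp add: dim_vsupp mker_def mrank_def)

definition proj :: "nat set \<Rightarrow> (nat \<Rightarrow> 'k::field) \<Rightarrow> nat \<Rightarrow> 'k" where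
  "proj A x = (\<lambda>j. if j \<in> A then x j else 0)"

lemma linear_proj: "Vector_Spaces.linear fscale fscale (proj A)"
proof -
  interpret vector_space_pair fscale fscale ..
  show ?thesis
    by (simp add: Vector_Spaces.linear_iff fv.vector_space_axioms proj_def fun_eq_iff)
qed

lemma proj_rank_nullity:
  assumes "finite A" "fv.subspace S" "S \<subseteq> vsupp A"
  shows "fv.dim S = fv.dim {x \<in> S. proj D x = 0} + fv.dim (proj D ` S)"
  using fv.rank_nullity[OF linear_proj assms(2) subset_trans[OF assms(3) vsupp_subset_span[OF assms(1)]]] assms(1)
  by simp

lemma subspace_proj_image:
  assumes "fv.subspace S"
  shows "fv.subspace (proj D ` S)"
proof -
  interpret vector_space_pair fscale fscale ..
  show ?thesis
    by (rule linear_subspace_image[OF linear_proj assms])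
qed

lemma subspace_proj_ker:
  assumes "fv.subspace S"
  shows "fv.subspace {x \<in> S. proj D x = 0}"
proof -
  interpret vector_space_pair fscale fscale ..
  have "{x \<in> S. proj D x = 0} = S \<inter> {x. proj D x = 0}" by blast
  then show ?thesis
    using fv.subspace_inter[OF assms linear_subspace_kernel[OF linear_proj[of D]]] by simp
qed

text \<open>One differential of a complex with a subcomplex, spanned by the basis elements in \<open>A'\<close> and \<open>B'\<close>.\<close>

locale block_matrix =
  fixes C :: "nat \<Rightarrow> nat \<Rightarrow> 'k::field" and A' A'' B' B'' :: "nat set"
  assumes fin: "finite A'" "finite A''" "finite B'" "finite B''"
    and disj: "A' \<inter> A'' = {}" "B' \<inter> B'' = {}"
    and zero: "\<And>k j. j \<in> A' \<Longrightarrow> k \<in> B'' \<Longrightarrow> C k j = 0"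
begin

lemma proj_mapp: "proj B'' (mapp C (B' \<union> B'') (A' \<union> A'') x) = mapp C B'' A'' (proj A'' x)"
proof -
  have "(\<Sum>j\<in>A' \<union> A''. C k j * x j) = (\<Sum>j\<in>A''. C k j * proj A'' x j)" if "k \<in> B''" for k
    using zero[OF _ that] fin disj by (simp add: sum.union_disjoint proj_def)
  then show ?thesis
    by (intro ext) (simp add: proj_def[of B''] mapp_def)
qed

lemma mapp_sub: "x \<in> vsupp A' \<Longrightarrow> mapp C (B' \<union> B'') (A' \<union> A'') x = mapp C B' A' x"
proof -
  assume x: "x \<in> vsupp A'"
  then have *: "(\<Sum>j\<in>A' \<union> A''. C k j * x j) = (\<Sum>j\<in>A'. C k j * x j)" for k
    using fin disj by (intro sum.mono_neutral_right) (auto simp: vsupp_def)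
  have "(\<Sum>j\<in>A'. C k j * x j) = 0" if "k \<in> B''" for k
    using zero that by simp
  then show "mapp C (B' \<union> B'') (A' \<union> A'') x = mapp C B' A' x"
    by (intro ext) (simp add: mapp_def *)
qed

lemma proj_image: "proj B'' ` mapp C (B' \<union> B'') (A' \<union> A'') ` vsupp (A' \<union> A'') = mapp C B'' A'' ` vsupp A''"
proof -
  have "proj A'' ` vsupp (A' \<union> A'') = (vsupp A'' :: (nat \<Rightarrow> 'k) set)"
  proof
    show "(vsupp A'' :: (nat \<Rightarrow> 'k) set) \<subseteq> proj A'' ` vsupp (A' \<union> A'')"
    proof
      fix x :: "nat \<Rightarrow> 'k" assume "x \<in> vsupp A''"
      then have "x = proj A'' x" "x \<in> vsupp (A' \<union> A'')"
        by (auto simp: vsupp_def proj_def)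
      then show "x \<in> proj A'' ` vsupp (A' \<union> A'')" by (rule image_eqI)
    qed
  qed (auto simp: vsupp_def proj_def)
  then have "mapp C B'' A'' ` vsupp A'' = mapp C B'' A'' ` proj A'' ` vsupp (A' \<union> A'')"
    by simp
  then show ?thesis
    by (simp add: image_image proj_mapp)
qed

text \<open>The image contains the image of the subcomplex and projects onto the image of the
  quotient. The surplus of the rank over this sum is the rank of the connecting map on
  homology.\<close>

lemma mrank_ge: "mrank C B' A' + mrank C B'' A'' \<le> mrank C (B' \<union> B'') (A' \<union> A'')"
proof -
  let ?S = "mapp C (B' \<union> B'') (A' \<union> A'') ` vsupp (A' \<union> A'')"
  have S: "fv.subspace ?S" "?S \<subseteq> vsupp (B' \<union> B'')"
    by (auto simp: subspace_mapp_image subspace_vsupp mapp_vsupp)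
  have "mapp C B' A' ` vsupp A' \<subseteq> {x \<in> ?S. proj B'' x = 0}"
  proof
    fix y :: "nat \<Rightarrow> 'k" assume "y \<in> mapp C B' A' ` vsupp A'"
    then obtain x :: "nat \<Rightarrow> 'k" where x: "x \<in> vsupp A'" "y = mapp C B' A' x" by blast
    have "x \<in> vsupp (A' \<union> A'')" using x(1) by (auto simp: vsupp_def)
    then have "y \<in> ?S"
      unfolding x(2) mapp_sub[OF x(1), symmetric] by (rule imageI)
    moreover have "proj B'' y = 0"
    proof
      fix k show "proj B'' y k = 0 k"
        using disj by (auto simp: proj_def x(2) mapp_def)
    qed
    ultimately show "y \<in> {x \<in> ?S. proj B'' x = 0}" by blast
  qed
  then have "fv.dim (mapp C B' A' ` vsupp A') \<le> fv.dim {x \<in> ?S. proj B'' x = 0}"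
    by (rule dim_vsupp_mono[rotated 3, of _ _ "B' \<union> B''"])
      (use S fin in \<open>auto simp: subspace_mapp_image subspace_vsupp subspace_proj_ker\<close>)
  then show ?thesis
    using proj_rank_nullity[OF _ S, of B''] fin unfolding proj_image mrank_def by simp
qed

text \<open>Elements of the image that project to 0 on \<open>B''\<close> are boundaries lying in
  the subcomplex, hence cycles for \<open>C2\<close>. After subtracting the rank on the subcomplex,
  this bounds the connecting map by the homology of the subcomplex at \<open>B'\<close>.\<close>

lemma mrank_le_target:
  assumes comp: "\<And>l j. l \<in> D' \<Longrightarrow> j \<in> A' \<union> A'' \<Longrightarrow> (\<Sum>k\<in>B' \<union> B''. C2 l k * C k j) = 0"
  shows "mrank C (B' \<union> B'') (A' \<union> A'') \<le> mrank C B'' A'' + fv.dim (mker C2 D' B')"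
proof -
  let ?S = "mapp C (B' \<union> B'') (A' \<union> A'') ` vsupp (A' \<union> A'')"
  have S: "fv.subspace ?S" "?S \<subseteq> vsupp (B' \<union> B'')"
    by (auto simp: subspace_mapp_image subspace_vsupp mapp_vsupp)
  have "{x \<in> ?S. proj B'' x = 0} \<subseteq> mker C2 D' B'"
  proof
    fix y assume y: "y \<in> {x \<in> ?S. proj B'' x = 0}"
    then obtain x where x: "y = mapp C (B' \<union> B'') (A' \<union> A'') x" by blast
    have y0: "y k = 0" if "k \<in> B''" for k
    proof -
      have "proj B'' y k = 0" using y by simp
      then show ?thesis using that by (simp add: proj_def)
    qed
    have yB: "y \<in> vsupp B'"
      using y0 x by (auto simp: vsupp_def mapp_def)
    have "(\<Sum>k\<in>B'. C2 l k * y k) = 0" if l: "l \<in> D'" for l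
    proof -
      have "(\<Sum>k\<in>B'. C2 l k * y k) = (\<Sum>k\<in>B' \<union> B''. C2 l k * y k)"
        using fin y0 by (intro sum.mono_neutral_left) auto
      also have "\<dots> = (\<Sum>k\<in>B' \<union> B''. \<Sum>j\<in>A' \<union> A''. C2 l k * C k j * x j)"
        by (rule sum.cong) (auto simp: x mapp_def sum_distrib_left mult.assoc)
      also have "\<dots> = (\<Sum>j\<in>A' \<union> A''. (\<Sum>k\<in>B' \<union> B''. C2 l k * C k j) * x j)"
        by (subst sum.swap) (simp add: sum_distrib_right)
      also have "\<dots> = 0" using comp[OF l] by simp
      finally show ?thesis .
    qed
    then show "y \<in> mker C2 D' B'"
      using yB by (auto simp: mker_def mapp_def fun_eq_iff)
  qed
  then have "fv.dim {x \<in> ?S. proj B'' x = 0} \<le> fv.dim (mker C2 D' B')"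
    by (rule dim_vsupp_mono[rotated 3, of _ _ B'])
      (use S fin subspace_mker[of C2 D' B'] in \<open>auto simp: subspace_proj_ker mker_def\<close>)
  then show ?thesis
    using proj_rank_nullity[OF _ S, of B''] fin unfolding proj_image mrank_def by simp
qed

text \<open>Among the cycles, those that project to 0 on \<open>A''\<close> include the cycles of
  the subcomplex, and the projections include the boundaries of the quotient. Counting dimensions
  bounds the connecting map by the homology of the quotient at \<open>A''\<close>.\<close>

lemma mrank_le_source:
  assumes "block_matrix C1 Z' Z'' A' A''"
    and comp: "\<And>l j. l \<in> B' \<union> B'' \<Longrightarrow> j \<in> Z' \<union> Z'' \<Longrightarrow> (\<Sum>k\<in>A' \<union> A''. C l k * C1 k j) = 0"
  shows "mrank C (B' \<union> B'') (A' \<union> A'') + mrank C1 A'' Z'' \<le> card A'' + mrank C B' A'"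
proof -
  interpret C1: block_matrix C1 Z' Z'' A' A'' by fact
  let ?K = "mker C (B' \<union> B'') (A' \<union> A'')"
  have K: "fv.subspace ?K" "?K \<subseteq> vsupp (A' \<union> A'')"
    using subspace_mker by (auto simp: mker_def)
  have "mker C B' A' \<subseteq> {x \<in> ?K. proj A'' x = 0}"
    using vsupp_mono[of A' "A' \<union> A''"] disj
    by (auto simp: mker_def mapp_sub) (auto simp: vsupp_def proj_def fun_eq_iff)
  then have 1: "fv.dim (mker C B' A') \<le> fv.dim {x \<in> ?K. proj A'' x = 0}"
    by (rule dim_vsupp_mono[rotated 3, of _ _ "A' \<union> A''"])
      (use K fin in \<open>auto simp: subspace_mker subspace_proj_ker\<close>)
  have "mapp C1 (A' \<union> A'') (Z' \<union> Z'') ` vsupp (Z' \<union> Z'') \<subseteq> ?K"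
  proof
    fix y :: "nat \<Rightarrow> 'k" assume "y \<in> mapp C1 (A' \<union> A'') (Z' \<union> Z'') ` vsupp (Z' \<union> Z'')"
    then obtain x where x: "y = mapp C1 (A' \<union> A'') (Z' \<union> Z'') x" by blast
    have "(\<Sum>k\<in>A' \<union> A''. C l k * y k) = 0" if l: "l \<in> B' \<union> B''" for l
    proof -
      have "(\<Sum>k\<in>A' \<union> A''. C l k * y k) = (\<Sum>k\<in>A' \<union> A''. \<Sum>j\<in>Z' \<union> Z''. C l k * C1 k j * x j)"
        by (rule sum.cong) (auto simp: x mapp_def sum_distrib_left mult.assoc)
      also have "\<dots> = (\<Sum>j\<in>Z' \<union> Z''. (\<Sum>k\<in>A' \<union> A''. C l k * C1 k j) * x j)"
        by (subst sum.swap) (simp add: sum_distrib_right)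
      also have "\<dots> = 0" using comp[OF l] by simp
      finally show ?thesis .
    qed
    moreover have "y \<in> vsupp (A' \<union> A'')" unfolding x by (rule mapp_vsupp)
    ultimately show "y \<in> ?K"
      by (auto simp: mker_def mapp_def fun_eq_iff)
  qed
  then have "mapp C1 A'' Z'' ` vsupp Z'' \<subseteq> proj A'' ` ?K"
    unfolding C1.proj_image[symmetric] by (rule image_mono)
  then have 2: "mrank C1 A'' Z'' \<le> fv.dim (proj A'' ` ?K)"
    unfolding mrank_def
    by (rule dim_vsupp_mono[rotated 3, of _ _ A''])
      (use K fin in \<open>auto simp: subspace_mapp_image subspace_vsupp subspace_proj_image\<close>,
       auto simp: proj_def vsupp_def)
  have "card (A' \<union> A'') = card A' + card A''"
    using fin disj by (simp add: card_Un_disjoint)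
  then show ?thesis
    using 1 2 proj_rank_nullity[OF _ K, of A''] fin
      mrank_nullity[of "A' \<union> A''" C "B' \<union> B''"] mrank_nullity[of A' C B'] by simp
qed

end

section \<open>Homology of multigraded resolutions\<close>

definition nbrs :: "'v set set \<Rightarrow> 'v \<Rightarrow> 'v set" where
  "nbrs E u = {v. {u, v} \<in> E}"

text \<open>The exponent vector of the product of the variables in \<open>W\<close>.\<close>

definition sqf :: "'v set \<Rightarrow> 'v \<Rightarrow> nat" where
  "sqf W v = (if v \<in> W then 1 else 0)"

lemma sqf_inj: "sqf V = sqf W \<longleftrightarrow> V = W"
proof
  assume "sqf V = sqf W"
  then have "v \<in> V \<longleftrightarrow> v \<in> W" for v by (auto simp: sqf_def fun_eq_iff split: if_splits)
  then show "V = W" by blast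
qed simp

lemma sqf_le_iff: "sqf W \<le> c \<longleftrightarrow> W \<subseteq> {v. 0 < c v}"
  by (auto simp: le_fun_def sqf_def Suc_le_eq)

text \<open>A minimal multigraded free resolution of R/I reduced to scalars. \<open>M c\<close> says
  that the monomial of degree \<open>c\<close> lies in I, and \<open>C\<close> holds the
  coefficients of the monomial entries. Exactness is stated in each degree \<open>c\<close>, where
  only generators of degree at most \<open>c\<close> contribute. \<open>C 0\<close> has the single
  row 0; \<open>augmentation\<close> and \<open>exact_0\<close> together say that it identifies the
  cokernel of \<open>C (Suc 0)\<close> in degree \<open>c\<close> with that of R/I.\<close>

locale graded_resolution =
  fixes M :: "('v::finite \<Rightarrow> nat) \<Rightarrow> bool"
    and len :: "nat \<Rightarrow> nat"
    and deg :: "nat \<Rightarrow> nat \<Rightarrow> 'v \<Rightarrow> nat"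
    and C :: "nat \<Rightarrow> nat \<Rightarrow> nat \<Rightarrow> 'k::field"
  assumes graded: "k < len i \<Longrightarrow> j < len (Suc i) \<Longrightarrow> C (Suc i) k j \<noteq> 0 \<Longrightarrow> deg i k \<le> deg (Suc i) j"
    and minimal: "k < len i \<Longrightarrow> j < len (Suc i) \<Longrightarrow> deg i k = deg (Suc i) j \<Longrightarrow> C (Suc i) k j = 0"
    and augmentation: "\<not> M c \<Longrightarrow>
      \<exists>x\<in>vsupp {j. j < len 0 \<and> deg 0 j \<le> c}. (\<Sum>j | j < len 0 \<and> deg 0 j \<le> c. C 0 0 j * x j) \<noteq> 0"
    and exact_0: "{x \<in> vsupp {j. j < len 0 \<and> deg 0 j \<le> c}.
        M c \<or> (\<Sum>j | j < len 0 \<and> deg 0 j \<le> c. C 0 0 j * x j) = 0} =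
      mapp (C (Suc 0)) {j. j < len 0 \<and> deg 0 j \<le> c} {j. j < len (Suc 0) \<and> deg (Suc 0) j \<le> c} `
        vsupp {j. j < len (Suc 0) \<and> deg (Suc 0) j \<le> c}"
    and exact_Suc: "mker (C (Suc i)) {j. j < len i \<and> deg i j \<le> c} {j. j < len (Suc i) \<and> deg (Suc i) j \<le> c} =
      mapp (C (Suc (Suc i))) {j. j < len (Suc i) \<and> deg (Suc i) j \<le> c}
          {j. j < len (Suc (Suc i)) \<and> deg (Suc (Suc i)) j \<le> c} `
        vsupp {j. j < len (Suc (Suc i)) \<and> deg (Suc (Suc i)) j \<le> c}"
begin

text \<open>In degree \<open>c\<close> a generator is multiplied by the monomial of the degree
  difference. Modulo the variables in \<open>X\<close> this survives exactly if the monomial avoids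
  \<open>X\<close>, that is, if the degrees agree on \<open>X\<close>.\<close>

definition J :: "('v \<Rightarrow> nat) \<Rightarrow> 'v set \<Rightarrow> nat \<Rightarrow> nat set" where
  "J c X i = {j. j < len i \<and> deg i j \<le> c \<and> (\<forall>v\<in>X. deg i j v = c v)}"

text \<open>The value 0 at \<open>i = 0\<close> leaves out the augmentation, so that
  \<open>h 0\<close> measures a cokernel, as Tor requires.\<close>

definition rho :: "('v \<Rightarrow> nat) \<Rightarrow> 'v set \<Rightarrow> nat \<Rightarrow> nat" where
  "rho c X i = (case i of 0 \<Rightarrow> 0 | Suc i' \<Rightarrow> mrank (C (Suc i')) (J c X i') (J c X (Suc i')))"

text \<open>This is the dimension of the degree \<open>c\<close> part of \<open>Tor\<^sub>i(R/I, R/(x\<^sub>v. v \<in> X))\<close>.\<close>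

definition h :: "nat \<Rightarrow> ('v \<Rightarrow> nat) \<Rightarrow> 'v set \<Rightarrow> int" where
  "h i c X = int (card (J c X i)) - int (rho c X i) - int (rho c X (Suc i))"

lemma finite_J [simp]: "finite (J c X i)"
  by (simp add: J_def)

lemma J_empty: "J c {} i = {j. j < len i \<and> deg i j \<le> c}"
  by (simp add: J_def)

lemma augmentation_J: "\<not> M c \<Longrightarrow> \<exists>x\<in>vsupp (J c {} 0). (\<Sum>j\<in>J c {} 0. C 0 0 j * x j) \<noteq> 0"
  using augmentation by (simp add: J_empty)

lemma exact_0_J:
  "{x \<in> vsupp (J c {} 0). M c \<or> (\<Sum>j\<in>J c {} 0. C 0 0 j * x j) = 0} =
    mapp (C (Suc 0)) (J c {} 0) (J c {} (Suc 0)) ` vsupp (J c {} (Suc 0))"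
  using exact_0 by (simp add: J_empty)

lemma exact_Suc_J:
  "mker (C (Suc i)) (J c {} i) (J c {} (Suc i)) =
    mapp (C (Suc (Suc i))) (J c {} (Suc i)) (J c {} (Suc (Suc i))) ` vsupp (J c {} (Suc (Suc i)))"
  using exact_Suc by (simp add: J_empty)

text \<open>The sum over all generators below \<open>c\<close> is 0 by exactness. Restricting it to
  \<open>X\<close> loses nothing, since a contributing \<open>k\<close> has degree between those of
  \<open>l\<close> and \<open>j\<close>, which agree on \<open>X\<close>.\<close>

lemma complex_J:
  assumes "l \<in> J c X i" "j \<in> J c X (Suc (Suc i))"
  shows "(\<Sum>k\<in>J c X (Suc i). C (Suc i) l k * C (Suc (Suc i)) k j) = 0"
proof -
  have lj: "l \<in> J c {} i" "j \<in> J c {} (Suc (Suc i))" using assms by (auto simp: J_def)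
  have "uvec j \<in> (vsupp (J c {} (Suc (Suc i))) :: (nat \<Rightarrow> 'k) set)"
    using lj by (auto simp: vsupp_def uvec_def)
  then have "mapp (C (Suc (Suc i))) (J c {} (Suc i)) (J c {} (Suc (Suc i))) (uvec j)
      \<in> mker (C (Suc i)) (J c {} i) (J c {} (Suc i))"
    unfolding exact_Suc_J by (rule imageI)
  then have "mapp (C (Suc i)) (J c {} i) (J c {} (Suc i))
      (mapp (C (Suc (Suc i))) (J c {} (Suc i)) (J c {} (Suc (Suc i))) (uvec j)) l = 0"
    by (simp add: mker_def)
  then have "(\<Sum>k\<in>J c {} (Suc i). C (Suc i) l k *
      (\<Sum>j'\<in>J c {} (Suc (Suc i)). C (Suc (Suc i)) k j' * uvec j j')) = 0"
    using lj(1) by (simp add: mapp_def)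
  moreover have "(\<Sum>j'\<in>J c {} (Suc (Suc i)). C (Suc (Suc i)) k j' * uvec j j') = C (Suc (Suc i)) k j" for k
  proof -
    have "(\<Sum>j'\<in>J c {} (Suc (Suc i)). C (Suc (Suc i)) k j' * uvec j j') =
        (\<Sum>j'\<in>J c {} (Suc (Suc i)). if j' = j then C (Suc (Suc i)) k j' else 0)"
      by (rule sum.cong) (auto simp: uvec_def)
    then show ?thesis using lj(2) by simp
  qed
  ultimately have "(\<Sum>k\<in>J c {} (Suc i). C (Suc i) l k * C (Suc (Suc i)) k j) = 0" by simp
  moreover have "(\<Sum>k\<in>J c X (Suc i). C (Suc i) l k * C (Suc (Suc i)) k j) =
      (\<Sum>k\<in>J c {} (Suc i). C (Suc i) l k * C (Suc (Suc i)) k j)"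
  proof (rule sum.mono_neutral_left)
    show "\<forall>k\<in>J c {} (Suc i) - J c X (Suc i). C (Suc i) l k * C (Suc (Suc i)) k j = 0"
    proof (rule ballI, rule ccontr)
      fix k assume k: "k \<in> J c {} (Suc i) - J c X (Suc i)" and "C (Suc i) l k * C (Suc (Suc i)) k j \<noteq> 0"
      then have "deg i l \<le> deg (Suc i) k" "deg (Suc i) k \<le> deg (Suc (Suc i)) j"
        using graded assms by (auto simp: J_def)
      then have le: "deg i l v \<le> deg (Suc i) k v" "deg (Suc i) k v \<le> deg (Suc (Suc i)) j v" for v
        by (auto simp: le_fun_def)
      have "deg (Suc i) k v = c v" if "v \<in> X" for v
      proof -
        have "deg i l v = c v" "deg (Suc (Suc i)) j v = c v"
          using assms that by (simp_all add: J_def)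
        then show ?thesis using le[of v] by simp
      qed
      then show False using k by (auto simp: J_def)
    qed
  qed (auto simp: J_def)
  ultimately show ?thesis by simp
qed

lemma rho_le: "rho c X i + rho c X (Suc i) \<le> card (J c X i)"
proof (cases i)
  case 0
  have "fv.dim (mapp (C (Suc 0)) (J c X 0) (J c X (Suc 0)) ` vsupp (J c X (Suc 0)))
      \<le> fv.dim (vsupp (J c X 0) :: (nat \<Rightarrow> 'k) set)"
    by (rule dim_vsupp_mono[of "J c X 0"]) (auto simp: subspace_mapp_image subspace_vsupp mapp_vsupp)
  then show ?thesis using 0 by (simp add: rho_def mrank_def dim_vsupp)
next
  case (Suc m)
  interpret block_matrix "C (Suc m)" "{}" "J c X (Suc m)" "{}" "J c X m"
    by unfold_locales auto
  have "mrank (C (Suc m)) ({} \<union> J c X m) ({} \<union> J c X (Suc m)) + mrank (C (Suc (Suc m))) (J c X (Suc m)) (J c X (Suc (Suc m)))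
      \<le> card (J c X (Suc m)) + mrank (C (Suc m)) {} {}"
    by (rule mrank_le_source[where Z' = "{}"]) (unfold_locales, auto simp: complex_J)
  moreover have "mrank (C (Suc m)) {} {} = 0"
    using mrank_nullity[of "{}" "C (Suc m)" "{}"] by simp
  ultimately show ?thesis using Suc by (simp add: rho_def)
qed

lemma h_nonneg: "h i c X \<ge> 0"
  using rho_le[of c X i] by (simp add: h_def)

text \<open>This is the sequence of multiplication by the variable of \<open>v\<close> on R modulo
  \<open>X\<close>, in degree \<open>c\<close>: the subcomplex is the same complex one step lower in
  \<open>v\<close>, the quotient has \<open>v\<close> added to \<open>X\<close>.
  \<open>\<delta> i\<close> is the rank of the connecting map from degree \<open>i\<close> of the
  quotient to degree \<open>i - 1\<close> of the subcomplex.\<close>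

lemma les:
  assumes "v \<notin> X" "c v > 0" and c': "c' = c(v := c v - 1)"
  obtains \<delta> :: "nat \<Rightarrow> int" where "\<delta> 0 = 0" "\<And>i. 0 \<le> \<delta> i"
    "\<And>i. \<delta> i \<le> h i c (insert v X)" "\<And>i. \<delta> (Suc i) \<le> h i c' X"
    "\<And>i. h i c X = h i c' X + h i c (insert v X) - \<delta> i - \<delta> (Suc i)"
proof -
  let ?J' = "J c' X" and ?J'' = "J c (insert v X)"
  have J_eq: "J c X i = ?J' i \<union> ?J'' i" for i
  proof (intro equalityI subsetI)
    fix j assume j: "j \<in> J c X i"
    show "j \<in> ?J' i \<union> ?J'' i"
    proof (cases "deg i j v = c v")
      case True
      then show ?thesis using j by (auto simp: J_def)
    next
      case False
      have "deg i j w \<le> c w" for w using j by (auto simp: J_def le_fun_def)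
      moreover from this[of v] have "deg i j v < c v" using False by simp
      ultimately have "deg i j w \<le> c' w" for w by (auto simp: c')
      moreover have "\<forall>w\<in>X. deg i j w = c' w" using j assms(1) by (auto simp: J_def c')
      ultimately show ?thesis using j by (auto simp: J_def le_fun_def)
    qed
  next
    fix j assume "j \<in> ?J' i \<union> ?J'' i"
    moreover have "c' w \<le> c w" for w by (auto simp: c')
    then have "c' \<le> c" by (simp add: le_fun_def)
    moreover have "c' w = c w" if "w \<in> X" for w using that assms(1) by (auto simp: c')
    ultimately show "j \<in> J c X i"
      unfolding J_def by (auto intro: order_trans[of _ c' c])
  qed
  have J'v: "deg i j v < c v" if "j \<in> ?J' i" for i j
  proof -
    have "deg i j v \<le> c' v" using that by (auto simp: J_def le_fun_def)
    then show ?thesis using assms(2) by (auto simp: c')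
  qed
  have disj: "?J' i \<inter> ?J'' i = {}" for i
    using J'v by (force simp: J_def)
  have bm: "block_matrix (C (Suc i)) (?J' (Suc i)) (?J'' (Suc i)) (?J' i) (?J'' i)" for i
  proof
    fix k j assume j: "j \<in> ?J' (Suc i)" and k: "k \<in> ?J'' i"
    show "C (Suc i) k j = 0"
    proof (rule ccontr)
      assume "C (Suc i) k j \<noteq> 0"
      then have "deg i k \<le> deg (Suc i) j" using graded j k by (auto simp: J_def)
      then have "deg i k v \<le> deg (Suc i) j v" by (simp add: le_fun_def)
      moreover have "deg i k v = c v" using k by (simp add: J_def)
      ultimately show False using J'v[OF j] by simp
    qed
  qed (auto simp: disj)
  have card_J: "card (J c X i) = card (?J' i) + card (?J'' i)" for i
    unfolding J_eq by (rule card_Un_disjoint) (auto simp: disj)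
  define \<delta> where "\<delta> i = int (rho c X i) - int (rho c' X i) - int (rho c (insert v X) i)" for i
  have "\<delta> 0 = 0" by (simp add: \<delta>_def rho_def)
  moreover have "0 \<le> \<delta> i" for i
  proof (cases i)
    case (Suc m)
    show ?thesis
      using block_matrix.mrank_ge[OF bm, of m] unfolding \<delta>_def rho_def Suc by (simp add: J_eq)
  qed (simp add: \<delta>_def rho_def)
  moreover have "\<delta> i \<le> h i c (insert v X)" for i
  proof (cases i)
    case 0
    then show ?thesis using h_nonneg by (simp add: \<delta>_def rho_def)
  next
    case (Suc m)
    have "mrank (C (Suc m)) (J c X m) (J c X (Suc m)) + mrank (C (Suc (Suc m))) (?J'' (Suc m)) (?J'' (Suc (Suc m)))
      \<le> card (?J'' (Suc m)) + mrank (C (Suc m)) (?J' m) (?J' (Suc m))"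
      unfolding J_eq
      by (rule block_matrix.mrank_le_source[OF bm bm]) (simp only: J_eq[symmetric] complex_J)
    then show ?thesis unfolding \<delta>_def h_def rho_def Suc by simp
  qed
  moreover have "\<delta> (Suc i) \<le> h i c' X" for i
  proof (cases i)
    case 0
    \<comment> \<open>In homological degree 0 every chain is a cycle, so the outgoing map is taken
      with no rows at all.\<close>
    have "mrank (C (Suc 0)) (?J' 0 \<union> ?J'' 0) (?J' (Suc 0) \<union> ?J'' (Suc 0))
      \<le> mrank (C (Suc 0)) (?J'' 0) (?J'' (Suc 0)) + fv.dim (mker (C (Suc 0)) {} (?J' 0))"
      by (rule block_matrix.mrank_le_target[OF bm]) auto
    also have "mker (C (Suc 0)) {} (?J' 0) = vsupp (?J' 0)"
      by (auto simp: mker_def mapp_def fun_eq_iff)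
    also have "fv.dim (vsupp (?J' 0) :: (nat \<Rightarrow> 'k) set) = card (?J' 0)"
      by (rule dim_vsupp) simp
    finally show ?thesis
      unfolding \<delta>_def h_def rho_def 0 by (simp add: J_eq)
  next
    case (Suc m)
    have "mrank (C (Suc (Suc m))) (J c X (Suc m)) (J c X (Suc (Suc m))) \<le>
      mrank (C (Suc (Suc m))) (?J'' (Suc m)) (?J'' (Suc (Suc m))) + fv.dim (mker (C (Suc m)) (?J' m) (?J' (Suc m)))"
      unfolding J_eq
      by (rule block_matrix.mrank_le_target[OF bm]) (simp only: J_eq[symmetric], rule complex_J, auto simp: J_eq)
    then show ?thesis
      using mrank_nullity[of "?J' (Suc m)" "C (Suc m)" "?J' m"]
      unfolding \<delta>_def h_def rho_def Suc by simp
  qed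
  moreover have "h i c X = h i c' X + h i c (insert v X) - \<delta> i - \<delta> (Suc i)" for i
    by (simp add: h_def \<delta>_def card_J)
  ultimately show thesis by (rule that)
qed

lemma J_insert: "c v = 0 \<Longrightarrow> J c (insert v X) i = J c X i"
  by (auto simp: J_def le_fun_def) (metis le_zero_eq)

lemma h_insert: "c v = 0 \<Longrightarrow> h i c (insert v X) = h i c X"
  by (simp add: h_def rho_def J_insert split: nat.split)

text \<open>In the sequence that adds \<open>w\<close>, vanishing in degree \<open>c\<close> and one
  step lower in \<open>w\<close> forces vanishing of the third term. Because \<open>c\<close> is
  lowered along the way, the hypothesis ranges over all degrees that differ from \<open>c\<close>
  only on \<open>Y\<close>.\<close>

lemma h_zero_Un:
  assumes "finite Y" "\<And>c' i. (\<And>v. v \<notin> Y \<Longrightarrow> c' v = c v) \<Longrightarrow> h i c' X = 0"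
  shows "h i c (X \<union> Y) = 0"
  using assms
proof (induction Y arbitrary: c i rule: finite_induct)
  case empty
  then show ?case by simp
next
  case (insert w Y)
  have IH: "h i c' (X \<union> Y) = 0" if "\<And>v. v \<noteq> w \<Longrightarrow> c' v = c v" for c' i
    by (rule insert.IH, rule insert.prems) (use that in auto)
  show ?case
  proof (cases "w \<in> X \<union> Y \<or> c w = 0")
    case True
    moreover have "h i c (X \<union> Y) = 0" by (rule IH) simp
    ultimately show ?thesis
      by (auto simp: insert_absorb h_insert)
  next
    case False
    then have w: "w \<notin> X \<union> Y" "0 < c w" by auto
    obtain \<delta> :: "nat \<Rightarrow> int" where \<delta>: "\<delta> 0 = 0" "\<And>i. 0 \<le> \<delta> i"
      "\<And>i. \<delta> (Suc i) \<le> h i (c(w := c w - 1)) (X \<union> Y)"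
      "\<And>i. h i c (X \<union> Y) = h i (c(w := c w - 1)) (X \<union> Y) + h i c (insert w (X \<union> Y)) - \<delta> i - \<delta> (Suc i)"
      by (rule les[of w "X \<union> Y" c, OF w refl]) blast
    have 0: "h i c (X \<union> Y) = 0" "h i (c(w := c w - 1)) (X \<union> Y) = 0" for i
      by (auto intro: IH)
    have "\<delta> i = 0" for i
      using \<delta>(1) \<delta>(2)[of i] \<delta>(3)[of "i - 1"] 0 by (cases i) auto
    then show ?thesis using \<delta>(4)[of i] 0 by simp
  qed
qed

text \<open>With nothing divided out, this is the homology of the resolution itself in degree
  \<open>c\<close>. Only the cokernel in homological degree 0 remains; it is the degree
  \<open>c\<close> part of R/I, which is a line or 0.\<close>

lemma h_empty: "h i c {} = (if \<not> M c \<and> i = 0 then 1 else 0)"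
proof (cases i)
  case (Suc m)
  have "mrank (C (Suc (Suc m))) (J c {} (Suc m)) (J c {} (Suc (Suc m))) =
      fv.dim (mker (C (Suc m)) (J c {} m) (J c {} (Suc m)))"
    by (simp only: mrank_def exact_Suc_J)
  then show ?thesis
    using mrank_nullity[of "J c {} (Suc m)" "C (Suc m)" "J c {} m"] Suc
    by (simp add: h_def rho_def)
next
  case 0
  let ?J = "J c {} 0"
  let ?K = "{x \<in> vsupp ?J. M c \<or> (\<Sum>j\<in>?J. C 0 0 j * x j) = 0}"
  have r: "rho c {} (Suc 0) = fv.dim ?K"
    by (simp add: rho_def mrank_def exact_0_J)
  show ?thesis
  proof (cases "M c")
    case True
    then have "?K = vsupp ?J" by auto
    then show ?thesis using 0 True r by (simp add: h_def rho_def dim_vsupp)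
  next
    case False
    have "?K = mker (C 0) {0} ?J"
      using False by (auto simp: mker_def mapp_def fun_eq_iff)
    moreover have "mrank (C 0) {0} ?J = 1"
    proof -
      obtain x where x: "x \<in> vsupp ?J" "(\<Sum>j\<in>?J. C 0 0 j * x j) \<noteq> 0"
        using augmentation_J[OF False] by blast
      let ?y = "mapp (C 0) {0} ?J x"
      have "mapp (C 0) {0} ?J ` vsupp ?J \<subseteq> fv.span {?y}"
      proof
        fix z assume "z \<in> mapp (C 0) {0} ?J ` vsupp ?J"
        then obtain w where w: "z = mapp (C 0) {0} ?J w" by blast
        have "z = fscale ((\<Sum>j\<in>?J. C 0 0 j * w j) / (\<Sum>j\<in>?J. C 0 0 j * x j)) ?y"
          using x(2) by (auto simp: w fun_eq_iff mapp_def)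
        also have "\<dots> \<in> fv.span {?y}"
          by (intro fv.span_scale fv.span_base) simp
        finally show "z \<in> fv.span {?y}" .
      qed
      moreover have "fv.independent {?y}"
      proof
        assume "fv.dependent {?y}"
        then have "?y = 0" by simp
        then have "?y 0 = 0" by simp
        then show False using x(2) by (simp add: mapp_def)
      qed
      ultimately show ?thesis
        unfolding mrank_def using x(1) by (intro fv.dim_unique[of "{?y}"]) auto
    qed
    ultimately show ?thesis
      using mrank_nullity[of ?J "C 0" "{0}"] 0 False r by (simp add: h_def rho_def)
  qed
qed

text \<open>The hypothesis says that R/I has the same dimension in degree \<open>c\<close> and one
  step lower in \<open>u\<close>. Multiplication by the variable of \<open>u\<close> is then
  bijective between the two parts, so neither kernel nor cokernel contributes. If both are lines,
  the dimensions in the sequence do not show this and surjectivity is proved directly.\<close>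

lemma h_single_zero:
  assumes "c u > 0" "M (c(u := c u - 1)) \<longleftrightarrow> M c"
  shows "h i c {u} = 0"
proof -
  let ?c = "c(u := c u - 1)"
  obtain \<delta> :: "nat \<Rightarrow> int" where \<delta>: "\<delta> 0 = 0" "\<And>i. 0 \<le> \<delta> i"
    "\<And>i. \<delta> i \<le> h i c {u}" "\<And>i. \<delta> (Suc i) \<le> h i ?c {}"
    "\<And>i. h i c {} = h i ?c {} + h i c {u} - \<delta> i - \<delta> (Suc i)"
    using les[of u "{}" c ?c] assms(1) by auto
  have h_eq: "h i c {u} = \<delta> i + \<delta> (Suc i)" for i
    using \<delta>(5)[of i] assms(2) by (simp add: h_empty)
  have "\<delta> (Suc (Suc i)) = 0" for i
    using \<delta>(2,4)[of "Suc i"] \<delta>(2)[of "Suc (Suc i)"] by (simp add: h_empty)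
  moreover have "\<delta> (Suc 0) = 0"
  proof (cases "M c")
    case True
    then show ?thesis using \<delta>(4)[of 0] \<delta>(2)[of "Suc 0"] assms(2) by (simp add: h_empty)
  next
    case False
    let ?J = "J c {u}"
    let ?\<epsilon> = "\<lambda>x. \<Sum>j\<in>J c {} 0. C 0 0 j * x j"
    have sub: "J ?c {} i \<subseteq> J c {} i" for i
    proof
      fix j assume "j \<in> J ?c {} i"
      moreover have "?c \<le> c" by (auto simp: le_fun_def)
      ultimately show "j \<in> J c {} i" by (auto simp: J_def intro: order_trans)
    qed
    have disj: "j \<notin> J ?c {} i" if "j \<in> ?J i" for i j
    proof
      assume "j \<in> J ?c {} i"
      then have "deg i j u \<le> ?c u" unfolding J_def le_fun_def by blast
      then show False using that assms(1) by (auto simp: J_def)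
    qed
    \<comment> \<open>The chain \<open>y\<close> lives one step lower in \<open>u\<close> and so
      vanishes on \<open>?J 0\<close>. Subtracting a multiple of it turns any chain into one with
      augmentation 0, hence a boundary, without changing the coordinates on
      \<open>?J 0\<close>.\<close>
    obtain y where y: "y \<in> vsupp (J ?c {} 0)" "(\<Sum>j\<in>J ?c {} 0. C 0 0 j * y j) \<noteq> 0"
      using augmentation_J[of ?c] False assms(2) by blast
    have "(\<Sum>j\<in>J ?c {} 0. C 0 0 j * y j) = ?\<epsilon> y"
      using sub y(1) by (intro sum.mono_neutral_left) (auto simp: vsupp_def)
    then have \<epsilon>y: "?\<epsilon> y \<noteq> 0" using y(2) by simp
    have "vsupp (?J 0) \<subseteq> mapp (C (Suc 0)) (?J 0) (?J (Suc 0)) ` vsupp (?J (Suc 0))"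
    proof
      fix x :: "nat \<Rightarrow> 'k" assume x: "x \<in> vsupp (?J 0)"
      have xc: "x \<in> vsupp (J c {} 0)" using x by (auto simp: vsupp_def J_def)
      have yc: "y \<in> vsupp (J c {} 0)" using y sub[of 0] by (auto simp: vsupp_def)
      let ?z = "x - fscale (?\<epsilon> x / ?\<epsilon> y) y"
      have "?\<epsilon> ?z = ?\<epsilon> x - (?\<epsilon> x / ?\<epsilon> y) * ?\<epsilon> y"
        by (simp add: right_diff_distrib sum_subtractf sum_distrib_left mult.left_commute)
      then have "?\<epsilon> ?z = 0" using \<epsilon>y by simp
      moreover have "?z \<in> vsupp (J c {} 0)"
        using xc yc by (simp add: fv.subspace_diff fv.subspace_scale subspace_vsupp)
      ultimately have "?z \<in> mapp (C (Suc 0)) (J c {} 0) (J c {} (Suc 0)) ` vsupp (J c {} (Suc 0))"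
        unfolding exact_0_J[symmetric] by blast
      then obtain w where w: "?z = mapp (C (Suc 0)) (J c {} 0) (J c {} (Suc 0)) w"
        "w \<in> vsupp (J c {} (Suc 0))" by blast
      have "x k = mapp (C (Suc 0)) (?J 0) (?J (Suc 0)) (proj (?J (Suc 0)) w) k" for k
      proof (cases "k \<in> ?J 0")
        case False
        then show ?thesis using x by (auto simp: vsupp_def mapp_def)
      next
        case True
        have "y k = 0" using y(1) disj[OF True] by (auto simp: vsupp_def)
        then have "x k = ?z k" by simp
        also have "\<dots> = (\<Sum>j\<in>J c {} (Suc 0). C (Suc 0) k j * w j)"
          unfolding w using True by (auto simp: mapp_def J_def)
        also have "\<dots> = (\<Sum>j\<in>?J (Suc 0). C (Suc 0) k j * w j)"
        proof (rule sum.mono_neutral_right)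
          show "\<forall>j\<in>J c {} (Suc 0) - ?J (Suc 0). C (Suc 0) k j * w j = 0"
          proof (rule ballI, rule ccontr)
            fix j assume j: "j \<in> J c {} (Suc 0) - ?J (Suc 0)" and "C (Suc 0) k j * w j \<noteq> 0"
            then have "deg 0 k \<le> deg (Suc 0) j" using graded[of k 0 j] True by (auto simp: J_def)
            then have "deg 0 k u \<le> deg (Suc 0) j u" "deg (Suc 0) j u \<le> c u"
              using j by (auto simp: J_def le_fun_def)
            then show False using j True by (auto simp: J_def)
          qed
        qed (auto simp: J_def)
        also have "\<dots> = mapp (C (Suc 0)) (?J 0) (?J (Suc 0)) (proj (?J (Suc 0)) w) k"
          using True by (simp add: mapp_def proj_def)
        finally show ?thesis .
      qed
      then have "x = mapp (C (Suc 0)) (?J 0) (?J (Suc 0)) (proj (?J (Suc 0)) w)" ..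
      moreover have "proj (?J (Suc 0)) w \<in> vsupp (?J (Suc 0))"
        by (auto simp: proj_def vsupp_def)
      ultimately show "x \<in> mapp (C (Suc 0)) (?J 0) (?J (Suc 0)) ` vsupp (?J (Suc 0))" by (rule image_eqI)
    qed
    then have "fv.dim (vsupp (?J 0) :: (nat \<Rightarrow> 'k) set)
        \<le> fv.dim (mapp (C (Suc 0)) (?J 0) (?J (Suc 0)) ` vsupp (?J (Suc 0)))"
      by (rule dim_vsupp_mono[rotated 3, of _ _ "?J 0"])
        (auto simp: subspace_mapp_image subspace_vsupp mapp_vsupp)
    then have "h 0 c {u} \<le> 0" by (simp add: h_def rho_def mrank_def dim_vsupp)
    then show ?thesis using h_eq[of 0] \<delta>(1) \<delta>(2)[of "Suc 0"] by simp
  qed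
  ultimately show ?thesis
    using h_eq[of i] \<delta>(1) by (cases i; cases "i - 1") auto
qed

lemma h_UNIV: "h i a UNIV = int (card {j. j < len i \<and> deg i j = a})"
proof -
  have J: "J a UNIV i = {j. j < len i \<and> deg i j = a}" for i
    by (auto simp: J_def)
  have "rho a UNIV i = 0" for i
  proof (cases i)
    case (Suc m)
    have "mapp (C (Suc m)) (J a UNIV m) (J a UNIV (Suc m)) x = 0" for x
      using minimal by (auto simp: mapp_def fun_eq_iff J intro!: sum.neutral)
    then have "mker (C (Suc m)) (J a UNIV m) (J a UNIV (Suc m)) = vsupp (J a UNIV (Suc m))"
      by (simp add: mker_def)
    then show ?thesis
      using mrank_nullity[of "J a UNIV (Suc m)" "C (Suc m)" "J a UNIV m"] Suc
      by (simp add: rho_def dim_vsupp)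
  qed (simp add: rho_def)
  then show ?thesis by (simp add: h_def J)
qed

lemma h_support: "(\<And>v. v \<notin> X \<Longrightarrow> c v = 0) \<Longrightarrow> h i c X = h i c UNIV"
proof -
  assume c: "\<And>v. v \<notin> X \<Longrightarrow> c v = 0"
  have "J c X i = J c UNIV i" for i
  proof
    show "J c X i \<subseteq> J c UNIV i"
    proof
      fix j assume j: "j \<in> J c X i"
      have "deg i j v = c v" for v
        using c[of v] j by (cases "v \<in> X") (auto simp: J_def le_fun_def, metis le_zero_eq)
      then show "j \<in> J c UNIV i" using j by (simp add: J_def)
    qed
  qed (auto simp: J_def)
  then show ?thesis by (simp add: h_def rho_def split: nat.split)
qed

end

section \<open>Edge ideals: recursion over vertex sets\<close>

locale edge_ideal_resolution = graded_resolution M len deg C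
  for M :: "('v::finite \<Rightarrow> nat) \<Rightarrow> bool" and len deg and C :: "nat \<Rightarrow> nat \<Rightarrow> nat \<Rightarrow> 'k::field" +
  fixes E :: "'v set set"
  assumes simple: "simple_graph E"
    and M_iff: "M c \<longleftrightarrow> (\<exists>x y. {x, y} \<in> E \<and> 0 < c x \<and> 0 < c y)"
begin

text \<open>By \<open>h_support\<close> this is the Betti number in degree \<open>sqf W\<close>.
  Dividing out \<open>W\<close> instead of all variables makes deletion of a vertex a single step of
  the long exact sequence.\<close>

definition H :: "nat \<Rightarrow> 'v set \<Rightarrow> int" where
  "H i W = h i (sqf W) W"

lemma edge_neq: "{x, y} \<in> E \<Longrightarrow> x \<noteq> y"
  using simple by (force simp: simple_graph_def)

lemma H_eq_card: "H i W = int (card {j. j < len i \<and> deg i j = sqf W})"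
  unfolding H_def h_UNIV[symmetric] by (rule h_support) (simp add: sqf_def)

text \<open>Whether a monomial lies in a squarefree ideal depends only on its support, so lowering
  an exponent that is at least 2 changes nothing, whatever the other exponents are.\<close>

lemma not_squarefree:
  assumes "a u \<ge> 2"
  shows "card {j. j < len i \<and> deg i j = a} = 0"
proof -
  have "h i a ({u} \<union> (UNIV - {u})) = 0"
  proof (rule h_zero_Un)
    fix c' i assume "\<And>v. v \<notin> UNIV - {u} \<Longrightarrow> c' v = a v"
    then have "c' u \<ge> 2" using assms by simp
    then have "c' u > 0" "0 < (c'(u := c' u - 1)) z \<longleftrightarrow> 0 < c' z" for z by auto
    then show "h i c' {u} = 0"
      by (intro h_single_zero) (simp_all only: M_iff)
  qed simp
  then show ?thesis by (simp add: h_UNIV)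
qed

lemma H_empty: "H i {} = (if i = 0 then 1 else 0)"
  unfolding H_def h_empty by (simp add: M_iff sqf_def)

text \<open>The vertex \<open>u\<close> is in no edge inside \<open>W\<close>, so multiplying by its
  variable does not affect membership in the ideal for monomials supported in \<open>W\<close>,
  whatever their exponents at the other vertices.\<close>

lemma H_isolated:
  assumes "u \<in> W" "nbrs E u \<inter> W = {}"
  shows "H i W = 0"
proof -
  have "h i (sqf W) ({u} \<union> (W - {u})) = 0"
  proof (rule h_zero_Un)
    fix c' i assume c': "\<And>v. v \<notin> W - {u} \<Longrightarrow> c' v = sqf W v"
    have c'u: "c' u = 1" using c'[of u] assms(1) by (simp add: sqf_def)
    have W: "v \<in> W" if "0 < c' v" for v
      using c'[of v] that by (force simp: sqf_def split: if_splits)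
    have "u \<noteq> x \<and> u \<noteq> y" if "{x, y} \<in> E" "0 < c' x" "0 < c' y" for x y
      using assms(2) W[OF that(2)] W[OF that(3)] that(1) by (auto simp: nbrs_def insert_commute)
    then have "M (c'(u := c' u - 1)) \<longleftrightarrow> M c'"
      unfolding M_iff by (metis c'u diff_self_eq_0 fun_upd_other fun_upd_same less_numeral_extra(3))
    then show "h i c' {u} = 0"
      by (intro h_single_zero) (simp add: c'u)
  qed simp
  moreover have "{u} \<union> (W - {u}) = W" using assms(1) by blast
  ultimately show ?thesis by (simp add: H_def)
qed

text \<open>Every degree that agrees with \<open>sqf W\<close> outside \<open>X\<close> is still
  positive on the edge, so R/I vanishes in all of them.\<close>

lemma h_edge_zero:
  assumes "{x, y} \<in> E" "x \<in> W" "y \<in> W" "x \<notin> X" "y \<notin> X"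
  shows "h i (sqf W) X = 0"
proof -
  have "h i (sqf W) ({} \<union> X) = 0"
  proof (rule h_zero_Un)
    fix c' i assume "\<And>v. v \<notin> X \<Longrightarrow> c' v = sqf W v"
    then have "0 < c' x" "0 < c' y" using assms by (auto simp: sqf_def)
    then show "h i c' {} = 0" using assms(1) by (auto simp: h_empty M_iff)
  qed simp
  then show ?thesis by simp
qed

lemma sqf_upd: "(sqf W)(v := sqf W v - 1) = sqf (W - {v})"
  by (auto simp: sqf_def fun_eq_iff)

lemma les_sqf:
  assumes "v \<notin> X" "v \<in> W"
  obtains \<delta> :: "nat \<Rightarrow> int" where "\<delta> 0 = 0" "\<And>i. 0 \<le> \<delta> i"
    "\<And>i. \<delta> i \<le> h i (sqf W) (insert v X)" "\<And>i. \<delta> (Suc i) \<le> h i (sqf (W - {v})) X"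
    "\<And>i. h i (sqf W) X = h i (sqf (W - {v})) X + h i (sqf W) (insert v X) - \<delta> i - \<delta> (Suc i)"
proof -
  have "0 < sqf W v" using assms(2) by (simp add: sqf_def)
  show thesis
    by (rule les[OF assms(1) \<open>0 < sqf W v\<close> sqf_upd[symmetric]]) (rule that)
qed

text \<open>When a neighbor \<open>v\<close> is added to the divided variables, the edge to
  \<open>u\<close> still has both ends undivided and kills the middle term. The connecting map is
  then an isomorphism: it deletes \<open>v\<close> from the degree and lowers the homological degree
  by 1.\<close>

lemma h_remove_neighbors:
  assumes "finite S" "S \<subseteq> nbrs E u \<inter> W" "u \<in> W" "X \<inter> S = {}" "u \<notin> X"
  shows "h i (sqf W) (X \<union> S) = (if i < card S then 0 else h (i - card S) (sqf (W - S)) X)"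
  using assms
proof (induction S arbitrary: W i rule: finite_induct)
  case empty
  then show ?case by simp
next
  case (insert v S)
  have vu: "v \<noteq> u" "{u, v} \<in> E" "v \<in> W" using insert.prems edge_neq by (auto simp: nbrs_def)
  have uS: "u \<notin> S" using insert.prems edge_neq[of u u] by (auto simp: nbrs_def)
  have 0: "h i (sqf W) (X \<union> S) = 0" for i
    by (rule h_edge_zero[OF vu(2)]) (use insert vu uS in auto)
  obtain \<delta> :: "nat \<Rightarrow> int" where \<delta>: "\<delta> 0 = 0" "\<And>i. 0 \<le> \<delta> i"
    "\<And>i. \<delta> i \<le> h i (sqf W) (insert v (X \<union> S))" "\<And>i. \<delta> (Suc i) \<le> h i (sqf (W - {v})) (X \<union> S)"
    "\<And>i. h i (sqf W) (X \<union> S) = h i (sqf (W - {v})) (X \<union> S) + h i (sqf W) (insert v (X \<union> S)) - \<delta> i - \<delta> (Suc i)"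
    by (rule les_sqf[of v "X \<union> S" W]) (use insert vu in auto)
  have eq: "h i (sqf W) (insert v (X \<union> S)) = \<delta> i" "\<delta> (Suc i) = h i (sqf (W - {v})) (X \<union> S)" for i
    using \<delta>(3)[of i] \<delta>(4)[of i] \<delta>(5)[of i] 0[of i] by auto
  have IH: "h i (sqf (W - {v})) (X \<union> S) = (if i < card S then 0 else h (i - card S) (sqf (W - {v} - S)) X)" for i
    by (rule insert.IH) (use insert vu in auto)
  have "W - {v} - S = W - insert v S" by blast
  then show ?case
    using eq(1)[of i] eq(2)[of "i - 1"] IH[of "i - 1"] \<delta>(1) insert.hyps
    by (cases i) auto
qed

text \<open>This is the sequence that divides out \<open>u\<close> last. Its middle term has all of
  \<open>W\<close> except \<open>u\<close> divided out; dealing with the neighbors of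
  \<open>u\<close>, and then with \<open>u\<close> itself, turns it into a Betti number of a smaller
  set.\<close>

lemma H_les:
  assumes "u \<in> W"
  obtains \<delta> :: "nat \<Rightarrow> int" where "\<delta> 0 = 0" "\<And>i. 0 \<le> \<delta> i"
    "\<And>i. \<delta> i \<le> H i W" "\<And>i. \<delta> (Suc i) \<le> H i (W - {u})"
    "\<And>i. (if i < card (nbrs E u \<inter> W) then 0 else H (i - card (nbrs E u \<inter> W)) (W - insert u (nbrs E u))) =
      H i (W - {u}) + H i W - \<delta> i - \<delta> (Suc i)"
proof -
  let ?N = "nbrs E u \<inter> W"
  have uN: "u \<notin> nbrs E u" using edge_neq[of u u] by (auto simp: nbrs_def)
  \<comment> \<open>With its neighbors gone, \<open>u\<close> is isolated, so the term with
    \<open>u\<close> divided out vanishes and \<open>u\<close> can be deleted from the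
    degree.\<close>
  have isolated: "h i (sqf V) (V - {u}) = H i (V - {u})" if V: "u \<in> V" "nbrs E u \<inter> V = {}" for V i
  proof -
    obtain \<delta> :: "nat \<Rightarrow> int" where \<delta>: "\<And>i. 0 \<le> \<delta> i" "\<And>i. \<delta> i \<le> h i (sqf V) (insert u (V - {u}))"
      "\<And>i. h i (sqf V) (V - {u}) = h i (sqf (V - {u})) (V - {u}) + h i (sqf V) (insert u (V - {u})) - \<delta> i - \<delta> (Suc i)"
      by (rule les_sqf[of u "V - {u}" V]) (use V(1) in auto)
    have "h i (sqf V) (insert u (V - {u})) = 0" for i
      using H_isolated[OF V] V(1) by (simp add: H_def insert_absorb)
    then have "\<delta> i = 0" for i using \<delta>(1,2)[of i] by simp
    then show ?thesis
      using \<delta>(3)[of i] \<open>h i (sqf V) (insert u (V - {u})) = 0\<close> by (simp add: H_def)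
  qed
  have mid: "h i (sqf W) (W - {u}) = (if i < card ?N then 0 else H (i - card ?N) (W - insert u (nbrs E u)))" for i
  proof -
    have e: "W - {u} = (W - insert u (nbrs E u)) \<union> ?N" "W - insert u (nbrs E u) = (W - ?N) - {u}"
      using uN by auto
    have "h i (sqf W) (W - {u}) = (if i < card ?N then 0 else h (i - card ?N) (sqf (W - ?N)) (W - insert u (nbrs E u)))"
      unfolding e(1) by (rule h_remove_neighbors[where u = u]) (use assms in auto)
    moreover have "h j (sqf (W - ?N)) (W - insert u (nbrs E u)) = H j (W - insert u (nbrs E u))" for j
      unfolding e(2) by (rule isolated) (use assms uN in auto)
    ultimately show ?thesis by simp
  qed
  obtain \<delta> :: "nat \<Rightarrow> int" where "\<delta> 0 = 0" "\<And>i. 0 \<le> \<delta> i"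
    "\<And>i. \<delta> i \<le> h i (sqf W) (insert u (W - {u}))" "\<And>i. \<delta> (Suc i) \<le> h i (sqf (W - {u})) (W - {u})"
    "\<And>i. h i (sqf W) (W - {u}) = h i (sqf (W - {u})) (W - {u}) + h i (sqf W) (insert u (W - {u})) - \<delta> i - \<delta> (Suc i)"
    by (rule les_sqf[of u "W - {u}" W]) (use assms in auto)
  then show thesis
    using that[of \<delta>] assms unfolding mid by (simp add: H_def insert_absorb)
qed

lemma H_leaf:
  assumes "v \<in> W" "nbrs E v \<inter> W = {u}"
  shows "H i W = (if i < card (nbrs E u \<inter> W) then 0 else H (i - card (nbrs E u \<inter> W)) (W - insert u (nbrs E u)))"
proof -
  have u: "u \<in> W" "u \<noteq> v" using assms edge_neq by (auto simp: nbrs_def)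
  obtain \<delta> :: "nat \<Rightarrow> int" where \<delta>: "\<delta> 0 = 0" "\<And>i. 0 \<le> \<delta> i" "\<And>i. \<delta> (Suc i) \<le> H i (W - {u})"
    "\<And>i. (if i < card (nbrs E u \<inter> W) then 0 else H (i - card (nbrs E u \<inter> W)) (W - insert u (nbrs E u))) =
      H i (W - {u}) + H i W - \<delta> i - \<delta> (Suc i)"
    by (rule H_les[OF u(1)]) blast
  have "H i (W - {u}) = 0" for i
    by (rule H_isolated[of v]) (use assms u in auto)
  moreover from this have "\<delta> i = 0" for i
    using \<delta>(1) \<delta>(2)[of i] \<delta>(3)[of "i - 1"] by (cases i) auto
  ultimately show ?thesis using \<delta>(4)[of i] by simp
qed

text \<open>In each degree the source or the target of the map from \<open>H i (W - {u})\<close> to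
  \<open>L i\<close> vanishes, so this map is 0, the long sequence breaks into short ones and
  dimensions add.\<close>

lemma H_delete:
  assumes "u \<in> W"
  defines "L \<equiv> \<lambda>i. if i < card (nbrs E u \<inter> W) then 0 else H (i - card (nbrs E u \<inter> W)) (W - insert u (nbrs E u))"
  assumes split: "\<And>i. L i = 0 \<or> H i (W - {u}) = 0"
  shows "H i W = L i + (if i = 0 then 0 else H (i - 1) (W - {u}))"
proof -
  obtain \<delta> :: "nat \<Rightarrow> int" where \<delta>: "\<delta> 0 = 0" "\<And>i. 0 \<le> \<delta> i" "\<And>i. \<delta> i \<le> H i W" "\<And>i. \<delta> (Suc i) \<le> H i (W - {u})"
    "\<And>i. L i = H i (W - {u}) + H i W - \<delta> i - \<delta> (Suc i)"
    unfolding L_def by (rule H_les[OF assms(1)]) blast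
  have "\<delta> (Suc i) = H i (W - {u})" for i
    using split[of i] \<delta>(2)[of "Suc i"] \<delta>(3)[of i] \<delta>(4)[of i] \<delta>(5)[of i] by auto
  then show ?thesis using \<delta>(1) \<delta>(5)[of i] by (cases i) auto
qed

end

section \<open>Unicyclic graphs\<close>

text \<open>This replaces containing a cycle: it is easily checked on a union of paths, and every
  such set contains an induced cycle.\<close>

definition min_degree2 :: "'v set set \<Rightarrow> 'v set \<Rightarrow> bool" where
  "min_degree2 E U \<longleftrightarrow> U \<noteq> {} \<and> (\<forall>u\<in>U. card (nbrs E u \<inter> U) \<ge> 2)"

definition graph_path :: "'v set set \<Rightarrow> 'v list \<Rightarrow> bool" where
  "graph_path E p \<longleftrightarrow> p \<noteq> [] \<and> distinct p \<and> (\<forall>i. Suc i < length p \<longrightarrow> {p ! i, p ! Suc i} \<in> E)"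

text \<open>A cycle of the graph listed without repetition of its start; unlike for
  \<open>induces_cycle\<close>, chords are allowed.\<close>

definition closed_path :: "'v set set \<Rightarrow> 'v list \<Rightarrow> bool" where
  "closed_path E p \<longleftrightarrow> graph_path E p \<and> length p \<ge> 3 \<and> {last p, hd p} \<in> E"

lemma graph_path_Cons:
  "graph_path E (x # p) \<longleftrightarrow> p = [] \<or> graph_path E p \<and> x \<notin> set p \<and> {x, hd p} \<in> E"
proof (cases p)
  case (Cons y q)
  have "(\<forall>i. Suc i < length (x # p) \<longrightarrow> {(x # p) ! i, (x # p) ! Suc i} \<in> E) \<longleftrightarrow>
      {x, y} \<in> E \<and> (\<forall>i. Suc i < length p \<longrightarrow> {p ! i, p ! Suc i} \<in> E)" (is "?L \<longleftrightarrow> ?R")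
  proof
    assume ?L
    then show ?R using Cons by (auto dest: spec[of _ 0] spec[of _ "Suc i" for i])
  next
    assume R: ?R
    show ?L
    proof (intro allI impI)
      fix i assume "Suc i < length (x # p)"
      then show "{(x # p) ! i, (x # p) ! Suc i} \<in> E" using R Cons by (cases i) auto
    qed
  qed
  then show ?thesis using Cons by (auto simp: graph_path_def)
qed (simp add: graph_path_def)

lemma graph_path_append:
  "graph_path E p \<Longrightarrow> graph_path E q \<Longrightarrow> set p \<inter> set q = {} \<Longrightarrow> {last p, hd q} \<in> E \<Longrightarrow> graph_path E (p @ q)"
proof (induction p)
  case (Cons x p)
  show ?case
  proof (cases "p = []")
    case True
    then show ?thesis using Cons.prems by (simp add: graph_path_Cons)
  next
    case False
    then show ?thesis using Cons by (auto simp: graph_path_Cons)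
  qed
qed (simp add: graph_path_def)

lemma graph_path_rev: "graph_path E p \<Longrightarrow> graph_path E (rev p)"
proof (induction p)
  case (Cons x p)
  show ?case
  proof (cases "p = []")
    case True
    then show ?thesis using Cons.prems by simp
  next
    case False
    then have "graph_path E (rev p)" "x \<notin> set p" "{x, hd p} \<in> E"
      using Cons by (auto simp: graph_path_Cons)
    moreover have "graph_path E [x]" by (simp add: graph_path_def)
    ultimately have "graph_path E (rev p @ [x])"
      using False by (intro graph_path_append) (auto simp: last_rev insert_commute)
    then show ?thesis by simp
  qed
qed simp

lemma graph_path_take: "graph_path E p \<Longrightarrow> 0 < n \<Longrightarrow> graph_path E (take n p)"
  by (auto simp: graph_path_def)

lemma graph_path_drop: "graph_path E p \<Longrightarrow> n < length p \<Longrightarrow> graph_path E (drop n p)"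
  by (auto simp: graph_path_def less_diff_conv add.commute)

lemma closed_path_rotate1: "closed_path E p \<Longrightarrow> closed_path E (rotate1 p)"
proof (cases p)
  case (Cons x q)
  assume "closed_path E p"
  then have q: "graph_path E q" "x \<notin> set q" "{x, hd q} \<in> E" "{last q, x} \<in> E" "length q \<ge> 2" "q \<noteq> []"
    by (auto simp: closed_path_def Cons graph_path_Cons split: if_splits)
  moreover have "graph_path E [x]" by (simp add: graph_path_def)
  ultimately have "graph_path E (q @ [x])" by (intro graph_path_append) auto
  then show ?thesis using q by (auto simp: closed_path_def Cons hd_append)
qed (simp add: closed_path_def)

lemma closed_path_rotate: "closed_path E p \<Longrightarrow> closed_path E (rotate n p)"
  by (induction n) (simp_all add: closed_path_rotate1)

lemma closed_path_hd:
  assumes "closed_path E p" "x \<in> set p"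
  obtains q where "closed_path E (x # q)" "set (x # q) = set p" "length (x # q) = length p"
proof -
  obtain i where i: "i < length p" "p ! i = x" using assms(2) by (auto simp: in_set_conv_nth)
  then have "p \<noteq> []" by auto
  then have "hd (rotate i p) = x" "rotate i p \<noteq> []" using i by (simp_all add: hd_rotate_conv_nth)
  then obtain q where "rotate i p = x # q" by (metis list.collapse)
  then show thesis
    using that[of q] closed_path_rotate[OF assms(1), of i] set_rotate[of i p] length_rotate[of i p] by metis
qed

lemma two_le_card:
  fixes A :: "'v::finite set"
  shows "x \<in> A \<Longrightarrow> y \<in> A \<Longrightarrow> x \<noteq> y \<Longrightarrow> card A \<ge> 2"
  using card_mono[of A "{x, y}"] by simp

lemma closed_path_min_degree2:
  fixes E :: "'v::finite set set"
  assumes "closed_path E p"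
  shows "min_degree2 E (set p)"
  unfolding min_degree2_def
proof (intro conjI ballI)
  show "set p \<noteq> {}" using assms by (auto simp: closed_path_def graph_path_def)
  fix u assume "u \<in> set p"
  then obtain q where q: "closed_path E (u # q)" "set (u # q) = set p"
    using assms by (meson closed_path_hd)
  then obtain y r where yr: "q = y # r" "r \<noteq> []"
    by (cases q; cases "tl q") (auto simp: closed_path_def)
  have "y \<noteq> last r" "{u, y} \<in> E" "{last r, u} \<in> E"
    using q yr by (auto simp: closed_path_def graph_path_Cons)
  then show "2 \<le> card (nbrs E u \<inter> set p)"
    using yr q(2)[symmetric] by (intro two_le_card[of y _ "last r"]) (auto simp: nbrs_def insert_commute)
qed

lemma induces_cycleD:
  assumes "induces_cycle E W"
  obtains vs where "closed_path E vs" "set vs = W"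
    "{e \<in> E. e \<subseteq> W} = {{vs ! i, vs ! ((i + 1) mod length vs)} | i. i < length vs}"
proof -
  obtain vs where vs: "distinct vs" "length vs \<ge> 3" "set vs = W"
       "{e \<in> E. e \<subseteq> W} = {{vs ! i, vs ! ((i + 1) mod length vs)} | i. i < length vs}"
    using assms unfolding induces_cycle_def by blast
  have e: "{vs ! i, vs ! ((i + 1) mod length vs)} \<in> E" if "i < length vs" for i
    using vs(4) that by blast
  have "graph_path E vs"
    unfolding graph_path_def
  proof (intro conjI allI impI)
    fix i assume "Suc i < length vs"
    then show "{vs ! i, vs ! Suc i} \<in> E" using e[of i] by simp
  qed (use vs in auto)
  moreover have "{last vs, hd vs} \<in> E"
    using e[of "length vs - 1"] vs(2) by (cases vs) (auto simp: last_conv_nth)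
  ultimately show thesis using vs that by (simp add: closed_path_def)
qed

lemma ex_longest_path:
  fixes Y :: "'v::finite set"
  assumes "Y \<noteq> {}"
  obtains p where "graph_path E p" "set p \<subseteq> Y"
    "\<And>q. graph_path E q \<Longrightarrow> set q \<subseteq> Y \<Longrightarrow> length q \<le> length p"
proof -
  obtain y where "y \<in> Y" using assms by blast
  then have "graph_path E [y] \<and> set [y] \<subseteq> Y" by (simp add: graph_path_def)
  moreover have "\<forall>q. graph_path E q \<and> set q \<subseteq> Y \<longrightarrow> length q < Suc (card (UNIV :: 'v set))"
    unfolding less_Suc_eq_le by (metis card_mono distinct_card finite_UNIV graph_path_def finite subset_UNIV)
  ultimately show thesis
    using ex_has_greatest_nat[of "\<lambda>q. graph_path E q \<and> set q \<subseteq> Y" "[y]" length] that by metis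
qed

lemma longest_path_nbrs:
  assumes "graph_path E p" "set p \<subseteq> Y"
    "\<And>q. graph_path E q \<Longrightarrow> set q \<subseteq> Y \<Longrightarrow> length q \<le> length p"
  shows "nbrs E (hd p) \<inter> Y \<subseteq> set p"
proof
  fix v assume v: "v \<in> nbrs E (hd p) \<inter> Y"
  show "v \<in> set p"
  proof (rule ccontr)
    assume "v \<notin> set p"
    then have "graph_path E (v # p)" "set (v # p) \<subseteq> Y"
      using assms v by (auto simp: graph_path_Cons nbrs_def insert_commute)
    then have "length (v # p) \<le> length p" by (rule assms(3))
    then show False by simp
  qed
qed

lemma chord_closes:
  assumes "graph_path E p" "a + 2 \<le> b" "b < length p" "{p ! a, p ! b} \<in> E"
  shows "closed_path E (drop a (take (Suc b) p))"
proof -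
  have "graph_path E (drop a (take (Suc b) p))"
    using assms by (intro graph_path_drop graph_path_take) auto
  moreover have "last (drop a (take (Suc b) p)) = p ! b" "hd (drop a (take (Suc b) p)) = p ! a"
    using assms by (simp_all add: hd_drop_conv_nth take_Suc_conv_app_nth)
  ultimately show ?thesis
    using assms by (simp add: closed_path_def insert_commute)
qed

lemma simple_graph_irrefl: "simple_graph E \<Longrightarrow> {x} \<notin> E"
  by (force simp: simple_graph_def)

text \<open>A minimal set of this kind is an induced cycle. The head of a longest path in it has all
  its neighbors on the path, one of them different from the next vertex, and this closes a cycle.
  Minimality makes the cycle use the whole set and rules out chords, which would close a shorter
  cycle.\<close>

lemma min_degree2_contains_cycle:
  fixes E :: "'v::finite set set"
  assumes simple: "simple_graph E" and "min_degree2 E U"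
  obtains W where "W \<subseteq> U" "induces_cycle E W"
proof -
  have "\<exists>V\<in>{V. V \<subseteq> U \<and> min_degree2 E V}. \<forall>V'\<in>{V. V \<subseteq> U \<and> min_degree2 E V}. V' \<subseteq> V \<longrightarrow> V = V'"
    by (rule finite_has_minimal) (use assms in auto)
  then obtain V where V: "V \<subseteq> U" "min_degree2 E V"
    and V_min: "\<forall>V'\<in>{V. V \<subseteq> U \<and> min_degree2 E V}. V' \<subseteq> V \<longrightarrow> V = V'"
    by blast
  have V_min: "V' = V" if "V' \<subseteq> V" "min_degree2 E V'" for V'
    using V_min that V(1) by blast
  obtain p where p: "graph_path E p" "set p \<subseteq> V"
    "\<And>q. graph_path E q \<Longrightarrow> set q \<subseteq> V \<Longrightarrow> length q \<le> length p"
    using ex_longest_path[of V E] V(2) unfolding min_degree2_def by metis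
  have p0: "p \<noteq> []" "distinct p" using p(1) by (auto simp: graph_path_def)
  have "hd p \<in> V" using p p0 by (auto simp: graph_path_def)
  then have "card (nbrs E (hd p) \<inter> V) \<ge> 2" using V(2) by (simp add: min_degree2_def)
  then have "\<not> nbrs E (hd p) \<inter> V \<subseteq> {p ! 1}"
    using card_mono[of "{p ! 1}" "nbrs E (hd p) \<inter> V"] by auto
  then obtain v where v: "v \<in> nbrs E (hd p) \<inter> V" "v \<noteq> p ! 1" by blast
  moreover have "v \<in> set p" using longest_path_nbrs[OF p] v by blast
  ultimately obtain j where j: "j < length p" "v = p ! j" by (auto simp: in_set_conv_nth)
  have "v \<noteq> hd p" using v simple_graph_irrefl[OF simple] by (auto simp: nbrs_def)
  then have "j \<noteq> 0" "j \<noteq> 1" using v j p0 by (auto simp: hd_conv_nth intro: Nat.gr0I)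
  then have j2: "0 + 2 \<le> j" by simp
  define q where "q = take (Suc j) p"
  have q: "closed_path E q" "length q = Suc j" "graph_path E q" "distinct q"
    using chord_closes[OF p(1) j2 j(1)] v j p0 graph_path_take[OF p(1)] by (auto simp: nbrs_def hd_conv_nth q_def)
  have setq: "set q = V"
    using V_min closed_path_min_degree2[OF q(1)] p(2) set_take_subset[of "Suc j" p] unfolding q_def by blast
  have chord: "b = Suc a \<or> a = 0 \<and> b = j" if ab: "a < b" "b \<le> j" "{q ! a, q ! b} \<in> E" for a b
  proof (rule ccontr)
    assume n: "\<not> ?thesis"
    then have c: "closed_path E (drop a (take (Suc b) q))"
      using ab q by (intro chord_closes) auto
    let ?r = "drop a (take (Suc b) q)"
    have "set ?r \<subseteq> V"
      unfolding setq[symmetric] by (meson order_trans set_drop_subset set_take_subset)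
    then have "set ?r = V"
      using V_min closed_path_min_degree2[OF c] by blast
    moreover have "card (set ?r) = length ?r" "card V = length q"
      using q by (auto simp: distinct_card simp flip: setq)
    ultimately have "length ?r = length q" by simp
    then show False using n ab q(2) by auto
  qed
  have edge: "{q ! i, q ! ((i + 1) mod length q)} \<in> E" if "i < length q" for i
  proof (cases "Suc i < length q")
    case True
    then show ?thesis using q(3) by (simp add: graph_path_def)
  next
    case False
    then have "i = j" using that q(2) by simp
    then show ?thesis
      using q(1,2) by (cases "q = []") (auto simp: closed_path_def last_conv_nth hd_conv_nth)
  qed
  have "{e \<in> E. e \<subseteq> V} = {{q ! i, q ! ((i + 1) mod length q)} | i. i < length q}"
  proof (intro equalityI subsetI)
    fix e assume e: "e \<in> {e \<in> E. e \<subseteq> V}"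
    then have "card e = 2" using simple by (simp add: simple_graph_def)
    then obtain x y where xy: "e = {x, y}" "x \<noteq> y" by (meson card_2_iff)
    then have "x \<in> set q" "y \<in> set q" using e setq by auto
    then obtain i i' where i: "i < length q" "x = q ! i" "i' < length q" "y = q ! i'"
      by (auto simp: in_set_conv_nth)
    have "\<exists>a b. a < b \<and> b \<le> j \<and> e = {q ! a, q ! b}"
    proof (cases "i < i'")
      case True
      then show ?thesis using i xy q(2) by (intro exI[of _ i] exI[of _ i']) auto
    next
      case False
      moreover have "i \<noteq> i'" using i xy by auto
      ultimately have "i' < i" by simp
      then show ?thesis using i xy q(2) by (intro exI[of _ i'] exI[of _ i]) auto
    qed
    then obtain a b where ab: "a < b" "b \<le> j" "e = {q ! a, q ! b}" by blast
    then consider "b = Suc a" | "a = 0" "b = j" using chord e by blast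
    then show "e \<in> {{q ! i, q ! ((i + 1) mod length q)} | i. i < length q}"
    proof cases
      case 1
      then show ?thesis using ab q(2) by (intro CollectI exI[of _ a]) auto
    next
      case 2
      then show ?thesis using ab q(2) by (intro CollectI exI[of _ j]) auto
    qed
  next
    fix e assume "e \<in> {{q ! i, q ! ((i + 1) mod length q)} | i. i < length q}"
    then obtain i where i: "i < length q" "e = {q ! i, q ! ((i + 1) mod length q)}" by blast
    then have "e \<in> E" using edge by simp
    moreover have "(i + 1) mod length q < length q" using i(1) by (intro mod_less_divisor) linarith
    then have "e \<subseteq> set q" using i by auto
    ultimately show "e \<in> {e \<in> E. e \<subseteq> V}" using setq by simp
  qed
  then have "induces_cycle E V"
    unfolding induces_cycle_def using q j2 setq by (intro exI[of _ q]) auto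
  then show thesis using that V(1) by blast
qed

lemma adj_on_mono: "A \<subseteq> B \<Longrightarrow> (adj_on E A)\<^sup>* \<subseteq> (adj_on E B)\<^sup>*"
  by (rule rtrancl_mono) (auto simp: adj_on_def)

lemma graph_path_connected: "graph_path E p \<Longrightarrow> connected_on E (set p)"
proof (induction p)
  case (Cons x p)
  show ?case
  proof (cases "p = []")
    case True
    then show ?thesis by (simp add: connected_on_def)
  next
    case False
    let ?R = "(adj_on E (set (x # p)))\<^sup>*"
    have p: "connected_on E (set p)" "{x, hd p} \<in> E" "hd p \<in> set p"
      using Cons False by (auto simp: graph_path_Cons)
    have 1: "(u, v) \<in> ?R" if "u \<in> set p" "v \<in> set p" for u v
      using p(1) that adj_on_mono[of "set p" "set (x # p)" E] unfolding connected_on_def by auto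
    have 2: "(x, hd p) \<in> ?R" "(hd p, x) \<in> ?R"
      using p by (auto simp: adj_on_def insert_commute intro!: r_into_rtrancl)
    have "(x, v) \<in> ?R" "(v, x) \<in> ?R" if "v \<in> set p" for v
      using 1[OF p(3) that] 1[OF that p(3)] 2 by (meson rtrancl_trans)+
    then show ?thesis
      unfolding connected_on_def using 1 by auto
  qed
qed (simp add: connected_on_def)

text \<open>After rotating the deleted vertex to the front, what is left is a path.\<close>

lemma closed_path_nonseparable:
  assumes "closed_path E p"
  shows "nonseparable E (set p)"
  unfolding nonseparable_def
proof (intro conjI allI)
  have p: "graph_path E p" "length p \<ge> 3" using assms by (auto simp: closed_path_def)
  then have "card (set p) = length p" by (simp add: graph_path_def distinct_card)
  then show "2 \<le> card (set p)" using p by simp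
  show "connected_on E (set p)" using p by (intro graph_path_connected)
  fix v
  show "\<not> cut_vertex E (set p) v"
  proof
    assume v: "cut_vertex E (set p) v"
    then obtain q where q: "closed_path E (v # q)" "set (v # q) = set p" "length (v # q) = length p"
      using assms by (meson closed_path_hd cut_vertex_def)
    then have "q \<noteq> []" "graph_path E q" "v \<notin> set q" using p by (auto simp: closed_path_def graph_path_Cons)
    then have "connected_on E (set q)" "set p - {v} = set q"
      using graph_path_connected q by auto
    then show False using v by (simp add: cut_vertex_def)
  qed
qed


section \<open>The unique cycle of a unicyclic graph\<close>

locale unicyclic_graph =
  fixes E :: "'v::finite set set"
  assumes unicyclic: "unicyclic E"
begin

lemma simple: "simple_graph E"
  using unicyclic by (simp add: unicyclic_def)

lemma irrefl: "u \<notin> nbrs E u"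
  using simple_graph_irrefl[OF simple] by (simp add: nbrs_def)

lemma nbrs_sym: "v \<in> nbrs E u \<longleftrightarrow> u \<in> nbrs E v"
  by (simp add: nbrs_def insert_commute)

text \<open>By finiteness the nonseparable set of the path extends to a block. It has at least three
  vertices, so it is no edge and must be the one block that is a cycle.\<close>

lemma closed_path_in_block:
  assumes "closed_path E p" "block E C" "induces_cycle E C"
  shows "set p \<subseteq> C"
proof -
  have "\<exists>B\<in>{W. nonseparable E W \<and> set p \<subseteq> W}. \<forall>W\<in>{W. nonseparable E W \<and> set p \<subseteq> W}. B \<subseteq> W \<longrightarrow> B = W"
    by (rule finite_has_maximal) (use closed_path_nonseparable[OF assms(1)] in auto)
  then obtain B where B: "nonseparable E B" "set p \<subseteq> B"
    and max: "\<forall>W\<in>{W. nonseparable E W \<and> set p \<subseteq> W}. B \<subseteq> W \<longrightarrow> B = W" by blast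
  then have "block E B" unfolding block_def by blast
  have "card (set p) = length p" "length p \<ge> 3"
    using assms(1) by (auto simp: closed_path_def graph_path_def distinct_card)
  moreover have "card (set p) \<le> card B" by (intro card_mono B) simp
  ultimately have "B \<notin> E" using simple by (auto simp: simple_graph_def)
  then have "induces_cycle E B"
    using unicyclic \<open>block E B\<close> unfolding unicyclic_def by blast
  then have "B = C"
    using unicyclic \<open>block E B\<close> assms(2,3) unfolding unicyclic_def by blast
  then show ?thesis using B(2) by simp
qed

text \<open>A vertex of an induced cycle has only its predecessor and successor as possible
  neighbors, so degree two within \<open>W\<close> forces the successor into \<open>W\<close>, and
  going round fills the cycle.\<close>

lemma induced_cycle_subset_eq:
  assumes "induces_cycle E C" "min_degree2 E W" "W \<subseteq> C"
  shows "W = C"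
proof -
  obtain cs where cs: "closed_path E cs" "set cs = C"
    and edges: "{e \<in> E. e \<subseteq> C} = {{cs ! i, cs ! ((i + 1) mod length cs)} | i. i < length cs}"
    using assms(1) by (rule induces_cycleD)
  let ?n = "length cs"
  have n: "?n \<ge> 3" and d: "distinct cs" using cs(1) by (auto simp: closed_path_def graph_path_def)
  have step: "cs ! ((i + 1) mod ?n) \<in> W" if i: "i < ?n" "cs ! i \<in> W" for i
  proof (rule ccontr)
    assume notin: "cs ! ((i + 1) mod ?n) \<notin> W"
    \<comment> \<open>Adding \<open>?n - 1\<close> modulo \<open>?n\<close> gives the cyclic
      predecessor, also for index 0.\<close>
    have "nbrs E (cs ! i) \<inter> W \<subseteq> {cs ! ((i + (?n - 1)) mod ?n)}"
    proof
      fix y assume y: "y \<in> nbrs E (cs ! i) \<inter> W"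
      then have "{cs ! i, y} \<in> {e \<in> E. e \<subseteq> C}" using i assms(3) by (auto simp: nbrs_def)
      then obtain j where j: "j < ?n" "{cs ! i, y} = {cs ! j, cs ! ((j + 1) mod ?n)}"
        unfolding edges by blast
      have j1: "(j + 1) mod ?n < ?n" using j(1) by (intro mod_less_divisor) linarith
      consider "cs ! i = cs ! j" "y = cs ! ((j + 1) mod ?n)" | "cs ! i = cs ! ((j + 1) mod ?n)" "y = cs ! j"
        using j(2) by (auto simp: doubleton_eq_iff)
      then show "y \<in> {cs ! ((i + (?n - 1)) mod ?n)}"
      proof cases
        case 1
        then have "i = j" using d i(1) j(1) by (simp add: nth_eq_iff_index_eq)
        then show ?thesis using 1 y notin by auto
      next
        case 2
        then have "i = (j + 1) mod ?n" using d i(1) j1 by (simp add: nth_eq_iff_index_eq)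
        then have "(i + (?n - 1)) mod ?n = (j + 1 + (?n - 1)) mod ?n" by (simp add: mod_add_left_eq)
        also have "j + 1 + (?n - 1) = j + ?n" using n by simp
        also have "(j + ?n) mod ?n = j" using j(1) by simp
        finally show ?thesis using 2 by simp
      qed
    qed
    then have "card (nbrs E (cs ! i) \<inter> W) \<le> 1"
      using card_mono[of "{cs ! ((i + (?n - 1)) mod ?n)}" "nbrs E (cs ! i) \<inter> W"] by simp
    then show False using assms(2) i(2) by (force simp: min_degree2_def)
  qed
  obtain w where "w \<in> W" using assms(2) by (auto simp: min_degree2_def)
  then obtain i0 where i0: "i0 < ?n" "cs ! i0 \<in> W" using assms(3) cs(2) by (metis in_set_conv_nth subsetD)
  have all: "cs ! ((i0 + k) mod ?n) \<in> W" for k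
  proof (induction k)
    case (Suc k)
    have "(i0 + k) mod ?n < ?n" using i0(1) by (intro mod_less_divisor) linarith
    from step[OF this Suc] show ?case by (simp add: mod_Suc_eq)
  qed (use i0 in simp)
  have "C \<subseteq> W"
  proof
    fix x assume "x \<in> C"
    then obtain j where j: "j < ?n" "x = cs ! j" using cs(2) by (metis in_set_conv_nth)
    have "(i0 + (?n - i0 + j)) mod ?n = j" using i0(1) j(1) by simp
    then show "x \<in> W" using all[of "?n - i0 + j"] j by simp
  qed
  then show ?thesis using assms(3) by blast
qed

lemma induces_cycle_min_degree2: "induces_cycle E W \<Longrightarrow> min_degree2 E W"
  by (metis closed_path_min_degree2 induces_cycleD)

text \<open>Unicyclicity speaks of cycles that are blocks, whereas \<open>the_cycle\<close>
  describes any induced cycle. Such a cycle lies in the cycle block and, having minimum degree two,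
  fills it.\<close>

lemma ex1_induced_cycle: "\<exists>!C. induces_cycle E C"
proof -
  obtain C where C: "block E C" "induces_cycle E C" using unicyclic unfolding unicyclic_def by blast
  show ?thesis
  proof (rule ex1I[of _ C])
    fix W assume W: "induces_cycle E W"
    then obtain p where "closed_path E p" "set p = W" by (rule induces_cycleD)
    then have "W \<subseteq> C" using closed_path_in_block[OF _ C] by blast
    then show "W = C" by (rule induced_cycle_subset_eq[OF C(2) induces_cycle_min_degree2[OF W]])
  qed (fact C)
qed

abbreviation "cyc \<equiv> the_cycle E"

lemma induces_cycle_cyc: "induces_cycle E cyc"
  unfolding the_cycle_def by (rule theI'[OF ex1_induced_cycle])

lemma cyc_subset:
  assumes "min_degree2 E U"
  shows "cyc \<subseteq> U"
proof -
  obtain W where "W \<subseteq> U" "induces_cycle E W"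
    using min_degree2_contains_cycle[OF simple assms] by blast
  then show ?thesis using ex1_induced_cycle induces_cycle_cyc by blast
qed

lemma closed_path_cyc: "closed_path E p \<Longrightarrow> cyc \<subseteq> set p"
  by (simp add: closed_path_min_degree2 cyc_subset)

text \<open>An arc that omits a vertex of the cycle, once closed up outside, gives a closed path
  that cannot contain the cycle. An initial segment from \<open>x\<close> does this unless
  \<open>y\<close> is the last vertex; then the closing edge is used.\<close>

lemma ex_arc:
  assumes "x \<in> cyc" "y \<in> cyc" "x \<noteq> y"
  obtains q where "graph_path E q" "hd q = x" "last q = y" "set q \<subseteq> cyc" "set q \<noteq> cyc"
proof -
  obtain cs where cs: "closed_path E cs" "set cs = cyc"
    using induces_cycle_cyc by (rule induces_cycleD)
  then obtain r where r: "closed_path E (x # r)" "set (x # r) = cyc"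
    using assms(1) by (metis closed_path_hd)
  let ?c = "x # r"
  have c: "graph_path E ?c" "distinct ?c" "length ?c \<ge> 3" "{last ?c, x} \<in> E"
    using r(1) by (auto simp: closed_path_def graph_path_def)
  have card: "card cyc = length ?c" using distinct_card[OF c(2)] r(2) by simp
  obtain j where j: "j < length ?c" "?c ! j = y" using assms(2) r(2) by (metis in_set_conv_nth)
  show thesis
  proof (cases "Suc j < length ?c")
    case True
    let ?q = "take (Suc j) ?c"
    show thesis
    proof (rule that[of ?q])
      show "graph_path E ?q" using c(1) by (rule graph_path_take) simp
      show "last ?q = y" using j by (simp add: take_Suc_conv_app_nth del: take_Suc_Cons)
      show "set ?q \<subseteq> cyc" using r(2) set_take_subset by metis
      have "card (set ?q) \<le> length ?q" by (rule card_length)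
      then show "set ?q \<noteq> cyc" using card True by auto
    qed simp
  next
    case False
    then have "j = length ?c - 1" using j(1) by simp
    then have "y = last ?c" using j(2) by (metis last_conv_nth list.distinct(1))
    then have "{x, y} \<in> E" using c(4) by (simp add: insert_commute)
    show thesis
    proof (rule that[of "[x, y]"])
      show "graph_path E [x, y]" using \<open>{x, y} \<in> E\<close> assms(3) by (simp add: graph_path_Cons graph_path_def)
      have "card (set [x, y]) \<le> 2" by (rule order_trans[OF card_length]) simp
      then show "set [x, y] \<noteq> cyc" using card c(3) by auto
    qed (use assms in auto)
  qed
qed

text \<open>A longest path outside the cycle is an ear if no end of it has degree one.\<close>

lemma ex_leaf:
  assumes "cyc \<subseteq> W" "W \<noteq> cyc"
  obtains v where "v \<in> W - cyc" "card (nbrs E v \<inter> W) \<le> 1"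
proof -
  have "\<exists>v\<in>W - cyc. card (nbrs E v \<inter> W) \<le> 1"
  proof (rule ccontr)
    assume "\<not> ?thesis"
    then have deg: "card (nbrs E v \<inter> W) \<ge> 2" if "v \<in> W - cyc" for v using that by force
    have notsub: "\<not> cyc \<subseteq> A" if "A \<subseteq> - cyc" for A
      using that induces_cycle_min_degree2[OF induces_cycle_cyc] by (auto simp: min_degree2_def)
    obtain p where p: "graph_path E p" "set p \<subseteq> W - cyc"
      "\<And>q. graph_path E q \<Longrightarrow> set q \<subseteq> W - cyc \<Longrightarrow> length q \<le> length p"
      using ex_longest_path[of "W - cyc" E] assms by blast
    have end_nbrs: "nbrs E (hd q) \<inter> W \<subseteq> cyc \<union> {q ! 1}"
      if q: "graph_path E q" "set q = set p" "length q = length p" for q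
    proof
      fix y assume y: "y \<in> nbrs E (hd q) \<inter> W"
      show "y \<in> cyc \<union> {q ! 1}"
      proof (rule ccontr)
        assume n: "y \<notin> cyc \<union> {q ! 1}"
        then have "y \<in> set q" using longest_path_nbrs[of E q "W - cyc"] p q y by auto
        then obtain j where j: "j < length q" "y = q ! j" by (auto simp: in_set_conv_nth)
        have "q \<noteq> []" using q by (simp add: graph_path_def)
        then have "j \<noteq> 0" "j \<noteq> 1" using y j n irrefl[of "hd q"] by (auto simp: hd_conv_nth intro: Nat.gr0I)
        then have "closed_path E (drop 0 (take (Suc j) q))"
          using y j \<open>q \<noteq> []\<close> by (intro chord_closes q) (auto simp: nbrs_def hd_conv_nth)
        then have "cyc \<subseteq> set (take (Suc j) q)" using closed_path_cyc by simp
        moreover have "set (take (Suc j) q) \<subseteq> - cyc" using q(2) p(2) set_take_subset[of "Suc j" q] by blast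
        ultimately show False using notsub by blast
      qed
    qed
    \<comment> \<open>An end of the path has two neighbors in \<open>W\<close>, at most one of them
      off the cycle. A path of one vertex has both on the cycle, so a given \<open>d\<close> can be
      avoided; this will provide two distinct attachments. For longer paths \<open>d\<close> is off
      the cycle and excludes nothing.\<close>
    have ex_nbr: "\<exists>c\<in>cyc. c \<in> nbrs E (hd q) \<and> c \<noteq> d"
      if q: "graph_path E q" "set q = set p" "length q = length p" "length q = 1 \<or> d \<notin> cyc" for q d
    proof (rule ccontr)
      assume n: "\<not> ?thesis"
      have "hd q \<in> W - cyc" using p(2) q by (metis graph_path_def hd_in_set subsetD)
      then have 2: "card (nbrs E (hd q) \<inter> W) \<ge> 2" by (rule deg)
      have "nbrs E (hd q) \<inter> W \<subseteq> {d} \<or> nbrs E (hd q) \<inter> W \<subseteq> {q ! 1}"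
      proof (cases "length q = 1")
        case True
        then obtain z where "q = [z]" by (auto simp: length_Suc_conv)
        then have z: "q = [z]" "z \<notin> nbrs E z" "z \<in> W - cyc" using irrefl \<open>hd q \<in> W - cyc\<close> by auto
        have "nbrs E z \<inter> (W - cyc) \<subseteq> set p"
          using longest_path_nbrs[of E q "W - cyc"] p q z by auto
        then show ?thesis using n end_nbrs[OF q(1-3)] z q(2) by auto
      next
        case False
        then show ?thesis using n end_nbrs[OF q(1-3)] q(4) by auto
      qed
      then obtain e where "nbrs E (hd q) \<inter> W \<subseteq> {e}" by blast
      then have "card (nbrs E (hd q) \<inter> W) \<le> 1" using card_mono[of "{e}"] by fastforce
      then show False using 2 by simp
    qed
    have p0: "p \<noteq> []" using p(1) by (simp add: graph_path_def)
    obtain c1 where c1: "c1 \<in> cyc" "c1 \<in> nbrs E (hd p)"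
      using ex_nbr[of p "hd p"] p(1,2) hd_in_set[OF p0] by auto
    obtain c2 where c2: "c2 \<in> cyc" "c2 \<in> nbrs E (last p)" "length p = 1 \<longrightarrow> c2 \<noteq> c1"
    proof -
      let ?d = "if length p = 1 then c1 else hd p"
      have "\<exists>c\<in>cyc. c \<in> nbrs E (hd (rev p)) \<and> c \<noteq> ?d"
        by (rule ex_nbr) (use p hd_in_set[OF p0] graph_path_rev in auto)
      then show thesis using that p0 by (auto simp: hd_rev split: if_splits)
    qed
    \<comment> \<open>Both cases close up the longest path outside the cycle: through one vertex if
      its ends attach at the same place, through an arc otherwise. Either closed path misses part of
      the cycle.\<close>
    show False
    proof (cases "c1 = c2")
      case True
      have "length p \<noteq> 1" using True c2 by simp
      then have "length p \<ge> 2" using p0 by (cases p) (auto simp: Suc_le_eq)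
      then have "closed_path E (c1 # p)"
        using c1 c2 p p0 True by (auto simp: closed_path_def graph_path_Cons nbrs_def insert_commute)
      then have "cyc \<subseteq> insert c1 (set p)" using closed_path_cyc by fastforce
      then have "cyc \<subseteq> {c1}" using p(2) by blast
      moreover have "card cyc \<ge> 3"
        using induces_cycle_cyc unfolding induces_cycle_def by (metis distinct_card)
      ultimately show False using card_mono[of "{c1}" cyc] by simp
    next
      case False
      then obtain q where q: "graph_path E q" "hd q = c1" "last q = c2" "set q \<subseteq> cyc" "set q \<noteq> cyc"
        using ex_arc c1(1) c2(1) by metis
      have q0: "q \<noteq> []" using q(1) by (simp add: graph_path_def)
      have "length q \<ge> 2" using False q q0 by (cases q; cases "tl q") auto
      moreover have "graph_path E (q @ rev p)"
        using q p(2) p0 c2 graph_path_rev[OF p(1)]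
        by (intro graph_path_append) (auto simp: hd_rev nbrs_def insert_commute)
      moreover have "length p \<ge> 1" using p0 by (cases p) auto
      ultimately have "closed_path E (q @ rev p)"
        using q p0 q0 c1 by (auto simp: closed_path_def hd_append last_rev nbrs_def)
      then have "cyc \<subseteq> set q \<union> set p" using closed_path_cyc by fastforce
      then show False using p(2) q(4,5) by blast
    qed
  qed
  then show thesis using that by blast
qed

lemma dist_to_set_le_2:
  assumes "dist_to_set E v cyc \<le> 2" "v \<notin> cyc"
  obtains c where "c \<in> cyc" "c \<in> nbrs E v \<or> (\<exists>w. w \<in> nbrs E v \<and> c \<in> nbrs E w)"
proof -
  have "dist_to_set E v cyc < 3" using assms(1) by (rule le_less_trans) simp
  then obtain c where c: "c \<in> cyc" "graph_dist E v c < 3"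
    unfolding dist_to_set_def by (auto simp: INF_less_iff)
  then obtain l where l: "(v, c) \<in> adj_on E UNIV ^^ l" "enat l < 3"
    unfolding graph_dist_def by (auto simp: INF_less_iff)
  then have "l < 3" by (simp add: numeral_eq_enat)
  then consider "l = 0" | "l = 1" | "l = 2" by linarith
  then show thesis
  proof cases
    case 1
    then show ?thesis using l c(1) assms(2) by simp
  next
    case 2
    then show ?thesis using l c(1) that by (auto simp: adj_on_def nbrs_def)
  next
    case 3
    then show ?thesis using l c(1) that by (auto simp: adj_on_def nbrs_def numeral_2_eq_2)
  qed
qed

text \<open>Otherwise a shortest path from the neighbor of the leaf to the cycle closes up with one from the leaf.\<close>

lemma leaf_nbr_near_cyc:
  assumes near: "\<And>v. dist_to_set E v cyc \<le> 2"
    and "cyc \<subseteq> W" "v \<in> W - cyc" "nbrs E v \<inter> W = {u}"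
  shows "insert u (nbrs E u) \<inter> cyc \<noteq> {}"
proof (rule ccontr)
  assume no: "\<not> ?thesis"
  have u: "u \<in> nbrs E v" "v \<in> nbrs E u" using assms(4) nbrs_sym by auto
  obtain c where c: "c \<in> cyc" "c \<in> nbrs E v \<or> (\<exists>w. w \<in> nbrs E v \<and> c \<in> nbrs E w)"
    using dist_to_set_le_2[OF near] assms(3) by blast
  have "c \<notin> nbrs E v" using c(1) assms(2,4) no by auto
  then obtain w where w: "w \<in> nbrs E v" "c \<in> nbrs E w" using c(2) by blast
  then have wu: "w \<noteq> u" using no c(1) by auto
  have wc: "w \<notin> cyc" using w(1) assms(2,4) wu by auto
  obtain c' where c': "c' \<in> cyc" "c' \<in> nbrs E u \<or> (\<exists>w. w \<in> nbrs E u \<and> c' \<in> nbrs E w)"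
    using dist_to_set_le_2[OF near, of u] no by auto
  then obtain w' where w': "w' \<in> nbrs E u" "c' \<in> nbrs E w'" using no by auto
  have w'c: "w' \<notin> cyc" using w'(1) no by auto
  \<comment> \<open>Each vertex of \<open>?Y\<close> off the cycle has two neighbors in
    \<open>?Y\<close>: \<open>u\<close> and \<open>w\<close> for \<open>v\<close>, \<open>v\<close>
    and \<open>w'\<close> for \<open>u\<close>, \<open>v\<close> and \<open>c\<close> for
    \<open>w\<close>, \<open>u\<close> and \<open>c'\<close> for \<open>w'\<close>. This contradicts
    \<open>ex_leaf\<close>.\<close>
  let ?Y = "cyc \<union> {v, u, w, w'}"
  have "?Y \<noteq> cyc" using assms(3) by blast
  then obtain y where y: "y \<in> ?Y - cyc" "card (nbrs E y \<inter> ?Y) \<le> 1"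
    using ex_leaf[of ?Y] by blast
  have two: "\<not> (a \<in> nbrs E y \<and> b \<in> nbrs E y \<and> a \<in> ?Y \<and> b \<in> ?Y \<and> a \<noteq> b)" for a b
    using two_le_card[of a "nbrs E y \<inter> ?Y" b] y(2) by auto
  have sym: "v \<in> nbrs E w" "u \<in> nbrs E w'" using w w' nbrs_sym by blast+
  have "v \<noteq> c" "u \<noteq> c'" "v \<noteq> w'"
    using c(1) c'(1) no assms(3) w'(2) \<open>c \<notin> nbrs E v\<close> assms(2,4) by auto
  consider "y = v" | "y = u" | "y = w" | "y = w'" using y(1) by blast
  then show False
  proof cases
    case 1
    then show ?thesis using two[of u w] u w wu by blast
  next
    case 2
    then show ?thesis using two[of v w'] u w' \<open>v \<noteq> w'\<close> by blast
  next
    case 3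
    then show ?thesis using two[of v c] sym w c \<open>v \<noteq> c\<close> by blast
  next
    case 4
    then show ?thesis using two[of u c'] sym w' c' \<open>u \<noteq> c'\<close> by blast
  qed
qed

end

section \<open>Betti numbers of unicyclic graphs\<close>

locale unicyclic_resolution = edge_ideal_resolution M len deg C E + unicyclic_graph E
  for M :: "('v::finite \<Rightarrow> nat) \<Rightarrow> bool" and len deg and C :: "nat \<Rightarrow> nat \<Rightarrow> nat \<Rightarrow> 'k::field" and E
begin

lemma ex_degree_le_1:
  assumes "\<not> cyc \<subseteq> W" "W \<noteq> {}"
  obtains v where "v \<in> W" "card (nbrs E v \<inter> W) \<le> 1"
proof -
  have "\<not> min_degree2 E W" using cyc_subset assms(1) by blast
  then show thesis using that assms(2) unfolding min_degree2_def by fastforce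
qed

lemma card_le_1_cases:
  fixes A :: "'v set"
  assumes "card A \<le> 1"
  obtains "A = {}" | u where "A = {u}"
  using assms by (cases "card A = 0") (auto simp: card_1_singleton_iff le_Suc_eq)

lemma H_forest:
  assumes "\<not> cyc \<subseteq> W"
  shows "(\<forall>i. H i W = 0) \<or> (\<exists>s. \<forall>i. H i W = (if i = s then 1 else 0))"
  using assms
proof (induction "card W" arbitrary: W rule: less_induct)
  case less
  show ?case
  proof (cases "W = {}")
    case True
    then show ?thesis by (auto simp: H_empty)
  next
    case False
    then obtain v where v: "v \<in> W" "card (nbrs E v \<inter> W) \<le> 1"
      using ex_degree_le_1[OF less.prems] by blast
    show ?thesis
    proof (rule card_le_1_cases[OF v(2)])
      assume "nbrs E v \<inter> W = {}"
      then show ?thesis using H_isolated[OF v(1)] by blast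
    next
      fix u assume u: "nbrs E v \<inter> W = {u}"
      let ?W = "W - insert u (nbrs E u)" and ?d = "card (nbrs E u \<inter> W)"
      have "u \<in> W" using u by blast
      then have "card ?W < card W" by (intro psubset_card_mono) auto
      then have "(\<forall>i. H i ?W = 0) \<or> (\<exists>s. \<forall>i. H i ?W = (if i = s then 1 else 0))"
        by (rule less.hyps) (use less.prems in blast)
      then show ?thesis
      proof
        assume "\<forall>i. H i ?W = 0"
        then show ?thesis using H_leaf[OF v(1) u] by simp
      next
        assume "\<exists>s. \<forall>i. H i ?W = (if i = s then 1 else 0)"
        then obtain s where s: "\<forall>i. H i ?W = (if i = s then 1 else 0)" ..
        have "H i W = (if i = s + ?d then 1 else 0)" for i
          unfolding H_leaf[OF v(1) u] using s by auto
        then show ?thesis by blast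
      qed
    qed
  qed
qed

lemma H_forest_le_1: "\<not> cyc \<subseteq> W \<Longrightarrow> H i W \<le> 1"
  using H_forest[of W] by (metis order_refl zero_le_one)

lemma ex_cyc_enum:
  obtains cs where "distinct cs" "length cs = girth E" "girth E \<ge> 3" "set cs = cyc"
    "\<And>i j. i < girth E \<Longrightarrow> j < girth E \<Longrightarrow>
      cs ! j \<in> nbrs E (cs ! i) \<longleftrightarrow> j = (i + 1) mod girth E \<or> i = (j + 1) mod girth E"
proof -
  obtain cs where cs: "distinct cs" "length cs \<ge> 3" "set cs = cyc"
    "{e \<in> E. e \<subseteq> cyc} = {{cs ! i, cs ! ((i + 1) mod length cs)} | i. i < length cs}"
    using induces_cycle_cyc unfolding induces_cycle_def by blast
  have len: "length cs = girth E" unfolding girth_def using cs by (metis distinct_card)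
  let ?m = "girth E"
  have adj: "cs ! j \<in> nbrs E (cs ! i) \<longleftrightarrow> j = (i + 1) mod ?m \<or> i = (j + 1) mod ?m"
    if ij: "i < ?m" "j < ?m" for i j
  proof -
    have m: "(k + 1) mod ?m < ?m" for k using ij by (intro mod_less_divisor) linarith
    have eq: "cs ! a = cs ! b \<longleftrightarrow> a = b" if "a < ?m" "b < ?m" for a b
      using cs(1) that len by (simp add: nth_eq_iff_index_eq)
    have "cs ! i \<in> cyc" "cs ! j \<in> cyc" unfolding cs(3)[symmetric] using ij len by simp_all
    then have "cs ! j \<in> nbrs E (cs ! i) \<longleftrightarrow> {cs ! i, cs ! j} \<in> {e \<in> E. e \<subseteq> cyc}"
      by (simp add: nbrs_def)
    also have "\<dots> \<longleftrightarrow> (\<exists>k<?m. {cs ! i, cs ! j} = {cs ! k, cs ! ((k + 1) mod ?m)})"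
      unfolding cs(4) len by blast
    also have "\<dots> \<longleftrightarrow> (\<exists>k<?m. i = k \<and> j = (k + 1) mod ?m \<or> i = (k + 1) mod ?m \<and> j = k)"
      by (intro ex_cong1 conj_cong refl) (simp add: doubleton_eq_iff eq ij m)
    also have "\<dots> \<longleftrightarrow> j = (i + 1) mod ?m \<or> i = (j + 1) mod ?m" using ij by blast
    finally show ?thesis .
  qed
  have "?m \<ge> 3" using cs(2) len by simp
  from that[OF cs(1) len this cs(3) adj] show thesis .
qed

section \<open>Betti numbers of paths in the cycle and of the cycle\<close>

context
  fixes cs
  assumes cs: "distinct cs" "length cs = girth E" "girth E \<ge> 3" "set cs = cyc"
    and adj: "\<And>i j. i < girth E \<Longrightarrow> j < girth E \<Longrightarrow>
      cs ! j \<in> nbrs E (cs ! i) \<longleftrightarrow> j = (i + 1) mod girth E \<or> i = (j + 1) mod girth E"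
begin

lemma inj_cs: "A \<subseteq> {..<girth E} \<Longrightarrow> inj_on ((!) cs) A"
  using cs(1,2) by (auto intro!: inj_on_nth)

lemma image_nbrs:
  assumes "A \<subseteq> {..<girth E}" "i < girth E"
  shows "nbrs E (cs ! i) \<inter> (!) cs ` A = (!) cs ` {j \<in> A. j = (i + 1) mod girth E \<or> i = (j + 1) mod girth E}"
  using adj[OF assms(2)] assms(1) by auto

lemma image_diff_nbrs:
  assumes "A \<subseteq> {..<girth E}" "i < girth E"
  shows "(!) cs ` A - insert (cs ! i) (nbrs E (cs ! i)) =
    (!) cs ` {j \<in> A. j \<noteq> i \<and> j \<noteq> (i + 1) mod girth E \<and> i \<noteq> (j + 1) mod girth E}"
proof -
  have "cs ! j \<noteq> cs ! i" if "j \<in> A" "j \<noteq> i" for j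
    using that assms cs(1,2) by (auto simp: nth_eq_iff_index_eq subset_iff)
  then show ?thesis using adj[OF assms(2)] assms(1) by auto
qed

text \<open>Stripping the first vertex as a leaf removes three vertices and raises the homological
  degree by 2, hence the period 3. Two remaining vertices form an edge and add 1; a single one is
  isolated. The bound \<open>1 \<le> a\<close> keeps index 0 out, so that no adjacency wraps
  around.\<close>

lemma H_path:
  assumes "1 \<le> a" "a + l \<le> girth E"
  shows "H i ((!) cs ` {a..<a + l}) =
    (if l mod 3 = 0 then (if i = 2 * (l div 3) then 1 else 0)
     else if l mod 3 = 1 then 0 else (if i = 2 * (l div 3) + 1 then 1 else 0))"
  using assms
proof (induction l arbitrary: a i rule: less_induct)
  case (less l)
  let ?m = "girth E" and ?P = "(!) cs ` {a..<a + l}"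
  have m: "(j + 1) mod ?m = j + 1 \<or> (j + 1) mod ?m = 0" if "j < ?m" for j
    using that by (cases "j + 1 = ?m") auto
  have adj': "j = (i + 1) mod ?m \<or> i = (j + 1) mod ?m \<longleftrightarrow> j = i + 1 \<or> i = j + 1"
    if "j \<in> {a..<a + l}" "i \<in> {a..<a + l}" for i j
  proof -
    have "i < ?m" "j < ?m" "1 \<le> i" "1 \<le> j" using that less.prems by auto
    then show ?thesis using m[of i] m[of j] by (cases "i + 1 = ?m"; cases "j + 1 = ?m") auto
  qed
  have sub: "{a..<a + l} \<subseteq> {..<?m}" using less.prems by auto
  have nbrs: "nbrs E (cs ! i) \<inter> ?P = (!) cs ` {j \<in> {a..<a + l}. j = i + 1 \<or> i = j + 1}"
    "?P - insert (cs ! i) (nbrs E (cs ! i)) = (!) cs ` {j \<in> {a..<a + l}. j \<noteq> i \<and> j \<noteq> i + 1 \<and> i \<noteq> j + 1}"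
    if i: "i \<in> {a..<a + l}" for i
  proof -
    have im: "i < ?m" using i sub by blast
    have "{j \<in> {a..<a + l}. j = (i + 1) mod ?m \<or> i = (j + 1) mod ?m} = {j \<in> {a..<a + l}. j = i + 1 \<or> i = j + 1}"
      by (rule Collect_cong, rule conj_cong[OF refl adj'[OF _ i]])
    then show "nbrs E (cs ! i) \<inter> ?P = (!) cs ` {j \<in> {a..<a + l}. j = i + 1 \<or> i = j + 1}"
      unfolding image_nbrs[OF sub im] by (rule arg_cong)
    have "{j \<in> {a..<a + l}. j \<noteq> i \<and> j \<noteq> (i + 1) mod ?m \<and> i \<noteq> (j + 1) mod ?m} =
        {j \<in> {a..<a + l}. j \<noteq> i \<and> j \<noteq> i + 1 \<and> i \<noteq> j + 1}"
    proof (rule Collect_cong, rule conj_cong[OF refl], rule conj_cong[OF refl])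
      fix j assume "j \<in> {a..<a + l}"
      from adj'[OF this i] show "(j \<noteq> (i + 1) mod ?m \<and> i \<noteq> (j + 1) mod ?m) = (j \<noteq> i + 1 \<and> i \<noteq> j + 1)"
        by metis
    qed
    then show "?P - insert (cs ! i) (nbrs E (cs ! i)) = (!) cs ` {j \<in> {a..<a + l}. j \<noteq> i \<and> j \<noteq> i + 1 \<and> i \<noteq> j + 1}"
      unfolding image_diff_nbrs[OF sub im] by (rule arg_cong)
  qed
  consider "l = 0" | "l = 1" | "l \<ge> 2" by linarith
  then show ?case
  proof cases
    case 1
    then show ?thesis by (simp add: H_empty)
  next
    case 2
    have "{j \<in> {a..<a + l}. j = a + 1 \<or> a = j + 1} = {}" using 2 by auto
    then have "nbrs E (cs ! a) \<inter> ?P = {}" using nbrs(1)[of a] 2 by simp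
    then show ?thesis using H_isolated[of "cs ! a" ?P] 2 by simp
  next
    case 3
    have "{j \<in> {a..<a + l}. j = a + 1 \<or> a = j + 1} = {a + 1}" using 3 by auto
    then have leaf: "nbrs E (cs ! a) \<inter> ?P = {cs ! (a + 1)}" using nbrs(1)[of a] 3 by simp
    have in_P: "cs ! a \<in> ?P" using 3 by auto
    have diff: "?P - insert (cs ! (a + 1)) (nbrs E (cs ! (a + 1))) = (!) cs ` {a + 3..<a + l}"
    proof -
      have "{j \<in> {a..<a + l}. j \<noteq> a + 1 \<and> j \<noteq> a + 1 + 1 \<and> a + 1 \<noteq> j + 1} = {a + 3..<a + l}"
        by auto
      then show ?thesis using nbrs(2)[of "a + 1"] 3 by simp
    qed
    \<comment> \<open>With only two vertices the neighbor of the leaf has degree 1 instead of 2,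
      which changes the shift.\<close>
    show ?thesis
    proof (cases "l = 2")
      case True
      have "{j \<in> {a..<a + l}. j = a + 1 + 1 \<or> a + 1 = j + 1} = {a}" using True by auto
      then have "nbrs E (cs ! (a + 1)) \<inter> ?P = {cs ! a}" using nbrs(1)[of "a + 1"] 3 by simp
      then show ?thesis
        unfolding H_leaf[OF in_P leaf] diff using True by (auto simp: H_empty)
    next
      case False
      then have l3: "l \<ge> 3" using 3 by simp
      have "{j \<in> {a..<a + l}. j = a + 1 + 1 \<or> a + 1 = j + 1} = {a, a + 2}" using l3 by auto
      then have "nbrs E (cs ! (a + 1)) \<inter> ?P = (!) cs ` {a, a + 2}" using nbrs(1)[of "a + 1"] l3 by simp
      moreover have "card ((!) cs ` {a, a + 2}) = card {a, a + 2}"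
        by (rule card_image, rule inj_cs) (use l3 less.prems in auto)
      ultimately have d: "card (nbrs E (cs ! (a + 1)) \<inter> ?P) = 2" by simp
      have IH: "H i ((!) cs ` {a + 3..<a + 3 + (l - 3)}) =
        (if (l - 3) mod 3 = 0 then (if i = 2 * ((l - 3) div 3) then 1 else 0)
         else if (l - 3) mod 3 = 1 then 0 else (if i = 2 * ((l - 3) div 3) + 1 then 1 else 0))" for i
        by (rule less.IH) (use l3 less.prems in auto)
      obtain l' where l': "l = l' + 3" using l3 by (metis le_add_diff_inverse2)
      have e: "l mod 3 = l' mod 3" "l div 3 = l' div 3 + 1" "l - 3 = l'" "a + 3 + (l - 3) = a + l" "a + 3 + l' = a + l"
        using l' by auto
      show ?thesis
        unfolding H_leaf[OF in_P leaf] diff d IH[unfolded e(3,4,5)] e(1,2) by auto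
    qed
  qed
qed

lemma H_path_mod:
  assumes "1 \<le> a"
  shows "a + 3 * q \<le> girth E \<Longrightarrow> H i ((!) cs ` {a..<a + 3 * q}) = (if i = 2 * q then 1 else 0)"
    and "a + (3 * q + 1) \<le> girth E \<Longrightarrow> H i ((!) cs ` {a..<a + (3 * q + 1)}) = 0"
    and "a + (3 * q + 2) \<le> girth E \<Longrightarrow> H i ((!) cs ` {a..<a + (3 * q + 2)}) = (if i = 2 * q + 1 then 1 else 0)"
proof -
  have "3 * q mod 3 = 0" "(3 * q + 1) mod 3 = 1" "(3 * q + 2) mod 3 = 2"
    "3 * q div 3 = q" "(3 * q + 1) div 3 = q" "(3 * q + 2) div 3 = q"
    by presburger+
  note m = this
  show "a + 3 * q \<le> girth E \<Longrightarrow> H i ((!) cs ` {a..<a + 3 * q}) = (if i = 2 * q then 1 else 0)"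
    using H_path[OF assms, of "3 * q" i] unfolding m by simp
  show "a + (3 * q + 1) \<le> girth E \<Longrightarrow> H i ((!) cs ` {a..<a + (3 * q + 1)}) = 0"
    using H_path[OF assms, of "3 * q + 1" i] unfolding m by simp
  show "a + (3 * q + 2) \<le> girth E \<Longrightarrow> H i ((!) cs ` {a..<a + (3 * q + 2)}) = (if i = 2 * q + 1 then 1 else 0)"
    using H_path[OF assms, of "3 * q + 2" i] unfolding m by simp
qed

text \<open>Deleting a vertex with its two neighbors leaves a path of \<open>girth E - 3\<close>
  vertices, shifted by 2; deleting it alone leaves one of \<open>girth E - 1\<close> vertices,
  shifted by 1. If 3 divides the girth, both are nonzero and land in the same homological degree,
  which is where the 2 comes from. Otherwise exactly one of them is nonzero.\<close>

lemma H_cyc: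
  "H i cyc = (if girth E mod 3 = 0 then (if i = 2 * (girth E div 3) then 2 else 0)
    else if i = 2 * (girth E div 3) + 1 then 1 else 0)"
proof -
  let ?m = "girth E"
  have cyc: "cyc = (!) cs ` {..<?m}" using cs by (metis atLeast_upt image_set map_nth)
  have m0: "0 < ?m" using cs(3) by simp
  have mod: "0 = (j + 1) mod ?m \<longleftrightarrow> j = ?m - 1" if "j < ?m" for j
    using that by (cases "j + 1 = ?m") auto
  have 1: "(0 + 1) mod ?m = 1" using cs(3) by simp
  have "{j \<in> {..<?m}. j = (0 + 1) mod ?m \<or> 0 = (j + 1) mod ?m} = {j \<in> {..<?m}. j = 1 \<or> j = ?m - 1}"
    unfolding 1 by (rule Collect_cong, rule conj_cong[OF refl]) (simp only: lessThan_iff mod)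
  also have "\<dots> = {1, ?m - 1}" using cs(3) by auto
  finally have "{j \<in> {..<?m}. j = (0 + 1) mod ?m \<or> 0 = (j + 1) mod ?m} = {1, ?m - 1}" .
  then have N: "nbrs E (cs ! 0) \<inter> cyc = (!) cs ` {1, ?m - 1}"
    unfolding cyc image_nbrs[OF subset_refl m0] by simp
  have "card ((!) cs ` {1, ?m - 1}) = card {1, ?m - 1}"
    by (rule card_image, rule inj_cs) (use cs(3) in auto)
  then have d: "card (nbrs E (cs ! 0) \<inter> cyc) = 2" unfolding N using cs(3) by simp
  have "{j \<in> {..<?m}. j \<noteq> 0 \<and> j \<noteq> (0 + 1) mod ?m \<and> 0 \<noteq> (j + 1) mod ?m} =
      {j \<in> {..<?m}. j \<noteq> 0 \<and> j \<noteq> 1 \<and> j \<noteq> ?m - 1}"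
    unfolding 1 by (rule Collect_cong, rule conj_cong[OF refl]) (simp only: lessThan_iff mod)
  also have "\<dots> = {2..<2 + (?m - 3)}" using cs(3) by auto
  finally have "{j \<in> {..<?m}. j \<noteq> 0 \<and> j \<noteq> (0 + 1) mod ?m \<and> 0 \<noteq> (j + 1) mod ?m} = {2..<2 + (?m - 3)}" .
  then have diff: "cyc - insert (cs ! 0) (nbrs E (cs ! 0)) = (!) cs ` {2..<2 + (?m - 3)}"
    unfolding cyc image_diff_nbrs[OF subset_refl m0] by simp
  have del: "cyc - {cs ! 0} = (!) cs ` {1..<1 + (?m - 1)}"
  proof -
    have "cs ! j \<noteq> cs ! 0" if "j < ?m" "j \<noteq> 0" for j
      using that cs(1,2) m0 by (simp add: nth_eq_iff_index_eq)
    then have "cs ! 0 \<notin> (!) cs ` {1..<1 + (?m - 1)}" using m0 by fastforce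
    moreover have "{..<?m} = insert 0 {1..<1 + (?m - 1)}" using m0 by auto
    ultimately show ?thesis unfolding cyc by simp
  qed
  \<comment> \<open>Here \<open>k\<close> is \<open>?m div 3 - 1\<close>, so that both path lengths
    become sums in \<open>k\<close>.\<close>
  obtain k where k: "?m = 3 * k + 3 \<or> ?m = 3 * k + 4 \<or> ?m = 3 * k + 5"
  proof -
    have "?m = 3 * (?m div 3) + ?m mod 3" "?m div 3 \<ge> 1" "?m mod 3 < 3" using cs(3) by auto
    then have "?m = 3 * (?m div 3 - 1) + 3 \<or> ?m = 3 * (?m div 3 - 1) + 4 \<or> ?m = 3 * (?m div 3 - 1) + 5"
      by linarith
    then show thesis by (rule that)
  qed
  have in_cyc: "cs ! 0 \<in> cyc" using m0 unfolding cyc by blast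
  note H_del = H_delete[OF in_cyc, unfolded d diff del]
  from k consider "?m = 3 * k + 3" | "?m = 3 * k + 4" | "?m = 3 * k + 5" by blast
  then show ?thesis
  proof cases
    case 1
    then have e: "?m - 3 = 3 * k" "?m - 1 = 3 * k + 2" "?m mod 3 = 0" "?m div 3 = k + 1" by presburger+
    have H1: "H i ((!) cs ` {2..<2 + (?m - 3)}) = (if i = 2 * k then 1 else 0)" for i
      unfolding e(1) using 1 by (intro H_path_mod) auto
    have H2: "H i ((!) cs ` {1..<1 + (?m - 1)}) = (if i = 2 * k + 1 then 1 else 0)" for i
      unfolding e(2) using 1 by (intro H_path_mod) auto
    \<comment> \<open>The shorter path, after its shift, sits in degree \<open>2 * k + 2\<close>,
      the longer one before its shift in degree \<open>2 * k + 1\<close>. The condition of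
      \<open>H_delete\<close> holds and nothing cancels.\<close>
    have "H i cyc = (if i < 2 then 0 else if i - 2 = 2 * k then 1 else 0) +
        (if i = 0 then 0 else if i - 1 = 2 * k + 1 then 1 else 0)"
      by (rule H_del[unfolded H1 H2]) auto
    then show ?thesis unfolding e(3,4) by (auto split: if_splits)
  next
    case 2
    then have e: "?m - 3 = 3 * k + 1" "?m - 1 = 3 * (k + 1)" "?m mod 3 = 1" "?m div 3 = k + 1" by presburger+
    have H1: "H i ((!) cs ` {2..<2 + (?m - 3)}) = 0" for i
      unfolding e(1) using 2 by (intro H_path_mod) auto
    have H2: "H i ((!) cs ` {1..<1 + (?m - 1)}) = (if i = 2 * (k + 1) then 1 else 0)" for i
      unfolding e(2) using 2 by (intro H_path_mod) auto
    have "H i cyc = (if i < 2 then 0 else 0) + (if i = 0 then 0 else if i - 1 = 2 * (k + 1) then 1 else 0)"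
      by (rule H_del[unfolded H1 H2]) auto
    then show ?thesis unfolding e(3,4) by (auto split: if_splits)
  next
    case 3
    then have e: "?m - 3 = 3 * k + 2" "?m - 1 = 3 * (k + 1) + 1" "?m mod 3 = 2" "?m div 3 = k + 1" by presburger+
    have H1: "H i ((!) cs ` {2..<2 + (?m - 3)}) = (if i = 2 * k + 1 then 1 else 0)" for i
      unfolding e(1) using 3 by (intro H_path_mod) auto
    have H2: "H i ((!) cs ` {1..<1 + (?m - 1)}) = 0" for i
      unfolding e(2) using 3 by (intro H_path_mod) auto
    have "H i cyc = (if i < 2 then 0 else if i - 2 = 2 * k + 1 then 1 else 0) + (if i = 0 then 0 else 0)"
      by (rule H_del[unfolded H1 H2]) auto
    then show ?thesis unfolding e(3,4) by (auto split: if_splits)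
  qed
qed

end

text \<open>Stripping a leaf off the cycle either keeps the whole cycle, where induction applies, or
  leaves a forest, where the value is at most 1. The homological shift does not affect the
  bound.\<close>

lemma H_bound:
  assumes "cyc \<subseteq> W"
  shows "H i W \<le> (if girth E mod 3 = 0 then 2 else 1)"
  using assms
proof (induction "card W" arbitrary: W i rule: less_induct)
  case less
  show ?case
  proof (cases "W = cyc")
    case True
    obtain cs where "distinct cs" "length cs = girth E" "girth E \<ge> 3" "set cs = cyc"
      "\<And>i j. i < girth E \<Longrightarrow> j < girth E \<Longrightarrow>
        cs ! j \<in> nbrs E (cs ! i) \<longleftrightarrow> j = (i + 1) mod girth E \<or> i = (j + 1) mod girth E"
      by (rule ex_cyc_enum) blast
    from H_cyc[OF this] True show ?thesis by simp
  next
    case False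
    then obtain v where v: "v \<in> W - cyc" "card (nbrs E v \<inter> W) \<le> 1"
      using ex_leaf[OF less.prems] by blast
    have vW: "v \<in> W" using v by blast
    show ?thesis
    proof (rule card_le_1_cases[OF v(2)])
      assume "nbrs E v \<inter> W = {}"
      then show ?thesis using H_isolated[OF vW] by simp
    next
      fix u assume u: "nbrs E v \<inter> W = {u}"
      let ?W = "W - insert u (nbrs E u)"
      have "u \<in> W" using u by blast
      then have card: "card ?W < card W" by (intro psubset_card_mono) auto
      have "H j ?W \<le> (if girth E mod 3 = 0 then 2 else 1)" for j
        using less.hyps[OF card, of j] H_forest_le_1[of ?W j] by (cases "cyc \<subseteq> ?W") auto
      then show ?thesis unfolding H_leaf[OF vW u] by auto
    qed
  qed
qed

lemma H_le_1_near:
  assumes near: "\<And>v. dist_to_set E v cyc \<le> 2" and "W \<noteq> cyc"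
  shows "H i W \<le> 1"
proof (cases "cyc \<subseteq> W")
  case True
  then obtain v where v: "v \<in> W - cyc" "card (nbrs E v \<inter> W) \<le> 1"
    using ex_leaf[OF True assms(2)] by blast
  have vW: "v \<in> W" using v by blast
  show ?thesis
  proof (rule card_le_1_cases[OF v(2)])
    assume "nbrs E v \<inter> W = {}"
    then show ?thesis using H_isolated[OF vW] by simp
  next
    fix u assume u: "nbrs E v \<inter> W = {u}"
    have "\<not> cyc \<subseteq> W - insert u (nbrs E u)"
      using leaf_nbr_near_cyc[OF near True v(1) u] by blast
    then show ?thesis unfolding H_leaf[OF vW u] using H_forest_le_1 by auto
  qed
qed (rule H_forest_le_1)

lemma H_cycle:
  "H i cyc = (if girth E mod 3 = 0 then (if i = 2 * (girth E div 3) then 2 else 0)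
    else if i = 2 * (girth E div 3) + 1 then 1 else 0)"
  by (rule ex_cyc_enum) (rule H_cyc)

definition gens :: "nat \<Rightarrow> ('v \<Rightarrow> nat) \<Rightarrow> nat" where
  "gens i a = card {j. j < len i \<and> deg i j = a}"

lemma gens_cases:
  obtains "gens i a = 0" "\<And>W. a \<noteq> sqf W" | W where "a = sqf W" "int (gens i a) = H i W"
proof (cases "\<exists>u. a u \<ge> 2")
  case True
  then obtain u where u: "a u \<ge> 2" by blast
  then have "a \<noteq> sqf W" for W by (auto simp: sqf_def split: if_splits)
  then show thesis using that(1) not_squarefree[of a u, OF u] by (simp add: gens_def)
next
  case False
  have "a = sqf {v. a v \<noteq> 0}"
  proof
    fix u
    have "\<not> 2 \<le> a u" using False by blast
    then show "a u = sqf {v. a v \<noteq> 0} u" by (auto simp: sqf_def)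
  qed
  then show thesis using that(2)[of "{v. a v \<noteq> 0}"] H_eq_card[of i "{v. a v \<noteq> 0}"] by (simp add: gens_def)
qed

lemma gens_le: "gens i a \<le> (if 3 dvd girth E then 2 else 1)"
proof (rule gens_cases[of i a])
  fix W assume W: "int (gens i a) = H i W"
  show ?thesis
    using W H_bound[of W i] H_forest_le_1[of W i] by (cases "cyc \<subseteq> W") (auto simp: dvd_eq_mod_eq_0 split: if_splits)
qed simp

lemma gens_eq_2_iff:
  assumes "\<And>v. dist_to_set E v cyc \<le> 2" "girth E = 3 * k"
  shows "gens i a = 2 \<longleftrightarrow> i = 2 * k \<and> a = sqf cyc"
proof (rule gens_cases[of i a])
  fix W assume W: "a = sqf W" "int (gens i a) = H i W"
  show ?thesis
  proof (cases "W = cyc")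
    case True
    then show ?thesis using W H_cycle[of i] assms(2) by (auto split: if_splits)
  next
    case False
    then show ?thesis using W H_le_1_near[OF assms(1) False, of i] by (auto simp: sqf_inj)
  qed
qed auto

end

section \<open>Existence of minimal resolutions\<close>

definition below :: "nat \<Rightarrow> (nat \<Rightarrow> 'v set) \<Rightarrow> 'v set \<Rightarrow> nat set" where
  "below n w W = {j. j < n \<and> w j \<subseteq> W}"

lemma finite_below [simp]: "finite (below n w W)"
  by (simp add: below_def)

text \<open>\<open>K W\<close> is the squarefree degree \<open>W\<close> part of a submodule of a free module with generators
  \<open>j < n\<close> of squarefree degrees \<open>w j\<close>. The last condition is minimality.\<close>

definition syzygy_family :: "nat \<Rightarrow> (nat \<Rightarrow> 'v set) \<Rightarrow> ('v set \<Rightarrow> (nat \<Rightarrow> 'k::field) set) \<Rightarrow> bool" where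
  "syzygy_family n w K \<longleftrightarrow>
    (\<forall>W. fv.subspace (K W) \<and> K W \<subseteq> vsupp (below n w W)) \<and>
    (\<forall>W W'. W \<subseteq> W' \<longrightarrow> K W \<subseteq> K W') \<and>
    (\<forall>W. \<forall>x\<in>K W. \<forall>j<n. w j = W \<longrightarrow> x j = 0)"

lemma mapp_eq_sum:
  assumes "finite A" "\<And>j. j \<in> A \<Longrightarrow> (\<lambda>k. C k j) \<in> vsupp B"
  shows "mapp C B A x = (\<Sum>j\<in>A. fscale (x j) (\<lambda>k. C k j))"
proof
  fix k
  show "mapp C B A x k = (\<Sum>j\<in>A. fscale (x j) (\<lambda>k. C k j)) k"
  proof (cases "k \<in> B")
    case True
    then show ?thesis by (simp add: mapp_def sum_fun_apply mult.commute)
  next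
    case False
    then have "C k j = 0" if "j \<in> A" for j using assms(2)[OF that] by (auto simp: vsupp_def)
    then show ?thesis using False by (simp add: mapp_def sum_fun_apply)
  qed
qed

text \<open>\<open>G\<close> extends a basis of \<open>N\<close> to one of \<open>K\<close>; the
  last clause is independence modulo \<open>N\<close>. With \<open>N\<close> the part generated in
  smaller degrees, \<open>G\<close> is a minimal set of new generators.\<close>

lemma ex_minimal_generators:
  fixes K N :: "(nat \<Rightarrow> 'k::field) set"
  assumes "fv.subspace K" "K \<subseteq> vsupp A" "finite A" "fv.subspace N" "N \<subseteq> K"
  obtains G where "finite G" "G \<subseteq> K" "K \<subseteq> fv.span (N \<union> G)"
    "\<And>u g. (\<Sum>g\<in>G. fscale (u g) g) \<in> N \<Longrightarrow> g \<in> G \<Longrightarrow> u g = 0"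
proof -
  have span: "K \<subseteq> fv.span (uvec ` A)" using assms(2) vsupp_subset_span[OF assms(3)] by blast
  have fin: "finite (uvec ` A)" using assms(3) by simp
  obtain B0 where B0: "B0 \<subseteq> N" "fv.independent B0" "fv.span B0 = N"
    by (rule fv.finite_basis_extend[OF assms(4) subset_trans[OF assms(5) span] fin empty_subsetI fv.independent_empty])
  obtain B where B: "B0 \<subseteq> B" "B \<subseteq> K" "fv.independent B" "finite B" "fv.span B = K"
    by (rule fv.finite_basis_extend[OF assms(1) span fin subset_trans[OF B0(1) assms(5)] B0(2)])
  show thesis
  proof (rule that[of "B - B0"])
    show "finite (B - B0)" "B - B0 \<subseteq> K" using B by auto
    have "B \<subseteq> N \<union> (B - B0)" using B0 by auto
    then show "K \<subseteq> fv.span (N \<union> (B - B0))" unfolding B(5)[symmetric] by (rule fv.span_mono)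
  next
    fix u g assume s: "(\<Sum>g\<in>B - B0. fscale (u g) g) \<in> N" and g: "g \<in> B - B0"
    have "(\<Sum>g\<in>B - B0. fscale (u g) g) \<in> fv.span (B - B0)"
      by (intro fv.span_sum fv.span_scale fv.span_base)
    moreover have "(\<Sum>g\<in>B - B0. fscale (u g) g) \<in> fv.span B0" using s B0(3) by simp
    ultimately have "(\<Sum>g\<in>B - B0. fscale (u g) g) = 0"
      by (intro fv.independent_span_Int[OF B(3,4,1)])
    moreover have "fv.independent (B - B0)" using B(3) by (rule fv.independent_mono) blast
    ultimately show "u g = 0"
      using fv.independentD[OF _ _ subset_refl, of "B - B0" u g] B(4) g by blast
  qed
qed

text \<open>In each degree \<open>W\<close> the part \<open>N W\<close> coming from smaller degrees
  is completed by new generators \<open>G W\<close>, and all of these together index the next free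
  module. Minimality of the given family makes the inclusions of degrees strict; independence of
  \<open>G W\<close> modulo \<open>N W\<close> makes the family of kernels minimal again, so the
  step can be iterated.\<close>

lemma syzygy_step:
  fixes K :: "'v::finite set \<Rightarrow> (nat \<Rightarrow> 'k::field) set"
  assumes "syzygy_family n w K"
  obtains n' w' C where
    "\<And>k j. k < n \<Longrightarrow> j < n' \<Longrightarrow> C k j \<noteq> 0 \<Longrightarrow> w k \<subset> w' j"
    "\<And>W. mapp C (below n w W) (below n' w' W) ` vsupp (below n' w' W) = K W"
    "syzygy_family n' w' (\<lambda>W. mker C (below n w W) (below n' w' W))"
proof -
  have K: "fv.subspace (K W)" "K W \<subseteq> vsupp (below n w W)" for W
    using assms by (auto simp: syzygy_family_def)
  have K_mono: "K W \<subseteq> K W'" if "W \<subseteq> W'" for W W'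
    using assms that by (auto simp: syzygy_family_def)
  have K_min: "x j = 0" if "x \<in> K W" "j < n" "w j = W" for x W j
    using assms that by (auto simp: syzygy_family_def)
  \<comment> \<open>Sets with one vertex removed are the largest proper subsets, so by monotonicity
    this span contains \<open>K U\<close> for every proper subset \<open>U\<close>.\<close>
  define N where "N W = fv.span (\<Union>v\<in>W. K (W - {v}))" for W
  have N: "fv.subspace (N W)" "N W \<subseteq> K W" for W
  proof -
    show "fv.subspace (N W)" by (simp add: N_def)
    show "N W \<subseteq> K W" unfolding N_def
      by (rule fv.span_minimal[OF UN_least K(1)], rule K_mono) blast
  qed
  have K_N: "K U \<subseteq> N W" if UW: "U \<subset> W" for U W
  proof -
    obtain v where "v \<in> W" "U \<subseteq> W - {v}" using UW by blast
    then have "K U \<subseteq> (\<Union>v\<in>W. K (W - {v}))" using K_mono by blast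
    then show ?thesis unfolding N_def using fv.span_superset by blast
  qed
  have ex: "\<exists>G. finite G \<and> G \<subseteq> K W \<and> K W \<subseteq> fv.span (N W \<union> G) \<and>
      (\<forall>u g. (\<Sum>g\<in>G. fscale (u g) g) \<in> N W \<longrightarrow> g \<in> G \<longrightarrow> u g = 0)" for W
    by (rule ex_minimal_generators[OF K(1,2) finite_below N]) blast
  from choice[OF allI[OF ex]] obtain G where G_all:
    "\<forall>W. finite (G W) \<and> G W \<subseteq> K W \<and> K W \<subseteq> fv.span (N W \<union> G W) \<and>
      (\<forall>u g. (\<Sum>g\<in>G W. fscale (u g) g) \<in> N W \<longrightarrow> g \<in> G W \<longrightarrow> u g = 0)" ..
  then have G: "finite (G W)" "G W \<subseteq> K W" "K W \<subseteq> fv.span (N W \<union> G W)" for W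
    by blast+
  have G_ind: "u g = 0" if "(\<Sum>g\<in>G W. fscale (u g) g) \<in> N W" "g \<in> G W" for W u g
    using G_all that by blast
  \<comment> \<open>Pairing each vector with its degree keeps equal vectors chosen in different
    degrees apart.\<close>
  define n' where "n' = card (Sigma UNIV G)"
  have "finite (Sigma UNIV G)" using G(1) by (intro finite_SigmaI) auto
  then obtain e where e: "bij_betw e {0..<n'} (Sigma UNIV G)"
    unfolding n'_def using ex_bij_betw_nat_finite by blast
  define w' where "w' j = fst (e j)" for j
  define col where "col j = snd (e j)" for j
  define C where "C k j = col j k" for k j
  have col: "col j \<in> G (w' j)" if "j < n'" for j
    using bij_betwE[OF e] that by (force simp: col_def w'_def)
  have colK: "col j \<in> K (w' j)" if "j < n'" for j using col[OF that] G(2) by blast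
  have col_below: "col j \<in> K W" if "j \<in> below n' w' W" for j W
    using colK K_mono that by (auto simp: below_def)
  have C_col: "(\<lambda>k. C k j) = col j" for j by (simp add: C_def)
  have app: "mapp C (below n w W) (below n' w' W) x = (\<Sum>j\<in>below n' w' W. fscale (x j) (col j))" for W x
  proof (rule mapp_eq_sum[where C = C, unfolded C_col])
    fix j assume "j \<in> below n' w' W"
    from col_below[OF this] K(2) show "col j \<in> vsupp (below n w W)" by blast
  qed simp
  have "w k \<subset> w' j" if kj: "k < n" "j < n'" "C k j \<noteq> 0" for k j
  proof -
    have "k \<in> below n w (w' j)" using kj colK[OF kj(2)] K(2) by (auto simp: vsupp_def C_def)
    moreover have "w k \<noteq> w' j" using K_min[OF colK[OF kj(2)] kj(1)] kj(3) by (auto simp: C_def)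
    ultimately show ?thesis by (auto simp: below_def)
  qed
  moreover have "mapp C (below n w W) (below n' w' W) ` vsupp (below n' w' W) = K W" for W
  proof
    let ?I = "\<lambda>W. mapp C (below n w W) (below n' w' W) ` vsupp (below n' w' W)"
    show "?I W \<subseteq> K W"
      unfolding app using col_below K(1) by (auto intro!: fv.subspace_sum fv.subspace_scale)
    have colI: "col j \<in> ?I W" if j: "j \<in> below n' w' W" for j W
    proof -
      have "(\<Sum>i\<in>below n' w' W. fscale (uvec j i) (col i)) = (\<Sum>i\<in>below n' w' W. if i = j then col i else 0)"
        by (rule sum.cong) (auto simp: uvec_def fun_eq_iff)
      then have "col j = mapp C (below n w W) (below n' w' W) (uvec j)" using j by (simp add: app)
      moreover have "uvec j \<in> (vsupp (below n' w' W) :: (nat \<Rightarrow> 'k) set)"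
        using j by (auto simp: vsupp_def uvec_def)
      ultimately show ?thesis by (rule image_eqI)
    qed
    have GI: "G U \<subseteq> ?I W" if "U \<subseteq> W" for U W
    proof
      fix g assume "g \<in> G U"
      then have "(U, g) \<in> e ` {0..<n'}" using e by (auto simp: bij_betw_def)
      then obtain j where "j < n'" "e j = (U, g)" by (metis atLeastLessThan_iff imageE)
      then show "g \<in> ?I W" using colI[of j W] that by (simp add: below_def w'_def col_def)
    qed
    have "K U \<subseteq> ?I W" if "U \<subseteq> W" for U
      using that
    proof (induction "card U" arbitrary: U rule: less_induct)
      case less
      have sub: "fv.subspace (?I W)" by (simp add: subspace_mapp_image subspace_vsupp)
      have "K (U - {v}) \<subseteq> ?I W" if "v \<in> U" for v
        by (rule less.hyps) (use that less.prems in \<open>auto intro!: card_Diff1_less simp del: card_Diff_insert card_Diff_singleton\<close>)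
      then have "N U \<subseteq> ?I W" unfolding N_def by (intro fv.span_minimal sub) blast
      then have "fv.span (N U \<union> G U) \<subseteq> ?I W"
        using GI[OF less.prems] by (intro fv.span_minimal sub) blast
      then show ?case using G(3) by blast
    qed
    then show "K W \<subseteq> ?I W" by blast
  qed
  moreover have "syzygy_family n' w' (\<lambda>W. mker C (below n w W) (below n' w' W))"
    unfolding syzygy_family_def
  proof (intro conjI allI impI ballI)
    fix W show "fv.subspace (mker C (below n w W) (below n' w' W))" by (rule subspace_mker)
    show "mker C (below n w W) (below n' w' W) \<subseteq> vsupp (below n' w' W)" by (auto simp: mker_def)
  next
    fix W W' :: "'v set" assume W: "W \<subseteq> W'"
    show "mker C (below n w W) (below n' w' W) \<subseteq> mker C (below n w W') (below n' w' W')"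
    proof
      fix x assume "x \<in> mker C (below n w W) (below n' w' W)"
      then have x: "x \<in> vsupp (below n' w' W)" "(\<Sum>j\<in>below n' w' W. fscale (x j) (col j)) = 0"
        by (auto simp: mker_def app)
      have "(\<Sum>j\<in>below n' w' W. fscale (x j) (col j)) = (\<Sum>j\<in>below n' w' W'. fscale (x j) (col j))"
        by (rule sum.mono_neutral_left) (use x(1) W in \<open>auto simp: vsupp_def below_def fun_eq_iff\<close>)
      then have "(\<Sum>j\<in>below n' w' W'. fscale (x j) (col j)) = 0" using x(2) by simp
      moreover have "x \<in> vsupp (below n' w' W')"
        using x(1) vsupp_mono[of "below n' w' W" "below n' w' W'"] W by (auto simp: below_def)
      ultimately show "x \<in> mker C (below n w W') (below n' w' W')"
        by (simp add: mker_def app)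
    qed
  next
    fix W x j assume x: "x \<in> mker C (below n w W) (below n' w' W)" and j: "j < n'" "w' j = W"
    have 0: "(\<Sum>j\<in>below n' w' W. fscale (x j) (col j)) = 0" using x by (simp add: mker_def app)
    \<comment> \<open>The generators of degree exactly \<open>W\<close> are separated from the rest
      of the relation. The rest lies in \<open>N W\<close>, so independence modulo
      \<open>N W\<close> kills their coefficients.\<close>
    let ?A = "{j. j < n' \<and> w' j = W}"
    have A: "?A \<subseteq> below n' w' W" by (auto simp: below_def)
    have "(\<Sum>j\<in>below n' w' W - ?A. fscale (x j) (col j)) + (\<Sum>j\<in>?A. fscale (x j) (col j)) = 0"
      using 0 sum.subset_diff[OF A finite_below, of "\<lambda>j. fscale (x j) (col j)"] by simp
    then have "(\<Sum>j\<in>?A. fscale (x j) (col j)) = - (\<Sum>j\<in>below n' w' W - ?A. fscale (x j) (col j))"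
      by (simp add: eq_neg_iff_add_eq_0 add.commute)
    moreover have "(\<Sum>j\<in>below n' w' W - ?A. fscale (x j) (col j)) \<in> N W"
    proof (intro fv.subspace_sum fv.subspace_scale N(1))
      fix j assume "j \<in> below n' w' W - ?A"
      then have "j < n'" "w' j \<subset> W" by (auto simp: below_def)
      then show "col j \<in> N W" using colK K_N by blast
    qed
    ultimately have inN: "(\<Sum>j\<in>?A. fscale (x j) (col j)) \<in> N W"
      using fv.subspace_neg[OF N(1)] by simp
    have e_A: "e i = (W, col i)" if "i \<in> ?A" for i
      using that by (auto simp: w'_def col_def prod_eq_iff)
    have inj: "inj_on col ?A"
    proof (rule inj_onI)
      fix i i' assume i: "i \<in> ?A" "i' \<in> ?A" "col i = col i'"
      then have "e i = e i'" using e_A by simp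
      then show "i = i'" using e i by (auto simp: bij_betw_def inj_on_def)
    qed
    have img: "col ` ?A = G W"
    proof
      show "col ` ?A \<subseteq> G W" using col by auto
      show "G W \<subseteq> col ` ?A"
      proof
        fix g assume "g \<in> G W"
        then have "(W, g) \<in> e ` {0..<n'}" using e by (auto simp: bij_betw_def)
        then obtain i where i: "i < n'" "e i = (W, g)" by (metis atLeastLessThan_iff imageE)
        then have "i \<in> ?A" "col i = g" by (auto simp: w'_def col_def)
        then show "g \<in> col ` ?A" by blast
      qed
    qed
    define u where "u g = x (the_inv_into ?A col g)" for g
    have u: "u (col i) = x i" if "i \<in> ?A" for i
      using the_inv_into_f_f[OF inj that] by (simp add: u_def)
    have "(\<Sum>g\<in>G W. fscale (u g) g) = (\<Sum>j\<in>?A. fscale (x j) (col j))"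
      unfolding img[symmetric] sum.reindex[OF inj] by (rule sum.cong) (auto simp: u)
    then have "u (col j) = 0" using G_ind[of u W "col j"] inN img j by auto
    then show "x j = 0" using u[of j] j by simp
  qed
  ultimately show thesis by (rule that)
qed

definition edge_monomial :: "'v set set \<Rightarrow> ('v \<Rightarrow> nat) \<Rightarrow> bool" where
  "edge_monomial E c \<longleftrightarrow> (\<exists>x y. {x, y} \<in> E \<and> 0 < c x \<and> 0 < c y)"

lemma edge_monomial_support: "edge_monomial E c \<longleftrightarrow> (\<exists>x y. {x, y} \<in> E \<and> {x, y} \<subseteq> {v. 0 < c v})"
  by (simp add: edge_monomial_def)

text \<open>Dependent choice iterates \<open>syzygy_step\<close>, starting from the ideal inside the
  free module of rank one: a line in degree \<open>W\<close> if \<open>W\<close> contains an edge,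
  else 0. Squarefree generators serve all degrees \<open>c\<close>, since which of them lie below
  \<open>c\<close> depends only on the support of \<open>c\<close>.\<close>

lemma ex_graded_resolution:
  fixes E :: "'v::finite set set"
  obtains len deg and C :: "nat \<Rightarrow> nat \<Rightarrow> nat \<Rightarrow> 'k::field"
  where "graded_resolution (edge_monomial E) len deg C" "len 0 = 1" "\<And>j. deg 0 j = (\<lambda>_. 0)" "\<And>k j. C 0 k j = 1"
proof -
  define P :: "nat \<Rightarrow> nat \<times> (nat \<Rightarrow> 'v set) \<times> ('v set \<Rightarrow> (nat \<Rightarrow> 'k) set) \<Rightarrow> bool"
    where "P i s \<longleftrightarrow> (case s of (n, w, K) \<Rightarrow> syzygy_family n w K \<and> (i = 0 \<longrightarrow> n = 1 \<and> w = (\<lambda>_. {}) \<and>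
      K = (\<lambda>W. if \<exists>x y. {x, y} \<in> E \<and> {x, y} \<subseteq> W then vsupp {0} else {0})))" for i s
  define Q :: "nat \<times> (nat \<Rightarrow> 'v set) \<times> ('v set \<Rightarrow> (nat \<Rightarrow> 'k) set) \<Rightarrow>
      nat \<times> (nat \<Rightarrow> 'v set) \<times> ('v set \<Rightarrow> (nat \<Rightarrow> 'k) set) \<Rightarrow> (nat \<Rightarrow> nat \<Rightarrow> 'k) \<Rightarrow> bool"
    where "Q s s' C \<longleftrightarrow> (case (s, s') of ((n, w, K), (n', w', K')) \<Rightarrow>
      (\<forall>k<n. \<forall>j<n'. C k j \<noteq> 0 \<longrightarrow> w k \<subset> w' j) \<and>
      (\<forall>W. mapp C (below n w W) (below n' w' W) ` vsupp (below n' w' W) = K W) \<and>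
      K' = (\<lambda>W. mker C (below n w W) (below n' w' W)))" for s s' C
  have "\<exists>s. \<forall>i. P i (s i) \<and> (\<exists>C. Q (s i) (s (Suc i)) C)"
  proof (rule dependent_nat_choice)
    have "fv.subspace (vsupp {0} :: (nat \<Rightarrow> 'k) set)" by (rule subspace_vsupp)
    then have "syzygy_family 1 (\<lambda>_. {})
        (\<lambda>W. if \<exists>x y. {x, y} \<in> E \<and> {x, y} \<subseteq> W then vsupp {0} else {0 :: nat \<Rightarrow> 'k})"
      unfolding syzygy_family_def
      by (auto simp: fv.subspace_single_0 below_def vsupp_def)
    then have "P 0 (1, \<lambda>_. {}, \<lambda>W. if \<exists>x y. {x, y} \<in> E \<and> {x, y} \<subseteq> W then vsupp {0} else {0})"
      by (simp add: P_def)
    then show "\<exists>s. P 0 s" by blast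
  next
    fix s i assume "P i s"
    obtain n w K where s: "s = (n, w, K)" by (cases s) auto
    then have "syzygy_family n w K" using \<open>P i s\<close> by (simp add: P_def)
    then obtain n' w' C where
      "\<And>k j. k < n \<Longrightarrow> j < n' \<Longrightarrow> C k j \<noteq> 0 \<Longrightarrow> w k \<subset> w' j"
      "\<And>W. mapp C (below n w W) (below n' w' W) ` vsupp (below n' w' W) = K W"
      "syzygy_family n' w' (\<lambda>W. mker C (below n w W) (below n' w' W))"
      by (rule syzygy_step) blast
    then have "P (Suc i) (n', w', \<lambda>W. mker C (below n w W) (below n' w' W)) \<and>
        Q s (n', w', \<lambda>W. mker C (below n w W) (below n' w' W)) C"
      by (simp add: P_def Q_def s)
    then show "\<exists>s'. P (Suc i) s' \<and> (\<exists>C. Q s s' C)" by blast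
  qed
  then obtain s where s: "\<And>i. P i (s i)" "\<And>i. \<exists>C. Q (s i) (s (Suc i)) C" by blast
  then obtain C' where C': "\<And>i. Q (s i) (s (Suc i)) (C' i)" by metis
  define n where "n i = fst (s i)" for i
  define w where "w i = fst (snd (s i))" for i
  define K where "K i = snd (snd (s i))" for i
  have s_eq: "s i = (n i, w i, K i)" for i by (simp add: n_def w_def K_def)
  define C where "C i = (case i of 0 \<Rightarrow> (\<lambda>_ _. 1) | Suc i \<Rightarrow> C' i)" for i
  have start: "n 0 = 1" "w 0 = (\<lambda>_. {})"
    "K 0 = (\<lambda>W. if \<exists>x y. {x, y} \<in> E \<and> {x, y} \<subseteq> W then vsupp {0} else {0})"
    using s(1)[of 0] unfolding s_eq P_def by auto
  have C: "w i k \<subset> w (Suc i) j" if "k < n i" "j < n (Suc i)" "C (Suc i) k j \<noteq> 0" for i k j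
    using C'[of i] that unfolding s_eq Q_def C_def by auto
  have image: "mapp (C (Suc i)) (below (n i) (w i) W) (below (n (Suc i)) (w (Suc i)) W) `
      vsupp (below (n (Suc i)) (w (Suc i)) W) = K i W" for i W
    using C'[of i] unfolding s_eq Q_def C_def by auto
  have ker: "K (Suc i) W = mker (C (Suc i)) (below (n i) (w i) W) (below (n (Suc i)) (w (Suc i)) W)" for i W
    using C'[of i] unfolding s_eq Q_def C_def by auto
  define deg where "deg i j = sqf (w i j)" for i j
  have below: "{j. j < n i \<and> deg i j \<le> c} = below (n i) (w i) {v. 0 < c v}" for i c
    by (simp add: below_def deg_def sqf_le_iff)
  have below_0: "below (n 0) (w 0) W = {0}" for W by (auto simp: below_def start)
  have "graded_resolution (edge_monomial E) n deg C"
  proof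
    fix k i j assume "k < n i" "j < n (Suc i)" "C (Suc i) k j \<noteq> 0"
    then have "w i k \<subset> w (Suc i) j" by (rule C)
    then show "deg i k \<le> deg (Suc i) j" by (auto simp: deg_def sqf_def le_fun_def)
  next
    fix k i j assume kj: "k < n i" "j < n (Suc i)" "deg i k = deg (Suc i) j"
    then show "C (Suc i) k j = 0" using C[OF kj(1,2)] by (auto simp: deg_def sqf_inj)
  next
    fix c assume "\<not> edge_monomial E c"
    show "\<exists>x\<in>vsupp {j. j < n 0 \<and> deg 0 j \<le> c}. (\<Sum>j | j < n 0 \<and> deg 0 j \<le> c. C 0 0 j * x j) \<noteq> 0"
      unfolding below below_0
      by (rule bexI[of _ "uvec 0"]) (auto simp: C_def uvec_def vsupp_def)
  next
    fix c
    have "x = 0" if "x \<in> vsupp {0}" "x 0 = 0" for x :: "nat \<Rightarrow> 'k"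
    proof
      fix j show "x j = 0 j" using that by (cases "j = 0") (auto simp: vsupp_def)
    qed
    then have 0: "{x \<in> vsupp {0}. x 0 = (0::'k)} = {0}" by (auto simp: vsupp_def)
    have "K 0 {v. 0 < c v} = (if edge_monomial E c then vsupp {0} else {0})"
      unfolding start edge_monomial_support ..
    then have "{x \<in> vsupp {0}. edge_monomial E c \<or> (\<Sum>j\<in>{0}. C 0 0 j * x j) = 0} = K 0 {v. 0 < c v}"
      using 0 by (simp add: C_def)
    then show "{x \<in> vsupp {j. j < n 0 \<and> deg 0 j \<le> c}. edge_monomial E c \<or>
        (\<Sum>j | j < n 0 \<and> deg 0 j \<le> c. C 0 0 j * x j) = 0} =
      mapp (C (Suc 0)) {j. j < n 0 \<and> deg 0 j \<le> c} {j. j < n (Suc 0) \<and> deg (Suc 0) j \<le> c} `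
        vsupp {j. j < n (Suc 0) \<and> deg (Suc 0) j \<le> c}"
      unfolding below image by (simp only: below_0)
  next
    fix i c
    show "mker (C (Suc i)) {j. j < n i \<and> deg i j \<le> c} {j. j < n (Suc i) \<and> deg (Suc i) j \<le> c} =
      mapp (C (Suc (Suc i))) {j. j < n (Suc i) \<and> deg (Suc i) j \<le> c}
          {j. j < n (Suc (Suc i)) \<and> deg (Suc (Suc i)) j \<le> c} `
        vsupp {j. j < n (Suc (Suc i)) \<and> deg (Suc (Suc i)) j \<le> c}"
      unfolding below image ker ..
  qed
  then show thesis
    by (rule that) (auto simp: start deg_def sqf_def C_def)
qed

section \<open>Polynomial matrices and their scalars\<close>

lemma sum_single_keys: "(\<Sum>t\<in>Poly_Mapping.keys p. Poly_Mapping.single t (Poly_Mapping.lookup p t)) = p"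
proof (rule poly_mapping_eqI)
  fix s
  have "(\<Sum>t\<in>Poly_Mapping.keys p. Poly_Mapping.lookup (Poly_Mapping.single t (Poly_Mapping.lookup p t)) s) =
      (\<Sum>t\<in>Poly_Mapping.keys p. if t = s then Poly_Mapping.lookup p t else 0)"
    by (rule sum.cong) (auto simp: lookup_single when_def)
  also have "\<dots> = Poly_Mapping.lookup p s" by (simp add: in_keys_iff)
  finally show "Poly_Mapping.lookup (\<Sum>t\<in>Poly_Mapping.keys p. Poly_Mapping.single t (Poly_Mapping.lookup p t)) s = Poly_Mapping.lookup p s"
    by (simp add: lookup_sum)
qed

abbreviation dle :: "'v mdeg \<Rightarrow> 'v mdeg \<Rightarrow> bool" where
  "dle s t \<equiv> Poly_Mapping.lookup s \<le> Poly_Mapping.lookup t"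

lemma dle_diff_add: "dle s t \<Longrightarrow> t - s + s = t"
  by (rule poly_mapping_eqI) (simp add: lookup_add lookup_minus le_fun_def)

lemma dle_add: "dle s (t + s)"
  by (simp add: le_fun_def lookup_add)

lemma lookup_single_mult:
  fixes q :: "('v, 'k::field) mpoly"
  shows "Poly_Mapping.lookup (Poly_Mapping.single t c * q) r = (if dle t r then c * Poly_Mapping.lookup q (r - t) else 0)"
proof -
  have "Poly_Mapping.single t c * q =
      (\<Sum>s\<in>Poly_Mapping.keys q. Poly_Mapping.single (t + s) (c * Poly_Mapping.lookup q s))"
    by (subst sum_single_keys[symmetric]) (simp add: sum_distrib_left mult_single)
  then have eq: "Poly_Mapping.lookup (Poly_Mapping.single t c * q) r =
      (\<Sum>s\<in>Poly_Mapping.keys q. if t + s = r then c * Poly_Mapping.lookup q s else 0)"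
    by (simp add: lookup_sum lookup_single when_def)
  show ?thesis
  proof (cases "dle t r")
    case True
    then have "t + s = r \<longleftrightarrow> s = r - t" for s
      using dle_diff_add[OF True] by (metis add.commute add_diff_cancel_left')
    then show ?thesis using True by (simp add: eq in_keys_iff)
  next
    case False
    then have "t + s \<noteq> r" for s using dle_add[of t s] by (metis add.commute)
    then show ?thesis using False by (simp add: eq)
  qed
qed

text \<open>The coefficients of the degree \<open>a\<close> part of an element of the graded free module of \<open>S\<close>.\<close>

definition coef :: "'v mdeg list \<Rightarrow> 'v mdeg \<Rightarrow> ('v, 'k::field) mpoly vec \<Rightarrow> nat \<Rightarrow> 'k" where
  "coef S a v = (\<lambda>j. if j < length S \<and> dle (S ! j) a then Poly_Mapping.lookup (v $ j) (a - S ! j) else 0)"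

text \<open>The coefficient of the only monomial that can occur at position \<open>(k, j)\<close> of
  a multigraded map.\<close>

definition mcoef :: "'v mdeg list \<Rightarrow> 'v mdeg list \<Rightarrow> ('v, 'k::field) mpoly mat \<Rightarrow> nat \<Rightarrow> nat \<Rightarrow> 'k" where
  "mcoef S T A k j = (if dle (T ! k) (S ! j) then Poly_Mapping.lookup (A $$ (k, j)) (S ! j - T ! k) else 0)"

text \<open>For \<open>x\<close> supported on \<open>gens_below S a\<close>, the homogeneous element
  of degree \<open>a\<close> with these coefficients; it brings statements on polynomial vectors
  down to one degree.\<close>

definition hvec :: "'v mdeg list \<Rightarrow> 'v mdeg \<Rightarrow> (nat \<Rightarrow> 'k) \<Rightarrow> ('v, 'k::field) mpoly vec" where
  "hvec S a x = vec (length S) (\<lambda>j. Poly_Mapping.single (a - S ! j) (x j))"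

definition gens_below :: "'v mdeg list \<Rightarrow> 'v mdeg \<Rightarrow> nat set" where
  "gens_below S a = {j. j < length S \<and> dle (S ! j) a}"

lemma finite_gens_below [simp]: "finite (gens_below S a)"
  by (simp add: gens_below_def)

lemma coef_vsupp: "coef S a v \<in> vsupp (gens_below S a)"
  by (auto simp: coef_def vsupp_def gens_below_def)

lemma coef_eqI:
  assumes "v \<in> carrier_vec (length S)" "w \<in> carrier_vec (length S)" "\<And>a. coef S a v = coef S a w"
  shows "v = w"
proof (rule eq_vecI)
  fix j assume j: "j < dim_vec w"
  then have j: "j < length S" using assms(2) by simp
  show "v $ j = w $ j"
  proof (rule poly_mapping_eqI)
    fix t
    have "coef S (t + S ! j) v j = coef S (t + S ! j) w j" using assms(3) by simp
    then show "Poly_Mapping.lookup (v $ j) t = Poly_Mapping.lookup (w $ j) t" using j by (simp add: coef_def dle_add)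
  qed
qed (use assms in simp)

lemma coef_zero: "coef S a (0\<^sub>v (length S)) = 0"
  by (auto simp: coef_def fun_eq_iff)

lemma hvec_carrier: "hvec S a x \<in> carrier_vec (length S)"
  by (simp add: hvec_def)

lemma coef_hvec:
  assumes "x \<in> vsupp (gens_below S a)"
  shows "coef S b (hvec S a x) = (if a = b then x else 0)"
proof
  fix j
  show "coef S b (hvec S a x) j = (if a = b then x else 0) j"
  proof (cases "j \<in> gens_below S a")
    case True
    then have j: "j < length S" "dle (S ! j) a" by (auto simp: gens_below_def)
    have "a - S ! j = b - S ! j \<longleftrightarrow> a = b" if "dle (S ! j) b"
      using dle_diff_add[OF j(2)] dle_diff_add[OF that] by metis
    then show ?thesis using j by (auto simp: coef_def hvec_def lookup_single when_def)
  next
    case False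
    then have "x j = 0" using assms by (auto simp: vsupp_def)
    then show ?thesis by (auto simp: coef_def hvec_def)
  qed
qed

text \<open>An entry of a multigraded map is a scalar times the monomial of the degree difference,
  so between the parts of degree \<open>a\<close> it acts as that scalar.\<close>

lemma lookup_entry_mult:
  fixes q :: "('v, 'k::field) mpoly"
  assumes "multigraded_map S T A" "k < length T" "j < length S" "dle (T ! k) a"
  shows "Poly_Mapping.lookup (A $$ (k, j) * q) (a - T ! k) =
    (if dle (S ! j) a then mcoef S T A k j * Poly_Mapping.lookup q (a - S ! j) else 0)"
proof -
  have keys: "t + T ! k = S ! j" if "t \<in> Poly_Mapping.keys (A $$ (k, j))" for t
    using assms that by (auto simp: multigraded_map_def)
  show ?thesis
  proof (cases "dle (T ! k) (S ! j)")
    case True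
    let ?d = "S ! j - T ! k"
    have "t = ?d" if "t \<in> Poly_Mapping.keys (A $$ (k, j))" for t
      using keys[OF that] by (metis add_diff_cancel_right')
    then have A: "A $$ (k, j) = Poly_Mapping.single ?d (Poly_Mapping.lookup (A $$ (k, j)) ?d)"
      by (intro poly_mapping_eqI) (auto simp: lookup_single when_def in_keys_iff)
    have "dle ?d (a - T ! k) \<longleftrightarrow> dle (S ! j) a"
    proof -
      have "Poly_Mapping.lookup (S ! j) v - Poly_Mapping.lookup (T ! k) v \<le> Poly_Mapping.lookup a v - Poly_Mapping.lookup (T ! k) v \<longleftrightarrow> Poly_Mapping.lookup (S ! j) v \<le> Poly_Mapping.lookup a v" for v
        using True assms(4) by (auto simp: le_fun_def intro!: le_diff_iff)
      then show ?thesis by (simp add: le_fun_def lookup_minus)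
    qed
    moreover have "a - T ! k - ?d = a - S ! j"
    proof (rule poly_mapping_eqI)
      fix v
      have "Poly_Mapping.lookup (T ! k) v \<le> Poly_Mapping.lookup (S ! j) v" using True by (simp add: le_fun_def)
      then show "Poly_Mapping.lookup (a - T ! k - ?d) v = Poly_Mapping.lookup (a - S ! j) v" by (simp add: lookup_minus)
    qed
    ultimately show ?thesis
      by (subst A) (simp add: lookup_single_mult mcoef_def True)
  next
    case False
    then have "Poly_Mapping.keys (A $$ (k, j)) = {}" using keys dle_add by (metis all_not_in_conv)
    then show ?thesis using False by (simp add: mcoef_def)
  qed
qed

lemma coef_mult:
  assumes "multigraded_map S T A" "v \<in> carrier_vec (length S)"
  shows "coef T a (A *\<^sub>v v) = mapp (mcoef S T A) (gens_below T a) (gens_below S a) (coef S a v)"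
proof
  fix k
  have A: "A \<in> carrier_mat (length T) (length S)" using assms(1) by (simp add: multigraded_map_def)
  show "coef T a (A *\<^sub>v v) k = mapp (mcoef S T A) (gens_below T a) (gens_below S a) (coef S a v) k"
  proof (cases "k \<in> gens_below T a")
    case True
    then have k: "k < length T" "dle (T ! k) a" by (auto simp: gens_below_def)
    have "(A *\<^sub>v v) $ k = (\<Sum>j<length S. A $$ (k, j) * v $ j)"
      using A assms(2) k by (simp add: scalar_prod_def lessThan_atLeast0)
    then have "coef T a (A *\<^sub>v v) k = (\<Sum>j<length S. Poly_Mapping.lookup (A $$ (k, j) * v $ j) (a - T ! k))"
      using k by (simp add: coef_def lookup_sum)
    also have "\<dots> = (\<Sum>j<length S. if dle (S ! j) a then mcoef S T A k j * Poly_Mapping.lookup (v $ j) (a - S ! j) else 0)"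
      by (rule sum.cong) (use lookup_entry_mult[OF assms(1) k(1) _ k(2)] in auto)
    also have "\<dots> = (\<Sum>j\<in>gens_below S a. if dle (S ! j) a then mcoef S T A k j * Poly_Mapping.lookup (v $ j) (a - S ! j) else 0)"
      by (rule sum.mono_neutral_right) (auto simp: gens_below_def)
    also have "\<dots> = (\<Sum>j\<in>gens_below S a. mcoef S T A k j * coef S a v j)"
      by (rule sum.cong) (auto simp: gens_below_def coef_def)
    finally show ?thesis using True by (simp add: mapp_def)
  next
    case False
    then show ?thesis by (auto simp: coef_def gens_below_def mapp_def)
  qed
qed

lemma mat_kernel_iff_coef:
  assumes "multigraded_map S T A"
  shows "v \<in> mat_kernel A \<longleftrightarrow> v \<in> carrier_vec (length S) \<and>
    (\<forall>a. coef S a v \<in> mker (mcoef S T A) (gens_below T a) (gens_below S a))"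
proof (cases "v \<in> carrier_vec (length S)")
  case True
  have A: "A \<in> carrier_mat (length T) (length S)" using assms by (simp add: multigraded_map_def)
  have "v \<in> mat_kernel A \<longleftrightarrow> A *\<^sub>v v = 0\<^sub>v (length T)"
    using True A by (simp add: mat_kernel[OF A])
  also have "\<dots> \<longleftrightarrow> (\<forall>a. coef T a (A *\<^sub>v v) = 0)"
  proof
    assume "\<forall>a. coef T a (A *\<^sub>v v) = 0"
    then show "A *\<^sub>v v = 0\<^sub>v (length T)"
      using A True by (intro coef_eqI[of _ T]) (auto simp: coef_zero)
  qed (simp add: coef_zero)
  also have "\<dots> \<longleftrightarrow> (\<forall>a. coef S a v \<in> mker (mcoef S T A) (gens_below T a) (gens_below S a))"
    unfolding coef_mult[OF assms True] mker_def using coef_vsupp by blast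
  finally show ?thesis using True by simp
next
  case False
  then show ?thesis using assms by (auto simp: mat_kernel_def multigraded_map_def)
qed

text \<open>Only finitely many degrees occur in \<open>v\<close>, so that homogeneous preimages add up to a preimage.\<close>

lemma mat_range_iff_coef:
  assumes "multigraded_map S T A"
  shows "v \<in> mat_range A \<longleftrightarrow> v \<in> carrier_vec (length T) \<and>
    (\<forall>a. coef T a v \<in> mapp (mcoef S T A) (gens_below T a) (gens_below S a) ` vsupp (gens_below S a))"
    (is "_ \<longleftrightarrow> _ \<and> (\<forall>a. coef T a v \<in> ?I a)")
proof (intro iffI conjI allI)
  have A: "A \<in> carrier_mat (length T) (length S)" using assms by (simp add: multigraded_map_def)
  {
    assume "v \<in> mat_range A"
    then obtain w where w: "v = A *\<^sub>v w" "w \<in> carrier_vec (length S)" using A by (auto simp: mat_range_def)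
    then show "v \<in> carrier_vec (length T)" using A by auto
    fix a show "coef T a v \<in> ?I a"
      unfolding w coef_mult[OF assms w(2)] by (rule imageI) (rule coef_vsupp)
  }
  assume v: "v \<in> carrier_vec (length T) \<and> (\<forall>a. coef T a v \<in> ?I a)"
  \<comment> \<open>A zero component gets the zero preimage; only then do the chosen preimages have
    finite support over all degrees and assemble to polynomials.\<close>
  have "\<exists>x\<in>vsupp (gens_below S a). mapp (mcoef S T A) (gens_below T a) (gens_below S a) x = coef T a v \<and>
      (coef T a v = 0 \<longrightarrow> x = 0)" for a
  proof (cases "coef T a v = 0")
    case True
    have "mapp (mcoef S T A) (gens_below T a) (gens_below S a) 0 = 0" by (auto simp: mapp_def)
    moreover have "0 \<in> vsupp (gens_below S a)" by (simp add: vsupp_def)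
    ultimately show ?thesis using True by metis
  next
    case False
    obtain x where "x \<in> vsupp (gens_below S a)"
      "coef T a v = mapp (mcoef S T A) (gens_below T a) (gens_below S a) x"
      using v by blast
    then show ?thesis using False by (intro bexI[of _ x]) auto
  qed
  then obtain y where y: "\<And>a. y a \<in> vsupp (gens_below S a)"
    "\<And>a. mapp (mcoef S T A) (gens_below T a) (gens_below S a) (y a) = coef T a v"
    "\<And>a. coef T a v = 0 \<Longrightarrow> y a = 0"
    by metis
  have "{a. coef T a v \<noteq> 0} \<subseteq> (\<Union>j<length T. (\<lambda>t. t + T ! j) ` Poly_Mapping.keys (v $ j))"
  proof
    fix a assume "a \<in> {a. coef T a v \<noteq> 0}"
    then obtain j where "coef T a v j \<noteq> 0" by (auto simp: fun_eq_iff)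
    then have j: "j < length T" "dle (T ! j) a" "a - T ! j \<in> Poly_Mapping.keys (v $ j)"
      by (auto simp: coef_def in_keys_iff split: if_splits)
    have "a \<in> (\<lambda>t. t + T ! j) ` Poly_Mapping.keys (v $ j)"
      by (rule image_eqI[OF _ j(3)]) (simp add: dle_diff_add j(2))
    then show "a \<in> (\<Union>j<length T. (\<lambda>t. t + T ! j) ` Poly_Mapping.keys (v $ j))"
      using j(1) by blast
  qed
  then have fin: "finite {a. coef T a v \<noteq> 0}" by (rule finite_subset) auto
  have fin_y: "finite {t. y (t + S ! j) j \<noteq> 0}" for j
  proof (rule finite_subset)
    show "{t. y (t + S ! j) j \<noteq> 0} \<subseteq> (\<lambda>t. t + S ! j) -` {a. coef T a v \<noteq> 0}"
    proof
      fix t assume "t \<in> {t. y (t + S ! j) j \<noteq> 0}"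
      then have "y (t + S ! j) \<noteq> 0" by auto
      then show "t \<in> (\<lambda>t. t + S ! j) -` {a. coef T a v \<noteq> 0}" using y(3) by blast
    qed
    show "finite ((\<lambda>t. t + S ! j) -` {a. coef T a v \<noteq> 0})"
      by (intro finite_vimageI[OF fin] injI) simp
  qed
  define w where "w = vec (length S) (\<lambda>j. Abs_poly_mapping (\<lambda>t. y (t + S ! j) j))"
  have w: "w \<in> carrier_vec (length S)" by (simp add: w_def)
  have "coef S a w = y a" for a
  proof
    fix j show "coef S a w j = y a j"
      using y(1)[of a] fin_y[of j]
      by (auto simp: coef_def w_def dle_diff_add vsupp_def gens_below_def)
  qed
  then have "v = A *\<^sub>v w"
    using v w A by (intro coef_eqI[of _ T]) (auto simp: coef_mult[OF assms w] y(2))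
  then show "v \<in> mat_range A" using w A by (auto simp: mat_range_def)
qed

section \<open>The edge ideal as a monomial ideal\<close>

interpretation mpoly_module: Modules.module "(*) :: ('v, 'k::field) mpoly \<Rightarrow> _"
  by unfold_locales (auto simp: algebra_simps)

text \<open>Polynomials all of whose monomials are divisible by an edge monomial form an ideal
  containing the generators. Conversely each such monomial is a multiple of a generator;
  \<open>x \<noteq> y\<close> enters here, as the exponents at \<open>x\<close> and \<open>y\<close>
  are only known to be positive.\<close>

lemma edge_ideal_iff:
  fixes p :: "('v::finite, 'k::field) mpoly"
  assumes "simple_graph E"
  shows "p \<in> edge_ideal E \<longleftrightarrow> (\<forall>t\<in>Poly_Mapping.keys p. edge_monomial E (Poly_Mapping.lookup t))"
proof
  let ?G = "{indet x * indet y | x y. {x, y} \<in> E} :: ('v, 'k) mpoly set"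
  let ?M = "{p :: ('v, 'k) mpoly. \<forall>t\<in>Poly_Mapping.keys p. edge_monomial E (Poly_Mapping.lookup t)}"
  have gen: "(indet x * indet y :: ('v, 'k) mpoly) = Poly_Mapping.single (unit_deg x + unit_deg y) 1" for x y
    by (simp add: indet_def mult_single)
  have lookup_gen: "Poly_Mapping.lookup (unit_deg x + unit_deg y) v = (if v = x then 1 else 0) + (if v = y then 1 else 0)" for x y v :: 'v
    by (simp add: lookup_add unit_deg_def lookup_single when_def)
  {
    assume "p \<in> edge_ideal E"
    then have "p \<in> mpoly_module.span ?G" by (simp add: edge_ideal_def)
    moreover have "mpoly_module.span ?G \<subseteq> ?M"
    proof (rule mpoly_module.span_minimal)
      show "?G \<subseteq> ?M"
      proof
        fix g :: "('v, 'k) mpoly" assume "g \<in> ?G"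
        then obtain x y where xy: "g = indet x * indet y" "{x, y} \<in> E" by blast
        then have "edge_monomial E (Poly_Mapping.lookup (unit_deg x + unit_deg y))"
          unfolding edge_monomial_def by (intro exI[of _ x] exI[of _ y]) (simp add: lookup_gen)
        then show "g \<in> ?M" by (simp add: xy(1) gen)
      qed
      show "mpoly_module.subspace ?M"
      proof (rule mpoly_module.subspaceI)
        fix x y assume "x \<in> ?M" "y \<in> ?M"
        then show "x + y \<in> ?M" using keys_add[of x y] by blast
      next
        fix c x assume x: "x \<in> ?M"
        show "c * x \<in> ?M"
        proof (rule CollectI, rule ballI)
          fix t assume "t \<in> Poly_Mapping.keys (c * x)"
          then obtain a b where ab: "t = a + b" "b \<in> Poly_Mapping.keys x" using keys_mult[of c x] by blast
          then obtain u v where "{u, v} \<in> E" "0 < Poly_Mapping.lookup b u" "0 < Poly_Mapping.lookup b v"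
            using x by (auto simp: edge_monomial_def)
          then show "edge_monomial E (Poly_Mapping.lookup t)"
            unfolding edge_monomial_def ab lookup_add by fastforce
        qed
      qed simp
    qed
    ultimately show "\<forall>t\<in>Poly_Mapping.keys p. edge_monomial E (Poly_Mapping.lookup t)" by blast
  }
  assume p: "\<forall>t\<in>Poly_Mapping.keys p. edge_monomial E (Poly_Mapping.lookup t)"
  have "Poly_Mapping.single t c \<in> mpoly_module.span ?G" if t: "edge_monomial E (Poly_Mapping.lookup t)" for t c
  proof -
    obtain x y where xy: "{x, y} \<in> E" "0 < Poly_Mapping.lookup t x" "0 < Poly_Mapping.lookup t y"
      using t by (auto simp: edge_monomial_def)
    then have "x \<noteq> y" using simple_graph_irrefl[OF assms, of x] by auto
    then have "dle (unit_deg x + unit_deg y) t" using xy by (simp add: le_fun_def lookup_gen)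
    then have "Poly_Mapping.single t c =
        Poly_Mapping.single (t - (unit_deg x + unit_deg y)) c * (indet x * indet y)"
      unfolding gen mult_single by (simp only: dle_diff_add mult_1_right)
    moreover have "indet x * indet y \<in> ?G" using xy by blast
    ultimately show ?thesis by (simp only: mpoly_module.span_scale mpoly_module.span_base)
  qed
  then have "(\<Sum>t\<in>Poly_Mapping.keys p. Poly_Mapping.single t (Poly_Mapping.lookup p t)) \<in> mpoly_module.span ?G"
    using p by (intro mpoly_module.span_sum) blast
  then show "p \<in> edge_ideal E" by (simp add: sum_single_keys edge_ideal_def)
qed

section \<open>Uniqueness of the Betti numbers\<close>

lemma ex_mdeg:
  fixes c :: "'v::finite \<Rightarrow> nat"
  obtains a where "Poly_Mapping.lookup a = c"
  using that[of "Abs_poly_mapping c"] by simp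

lemma gens_below_eq: "{j. j < length S \<and> Poly_Mapping.lookup (S ! j) \<le> Poly_Mapping.lookup a} = gens_below S a"
  by (simp add: gens_below_def)

lemma zero_in_image: "0 \<in> mapp C B A ` vsupp A"
  by (rule image_eqI[of _ _ 0]) (auto simp: mapp_def vsupp_def)

lemma mapp_cong: "(\<And>k j. k \<in> B \<Longrightarrow> j \<in> A \<Longrightarrow> C k j = C' k j) \<Longrightarrow> mapp C B A = mapp C' B A"
  by (intro ext) (simp add: mapp_def cong: sum.cong)

lemma mker_cong: "(\<And>k j. k \<in> B \<Longrightarrow> j \<in> A \<Longrightarrow> C k j = C' k j) \<Longrightarrow> mker C B A = mker C' B A"
  unfolding mker_def using mapp_cong[of B A C C'] by simp

lemma lookup_augmentation:
  assumes "multigraded_map S [0] A" "v \<in> carrier_vec (length S)"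
  shows "Poly_Mapping.lookup ((A *\<^sub>v v) $ 0) a = (\<Sum>j\<in>gens_below S a. mcoef S [0] A 0 j * coef S a v j)"
proof -
  have z: "0 \<in> gens_below [0] a" by (simp add: gens_below_def le_fun_def)
  have "Poly_Mapping.lookup ((A *\<^sub>v v) $ 0) a = coef [0] a (A *\<^sub>v v) 0"
    using z by (simp add: coef_def gens_below_def)
  also have "\<dots> = (\<Sum>j\<in>gens_below S a. mcoef S [0] A 0 j * coef S a v j)"
    unfolding coef_mult[OF assms] using z by (simp add: mapp_def)
  finally show ?thesis .
qed

lemma augmentation_in_edge_ideal:
  fixes A :: "('v::finite, 'k::field) mpoly mat"
  assumes "simple_graph E" "multigraded_map S [0] A" "v \<in> carrier_vec (length S)"
  shows "(A *\<^sub>v v) $ 0 \<in> edge_ideal E \<longleftrightarrow>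
    (\<forall>a. edge_monomial E (Poly_Mapping.lookup a) \<or> (\<Sum>j\<in>gens_below S a. mcoef S [0] A 0 j * coef S a v j) = 0)"
  unfolding edge_ideal_iff[OF assms(1)] Ball_def in_keys_iff lookup_augmentation[OF assms(2,3)] by blast

text \<open>Exactness is tested on the vectors \<open>hvec\<close>: they have a single nonzero
  component at most, so membership in a kernel or range becomes a statement in one degree. The
  augmentation is tested on the monomial of degree \<open>c\<close>.\<close>

lemma minimal_resolution_graded:
  fixes E :: "'v::finite set set" and D :: "nat \<Rightarrow> ('v, 'k::field) mpoly mat"
  assumes simple: "simple_graph E" and res: "minimal_resolution (edge_ideal E) F D"
  shows "graded_resolution (edge_monomial E) (\<lambda>i. length (F i)) (\<lambda>i j. Poly_Mapping.lookup (F i ! j))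
    (\<lambda>i. case i of 0 \<Rightarrow> mcoef (F 0) [0] (D 0) | Suc i' \<Rightarrow> mcoef (F (Suc i')) (F i') (D (Suc i')))"
    (is "graded_resolution _ _ _ ?C")
proof -
  have aug: "multigraded_map (F 0) [0] (D 0)"
    and mg: "\<And>i. multigraded_map (F (Suc i)) (F i) (D (Suc i))"
    and surj: "\<And>p. \<exists>v\<in>carrier_vec (length (F 0)). p - (D 0 *\<^sub>v v) $ 0 \<in> edge_ideal E"
    and ex0: "{v \<in> carrier_vec (length (F 0)). (D 0 *\<^sub>v v) $ 0 \<in> edge_ideal E} = mat_range (D 1)"
    and ex: "\<And>i. mat_kernel (D (Suc i)) = mat_range (D (Suc (Suc i)))"
    and min: "\<And>i k j. k < length (F i) \<Longrightarrow> j < length (F (Suc i)) \<Longrightarrow>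
       Poly_Mapping.lookup (D (Suc i) $$ (k, j)) 0 = 0"
    using res unfolding minimal_resolution_def by blast+
  let ?e = "\<lambda>a x. \<Sum>j\<in>gens_below (F 0) a. mcoef (F 0) [0] (D 0) 0 j * x j"
  show ?thesis
  proof
    fix k i j assume "?C (Suc i) k j \<noteq> 0"
    then show "Poly_Mapping.lookup (F i ! k) \<le> Poly_Mapping.lookup (F (Suc i) ! j)"
      by (simp add: mcoef_def split: if_splits)
  next
    fix k i j assume kj: "k < length (F i)" "j < length (F (Suc i))"
      "Poly_Mapping.lookup (F i ! k) = Poly_Mapping.lookup (F (Suc i) ! j)"
    then have "F i ! k = F (Suc i) ! j" by (simp add: lookup_inject)
    then show "?C (Suc i) k j = 0" using min[OF kj(1,2)] by (simp add: mcoef_def)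
  next
    fix c :: "'v \<Rightarrow> nat" assume M: "\<not> edge_monomial E c"
    obtain a where a: "Poly_Mapping.lookup a = c" by (rule ex_mdeg)
    obtain v where v: "v \<in> carrier_vec (length (F 0))"
      "Poly_Mapping.single a 1 - (D 0 *\<^sub>v v) $ 0 \<in> edge_ideal E"
      using surj by blast
    then have "Poly_Mapping.lookup (Poly_Mapping.single a 1 - (D 0 *\<^sub>v v) $ 0) a = 0"
      using M a unfolding edge_ideal_iff[OF simple] Ball_def in_keys_iff by blast
    then have "?e a (coef (F 0) a v) = 1"
      by (simp add: lookup_minus lookup_augmentation[OF aug v(1)])
    then show "\<exists>x\<in>vsupp {j. j < length (F 0) \<and> Poly_Mapping.lookup (F 0 ! j) \<le> c}.
        (\<Sum>j | j < length (F 0) \<and> Poly_Mapping.lookup (F 0 ! j) \<le> c. ?C 0 0 j * x j) \<noteq> 0"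
      unfolding a[symmetric] gens_below_eq by (intro bexI[of _ "coef (F 0) a v"] coef_vsupp) simp
  next
    fix c :: "'v \<Rightarrow> nat"
    obtain a where a: "Poly_Mapping.lookup a = c" by (rule ex_mdeg)
    let ?I = "\<lambda>a. mapp (mcoef (F (Suc 0)) (F 0) (D (Suc 0))) (gens_below (F 0) a) (gens_below (F (Suc 0)) a) `
        vsupp (gens_below (F (Suc 0)) a)"
    have iff: "edge_monomial E c \<or> ?e a x = 0 \<longleftrightarrow> x \<in> ?I a" if x: "x \<in> vsupp (gens_below (F 0) a)" for x
    proof -
      let ?v = "hvec (F 0) a x"
      have "edge_monomial E c \<or> ?e a x = 0 \<longleftrightarrow> (D 0 *\<^sub>v ?v) $ 0 \<in> edge_ideal E"
        unfolding augmentation_in_edge_ideal[OF simple aug hvec_carrier] coef_hvec[OF x] using a by auto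
      also have "\<dots> \<longleftrightarrow> ?v \<in> mat_range (D 1)"
        unfolding ex0[symmetric] by (simp add: hvec_carrier)
      also have "\<dots> \<longleftrightarrow> x \<in> ?I a"
        unfolding One_nat_def mat_range_iff_coef[OF mg] coef_hvec[OF x]
        using zero_in_image by (auto simp: hvec_carrier)
      finally show ?thesis .
    qed
    have "{x \<in> vsupp (gens_below (F 0) a). edge_monomial E c \<or> ?e a x = 0} = ?I a"
      using iff mapp_vsupp by blast
    then show "{x \<in> vsupp {j. j < length (F 0) \<and> Poly_Mapping.lookup (F 0 ! j) \<le> c}. edge_monomial E c \<or>
        (\<Sum>j | j < length (F 0) \<and> Poly_Mapping.lookup (F 0 ! j) \<le> c. ?C 0 0 j * x j) = 0} =
      mapp (?C (Suc 0)) {j. j < length (F 0) \<and> Poly_Mapping.lookup (F 0 ! j) \<le> c}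
          {j. j < length (F (Suc 0)) \<and> Poly_Mapping.lookup (F (Suc 0) ! j) \<le> c} `
        vsupp {j. j < length (F (Suc 0)) \<and> Poly_Mapping.lookup (F (Suc 0) ! j) \<le> c}"
      unfolding a[symmetric] gens_below_eq by simp
  next
    fix i and c :: "'v \<Rightarrow> nat"
    obtain a where a: "Poly_Mapping.lookup a = c" by (rule ex_mdeg)
    let ?K = "\<lambda>a. mker (mcoef (F (Suc i)) (F i) (D (Suc i))) (gens_below (F i) a) (gens_below (F (Suc i)) a)"
    let ?I = "\<lambda>a. mapp (mcoef (F (Suc (Suc i))) (F (Suc i)) (D (Suc (Suc i)))) (gens_below (F (Suc i)) a)
        (gens_below (F (Suc (Suc i))) a) ` vsupp (gens_below (F (Suc (Suc i))) a)"
    have iff: "x \<in> ?K a \<longleftrightarrow> x \<in> ?I a" if x: "x \<in> vsupp (gens_below (F (Suc i)) a)" for x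
    proof -
      let ?v = "hvec (F (Suc i)) a x"
      have z: "0 \<in> ?K b" for b using subspace_mker fv.subspace_0 by blast
      have "x \<in> ?K a \<longleftrightarrow> ?v \<in> mat_kernel (D (Suc i))"
        unfolding mat_kernel_iff_coef[OF mg] coef_hvec[OF x] using z by (auto simp: hvec_carrier)
      also have "\<dots> \<longleftrightarrow> ?v \<in> mat_range (D (Suc (Suc i)))"
        unfolding ex ..
      also have "\<dots> \<longleftrightarrow> x \<in> ?I a"
        unfolding mat_range_iff_coef[OF mg] coef_hvec[OF x]
        using zero_in_image by (auto simp: hvec_carrier)
      finally show ?thesis .
    qed
    have "?K a \<subseteq> vsupp (gens_below (F (Suc i)) a)" unfolding mker_def by blast
    then have "?K a = ?I a"
      using iff mapp_vsupp by blast
    then show "mker (?C (Suc i)) {j. j < length (F i) \<and> Poly_Mapping.lookup (F i ! j) \<le> c}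
        {j. j < length (F (Suc i)) \<and> Poly_Mapping.lookup (F (Suc i) ! j) \<le> c} =
      mapp (?C (Suc (Suc i))) {j. j < length (F (Suc i)) \<and> Poly_Mapping.lookup (F (Suc i) ! j) \<le> c}
          {j. j < length (F (Suc (Suc i))) \<and> Poly_Mapping.lookup (F (Suc (Suc i)) ! j) \<le> c} `
        vsupp {j. j < length (F (Suc (Suc i))) \<and> Poly_Mapping.lookup (F (Suc (Suc i)) ! j) \<le> c}"
      unfolding a[symmetric] gens_below_eq by simp
  qed
qed

text \<open>Each scalar is put in front of the monomial of the degree difference, and exactness
  transfers back degree by degree. The first module is R itself with the identity as lifted
  augmentation.\<close>

lemma ex_minimal_resolution:
  fixes E :: "'v::finite set set"
  assumes simple: "simple_graph E"
  shows "\<exists>F D. minimal_resolution (edge_ideal E :: ('v, 'k::field) mpoly set) F D"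
proof -
  obtain len deg and C :: "nat \<Rightarrow> nat \<Rightarrow> nat \<Rightarrow> 'k" where
    gr: "graded_resolution (edge_monomial E) len deg C"
    and zero: "len 0 = 1" "\<And>j. deg 0 j = (\<lambda>_. 0)" "\<And>k j. C 0 k j = 1"
    by (rule ex_graded_resolution[of E]) blast
  interpret graded_resolution "edge_monomial E" len deg C by (rule gr)
  define F where "F i = map (\<lambda>j. Abs_poly_mapping (deg i j)) [0..<len i]" for i
  define D :: "nat \<Rightarrow> ('v, 'k) mpoly mat" where "D i = (case i of 0 \<Rightarrow> mat 1 1 (\<lambda>_. 1)
    | Suc i \<Rightarrow> mat (len i) (len (Suc i)) (\<lambda>(k, j). if deg i k \<le> deg (Suc i) j
        then Poly_Mapping.single (F (Suc i) ! j - F i ! k) (C (Suc i) k j) else 0))" for i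
  have len: "length (F i) = len i" for i by (simp add: F_def)
  have deg: "Poly_Mapping.lookup (F i ! j) = deg i j" if "j < len i" for i j
    using that by (simp add: F_def)
  have F0: "F 0 = [0]" using zero by (simp add: F_def)
  have below: "gens_below (F i) a = {j. j < len i \<and> deg i j \<le> Poly_Mapping.lookup a}" for i a
    unfolding gens_below_def len using deg by auto
  have aug: "multigraded_map (F 0) [0] (D 0)"
    by (simp add: multigraded_map_def D_def F0)
  have mg: "multigraded_map (F (Suc i)) (F i) (D (Suc i))" for i
    unfolding multigraded_map_def
  proof (intro conjI allI impI ballI)
    show "D (Suc i) \<in> carrier_mat (length (F i)) (length (F (Suc i)))" by (simp add: D_def len)
    fix k j t assume kj: "k < length (F i)" "j < length (F (Suc i))"
      and t: "t \<in> Poly_Mapping.keys (D (Suc i) $$ (k, j))"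
    then have le: "deg i k \<le> deg (Suc i) j" and "t = F (Suc i) ! j - F i ! k"
      by (auto simp: D_def len split: if_splits)
    then show "t + F i ! k = F (Suc i) ! j"
      using dle_diff_add[of "F i ! k" "F (Suc i) ! j"] deg kj by (simp add: len)
  qed
  have mcoef: "mcoef (F (Suc i)) (F i) (D (Suc i)) k j = C (Suc i) k j" if kj: "k < len i" "j < len (Suc i)" for i k j
    using graded[OF kj] deg[OF kj(1)] deg[OF kj(2)] kj by (auto simp: mcoef_def D_def)
  have mcoef_0: "mcoef (F 0) [0] (D 0) 0 0 = C 0 0 0"
    by (simp add: mcoef_def D_def F0 zero lookup_one)
  have mapp: "mapp (mcoef (F (Suc i)) (F i) (D (Suc i))) (gens_below (F i) a) (gens_below (F (Suc i)) a) =
      mapp (C (Suc i)) (gens_below (F i) a) (gens_below (F (Suc i)) a)" for i a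
    by (rule mapp_cong) (use mcoef in \<open>auto simp: below\<close>)
  have mker: "mker (mcoef (F (Suc i)) (F i) (D (Suc i))) (gens_below (F i) a) (gens_below (F (Suc i)) a) =
      mker (C (Suc i)) (gens_below (F i) a) (gens_below (F (Suc i)) a)" for i a
    by (rule mker_cong) (use mcoef in \<open>auto simp: below\<close>)
  have "minimal_resolution (edge_ideal E) F D"
    unfolding minimal_resolution_def
  proof (intro conjI allI impI)
    show "multigraded_map (F 0) [0] (D 0)" by (rule aug)
    show "multigraded_map (F (Suc i)) (F i) (D (Suc i))" for i by (rule mg)
    show "\<exists>v\<in>carrier_vec (length (F 0)). p - (D 0 *\<^sub>v v) $ 0 \<in> edge_ideal E" for p :: "('v, 'k) mpoly"
    proof (rule bexI[of _ "vec 1 (\<lambda>_. p)"])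
      have "(D 0 *\<^sub>v vec 1 (\<lambda>_. p)) $ 0 = p" by (simp add: D_def scalar_prod_def)
      then show "p - (D 0 *\<^sub>v vec 1 (\<lambda>_. p)) $ 0 \<in> edge_ideal E" by (simp add: edge_ideal_iff[OF simple])
    qed (simp add: F0)
    show "{v \<in> carrier_vec (length (F 0)). (D 0 *\<^sub>v v) $ 0 \<in> edge_ideal E} = mat_range (D 1)"
    proof (rule Set.set_eqI)
      fix v :: "('v, 'k) mpoly vec"
      have e: "(\<Sum>j\<in>gens_below (F 0) a. mcoef (F 0) [0] (D 0) 0 j * x j) = (\<Sum>j\<in>gens_below (F 0) a. C 0 0 j * x j)"
        for a x
      proof (rule sum.cong[OF refl])
        fix j assume "j \<in> gens_below (F 0) a"
        then have "j = 0" by (simp add: gens_below_def len zero)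
        then show "mcoef (F 0) [0] (D 0) 0 j * x j = C 0 0 j * x j" using mcoef_0 by simp
      qed
      have "v \<in> mat_range (D 1) \<longleftrightarrow> v \<in> carrier_vec (length (F 0)) \<and>
          (\<forall>a. edge_monomial E (Poly_Mapping.lookup a) \<or> (\<Sum>j\<in>gens_below (F 0) a. C 0 0 j * coef (F 0) a v j) = 0)"
        unfolding One_nat_def mat_range_iff_coef[OF mg] mapp
        using coef_vsupp[of "F 0" _ v] unfolding below exact_0[symmetric] by blast
      then show "v \<in> {v \<in> carrier_vec (length (F 0)). (D 0 *\<^sub>v v) $ 0 \<in> edge_ideal E} \<longleftrightarrow> v \<in> mat_range (D 1)"
        using augmentation_in_edge_ideal[OF simple aug, of v] e by auto
    qed
    show "mat_kernel (D (Suc i)) = mat_range (D (Suc (Suc i)))" for i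
    proof (rule Set.set_eqI)
      fix v
      show "v \<in> mat_kernel (D (Suc i)) \<longleftrightarrow> v \<in> mat_range (D (Suc (Suc i)))"
        unfolding mat_kernel_iff_coef[OF mg] mat_range_iff_coef[OF mg] mker mapp
        unfolding below exact_Suc ..
    qed
    show "Poly_Mapping.lookup (D (Suc i) $$ (k, j)) 0 = 0"
      if kj: "k < length (F i)" "j < length (F (Suc i))" for i k j
    proof (cases "deg i k = deg (Suc i) j")
      case True
      then show ?thesis using minimal[of k i j] kj by (simp add: D_def len)
    next
      case False
      have "F (Suc i) ! j - F i ! k \<noteq> 0" if "deg i k \<le> deg (Suc i) j"
        using dle_diff_add[of "F i ! k" "F (Suc i) ! j"] that False deg[of k i] deg[of j "Suc i"] kj
        by (auto simp: len)
      then show ?thesis using kj by (auto simp: D_def len lookup_single when_def)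
    qed
  qed
  then show ?thesis by blast
qed

text \<open>Both resolutions obey the same recursion: every nonempty \<open>W\<close> other than the
  cycle has a vertex of degree at most one, which either makes the value 0 or reduces it to a
  smaller set.\<close>

lemma unicyclic_resolution_H_unique:
  assumes "unicyclic_resolution M len1 deg1 C1 E" "unicyclic_resolution M len2 deg2 C2 E"
  shows "edge_ideal_resolution.H len1 deg1 C1 i W = edge_ideal_resolution.H len2 deg2 C2 i W"
proof -
  interpret r1: unicyclic_resolution M len1 deg1 C1 E by fact
  interpret r2: unicyclic_resolution M len2 deg2 C2 E by fact
  show ?thesis
  proof (induction "card W" arbitrary: W i rule: less_induct)
    case less
    consider "W = {}" | "W = the_cycle E" | v where "v \<in> W" "card (nbrs E v \<inter> W) \<le> 1"
      using r1.ex_degree_le_1[of W] r1.ex_leaf[of W] by (metis DiffD1)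
    then show ?case
    proof cases
      case 1
      then show ?thesis by (simp add: r1.H_empty r2.H_empty)
    next
      case 2
      then show ?thesis by (simp add: r1.H_cycle r2.H_cycle)
    next
      case (3 v)
      show ?thesis
      proof (rule r1.card_le_1_cases[OF 3(2)])
        assume "nbrs E v \<inter> W = {}"
        then show ?thesis using r1.H_isolated[OF 3(1)] r2.H_isolated[OF 3(1)] by simp
      next
        fix u assume u: "nbrs E v \<inter> W = {u}"
        then have "u \<in> W" by blast
        then have "card (W - insert u (nbrs E u)) < card W" by (intro psubset_card_mono) auto
        then show ?thesis
          unfolding r1.H_leaf[OF 3(1) u] r2.H_leaf[OF 3(1) u] by (simp add: less)
      qed
    qed
  qed
qed

lemma gens_unique:
  assumes "unicyclic_resolution M len1 deg1 C1 E" "unicyclic_resolution M len2 deg2 C2 E"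
  shows "card {j. j < len1 i \<and> deg1 i j = a} = card {j. j < len2 i \<and> deg2 i j = a}"
proof -
  interpret r1: unicyclic_resolution M len1 deg1 C1 E by fact
  interpret r2: unicyclic_resolution M len2 deg2 C2 E by fact
  have "int (r1.gens i a) = int (r2.gens i a)"
  proof (rule r1.gens_cases[of i a])
    assume "r1.gens i a = 0" "\<And>W. a \<noteq> sqf W"
    then show ?thesis by (metis r2.gens_cases)
  next
    fix W assume W: "a = sqf W" "int (r1.gens i a) = r1.H i W"
    then show ?thesis
      using r2.H_eq_card[of i W] unicyclic_resolution_H_unique[OF assms, of i W] by (simp add: r2.gens_def)
  qed
  then show ?thesis by (simp add: r1.gens_def r2.gens_def)
qed

lemma minimal_resolution_unicyclic:
  fixes D :: "nat \<Rightarrow> ('v::finite, 'k::field) mpoly mat"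
  assumes "unicyclic E" "minimal_resolution (edge_ideal E) F D"
  obtains C :: "nat \<Rightarrow> nat \<Rightarrow> nat \<Rightarrow> 'k"
  where "unicyclic_resolution (edge_monomial E) (\<lambda>i. length (F i)) (\<lambda>i j. Poly_Mapping.lookup (F i ! j)) C E"
proof -
  interpret unicyclic_graph E by unfold_locales (fact assms(1))
  from minimal_resolution_graded[OF simple assms(2)] show thesis
    by (intro that unicyclic_resolution.intro edge_ideal_resolution.intro edge_ideal_resolution_axioms.intro
        unicyclic_graph_axioms) (auto simp: simple edge_monomial_def)
qed

lemma count_list_card:
  "count_list (S :: 'v mdeg list) a = card {j. j < length S \<and> Poly_Mapping.lookup (S ! j) = Poly_Mapping.lookup a}"
  by (simp add: count_list_eq_length_filter length_filter_conv_card lookup_inject eq_commute)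

text \<open>This replaces the definite description by a count in one fixed resolution: existence
  supplies the resolution, and \<open>gens_unique\<close> gives the same count for all
  others.\<close>

lemma betti_gens:
  fixes E :: "'v::finite set set"
  assumes "unicyclic E"
  obtains len deg and C :: "nat \<Rightarrow> nat \<Rightarrow> nat \<Rightarrow> 'k::field"
  where "unicyclic_resolution (edge_monomial E) len deg C E"
    "\<And>i a. betti (edge_ideal E :: ('v, 'k) mpoly set) i a = card {j. j < len i \<and> deg i j = Poly_Mapping.lookup a}"
proof -
  let ?I = "edge_ideal E :: ('v, 'k) mpoly set"
  have "simple_graph E" using assms by (simp add: unicyclic_def)
  then obtain F D where FD: "minimal_resolution ?I F D" using ex_minimal_resolution by blast
  obtain C :: "nat \<Rightarrow> nat \<Rightarrow> nat \<Rightarrow> 'k" where C: "unicyclic_resolution (edge_monomial E) (\<lambda>i. length (F i))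
      (\<lambda>i j. Poly_Mapping.lookup (F i ! j)) C E"
    by (rule minimal_resolution_unicyclic[OF assms FD])
  have "betti ?I i a = count_list (F i) a" for i a
    unfolding betti_def
  proof (rule the_equality)
    show "\<exists>F' D'. minimal_resolution ?I F' D' \<and> count_list (F i) a = count_list (F' i) a"
      using FD by blast
    fix b assume "\<exists>F' D'. minimal_resolution ?I F' D' \<and> b = count_list (F' i) a"
    then obtain F' D' where b: "minimal_resolution ?I F' D'" "b = count_list (F' i) a" by blast
    obtain C' :: "nat \<Rightarrow> nat \<Rightarrow> nat \<Rightarrow> 'k" where "unicyclic_resolution (edge_monomial E) (\<lambda>i. length (F' i))
        (\<lambda>i j. Poly_Mapping.lookup (F' i ! j)) C' E"
      by (rule minimal_resolution_unicyclic[OF assms b(1)])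
    from gens_unique[OF this C, of i "Poly_Mapping.lookup a"] show "b = count_list (F i) a"
      by (simp add: b(2) count_list_card)
  qed
  then show thesis using that[OF C] by (simp add: count_list_card)
qed

theorem theorem4p1:
  fixes E :: "'v::finite set set"
    and I :: "('v, 'k::field) mpoly set"
  assumes "unicyclic E"
    and "I = edge_ideal E"
  shows "(\<not> 3 dvd girth E \<longrightarrow> (\<forall>i\<ge>1. \<forall>a. betti I i a \<in> {0, 1})) \<and>
    (\<forall>k. girth E = 3 * k \<longrightarrow>
       (\<forall>i\<ge>1. \<forall>a. betti I i a \<in> {0, 1, 2}) \<and>
       ((\<forall>v. dist_to_set E v (the_cycle E) \<le> 2) \<longrightarrow>
          (\<forall>i a. betti I i a = 2 \<longleftrightarrow>
             i = 2 * k \<and> a = (\<Sum>x\<in>the_cycle E. unit_deg x))))"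
proof -
  obtain len deg and C :: "nat \<Rightarrow> nat \<Rightarrow> nat \<Rightarrow> 'k" where
    res: "unicyclic_resolution (edge_monomial E) len deg C E"
    and betti: "\<And>i a. betti I i a = card {j. j < len i \<and> deg i j = Poly_Mapping.lookup a}"
    unfolding assms(2) by (rule betti_gens[OF assms(1)]) blast
  interpret unicyclic_resolution "edge_monomial E" len deg C E by (rule res)
  have gens: "betti I i a = gens i (Poly_Mapping.lookup a)" for i a by (simp add: betti gens_def)
  have le: "betti I i a \<le> (if 3 dvd girth E then 2 else 1)" for i a
    unfolding gens by (rule gens_le)
  have sqf: "Poly_Mapping.lookup a = sqf cyc \<longleftrightarrow> a = (\<Sum>x\<in>cyc. unit_deg x)" for a
  proof -
    have "Poly_Mapping.lookup (\<Sum>x\<in>cyc. unit_deg x) = sqf cyc"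
      by (auto simp: fun_eq_iff lookup_sum unit_deg_def lookup_single when_def sqf_def)
    then show ?thesis by (metis lookup_inject)
  qed
  have "betti I i a \<in> {0, 1}" if "\<not> 3 dvd girth E" for i a
    using le[of i a] that by auto
  then have 1: "\<not> 3 dvd girth E \<longrightarrow> (\<forall>i\<ge>1. \<forall>a. betti I i a \<in> {0, 1})" by blast
  have 2: "betti I i a \<in> {0, 1, 2}" if "girth E = 3 * k" for i a k
    using le[of i a] that by auto
  have 3: "betti I i a = 2 \<longleftrightarrow> i = 2 * k \<and> a = (\<Sum>x\<in>cyc. unit_deg x)"
    if "girth E = 3 * k" "\<forall>v. dist_to_set E v cyc \<le> 2" for i a k
    unfolding gens sqf[symmetric] using that by (intro gens_eq_2_iff) auto
  show ?thesis using 1 2 3 by simp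
qed

end
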